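(* Let $b>0$ and $0\le\omega<\pi^2$ be constants and consider the autonomous problem (P). Then every non-negative bounded complete trajectory $\varphi$ of (P) which is neither identically $0$ nor identically equal to $v_1^+$ is of the form: there exists $\tau\in\mathbb{R}$ with $\varphi(t)=0$ for $t\le\tau$ and $\varphi(t)=u(t)$ for $t\ge\tau$, where $u$ is the unique solution on $[\tau,+\infty)$ of $\partial_t u-\partial_{xx}u=b+\omega u$ on $(\tau,\infty)\times(0,1)$, $u(t,0)=u(t,1)=0$, $u(\tau)=0$.
   Context: $H=L^2(0,1)$, $V=H_0^1(0,1)$, $A=-d^2/dx^2$ with $D(A)=H^2(0,1)\cap V$. $H_0(s)=\{-1\}$ for $s<0$, $[-1,1]$ for $s=0$, $\{1\}$ for $s>0$. Problem (P) with initial time $\tau$ and datum $u_\tau\in H$: $\partial_t u-\partial_{xx}u\in bH_0(u)+\omega u$ on $(\tau,\infty)\times(0,1)$, $u(t,0)=u(t,1)=0$, $u(\tau)=u_\tau$. A solution is $u\in C([\tau,\infty),H)$ with $u(\tau)=u_\tau$, absolutely continuous on each $[T_1,T_2]$ with $\tau<T_1<T_2$, $u(t)\in D(A)$ for a.e. $t$, and such that there is $r\in L^2_{loc}(\tau,\infty;H)$ with $r(t)(x)\in bH_0(u(t)(x))+\omega u(t)(x)$ for a.e. $x$, for a.e. $t$, and $du/dt+Au=r$ in $H$ for a.e. $t>\tau$; the linear problem is understood in the same sense with $r=b+\omega u$. A complete trajectory is $\varphi:\mathbb{R}\to H$ such that $\varphi|_{[\tau,\infty)}$ is a solution with initial time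 $\tau$ for every $\tau$; it is bounded if its range is bounded in $H$ and non-negative if $\varphi(t)\ge0$ a.e. for all $t$. $v_1^+$ denotes the positive stationary solution: the unique $v\in H^2(0,1)\cap V$, positive on $(0,1)$, with $-v''=b+\omega v$ on $(0,1)$, $v(0)=v(1)=0$ (viewed as a constant complete trajectory). *)

theory Defs
  imports "HOL-Analysis.Analysis"
begin

text \<open>Elements of H = L^2(0,1) are represented by functions real => real;
  equality in H is equality almost everywhere on (0,1), i.e. Hnorm of the difference is 0.\<close>

definition inH :: "(real \<Rightarrow> real) \<Rightarrow> bool" where
  "inH f \<longleftrightarrow> set_borel_measurable lborel {0<..<1} f \<and>
              set_integrable lborel {0<..<1} (\<lambda>x. (f x)^2)"

definition Hnorm :: "(real \<Rightarrow> real) \<Rightarrow> real" where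
  "Hnorm f = sqrt (LINT x:{0<..<1}|lborel. (f x)^2)"

text \<open>g is C^1 on [0,1], g' is absolutely continuous with g'' = h in L^2(0,1)
  (i.e. g is the continuous representative of an element of H^2(0,1) with g'' = h).\<close>
definition second_deriv_L2 :: "(real \<Rightarrow> real) \<Rightarrow> (real \<Rightarrow> real) \<Rightarrow> bool" where
  "second_deriv_L2 g h \<longleftrightarrow> inH h \<and>
     (\<exists>g1. \<forall>x\<in>{0..1}. (g has_real_derivative g1 x) (at x within {0..1}) \<and>
                        g1 x = g1 0 + (LBINT y=0..x. h y))"

text \<open>opA u w : u \<in> D(A) = H^2(0,1) \<inter> H_0^1(0,1) and A u = - u'' = w in H.\<close>
definition opA :: "(real \<Rightarrow> real) \<Rightarrow> (real \<Rightarrow> real) \<Rightarrow> bool" where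
  "opA u w \<longleftrightarrow> inH u \<and> inH w \<and>
     (\<exists>g. (AE x in lborel. 0 < x \<and> x < 1 \<longrightarrow> u x = g x) \<and> g 0 = 0 \<and> g 1 = 0 \<and>
          second_deriv_L2 g (\<lambda>x. - w x))"

definition H_deriv :: "(real \<Rightarrow> real \<Rightarrow> real) \<Rightarrow> real \<Rightarrow> (real \<Rightarrow> real) \<Rightarrow> bool" where
  "H_deriv u t v \<longleftrightarrow> inH v \<and>
     ((\<lambda>s. Hnorm (\<lambda>x. (u s x - u t x) / (s - t) - v x)) \<longlongrightarrow> 0) (at t)"

definition H_abs_cont :: "(real \<Rightarrow> real \<Rightarrow> real) \<Rightarrow> real \<Rightarrow> real \<Rightarrow> bool" where
  "H_abs_cont u T1 T2 \<longleftrightarrow>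
     (\<forall>\<epsilon>>0. \<exists>\<delta>>0. \<forall>n (a :: nat \<Rightarrow> real) (c :: nat \<Rightarrow> real).
        (\<forall>i<n. T1 \<le> a i \<and> a i \<le> c i \<and> c i \<le> T2) \<and>
        disjoint_family_on (\<lambda>i. {a i<..<c i}) {..<n} \<and>
        (\<Sum>i<n. c i - a i) < \<delta> \<longrightarrow>
        (\<Sum>i<n. Hnorm (\<lambda>x. u (c i) x - u (a i) x)) < \<epsilon>)"

text \<open>Generic notion of solution: F s y means that the value y is admissible for r
  at a point where the solution has value s.\<close>
definition is_solution ::
  "(real \<Rightarrow> real \<Rightarrow> bool) \<Rightarrow> real \<Rightarrow> (real \<Rightarrow> real) \<Rightarrow> (real \<Rightarrow> real \<Rightarrow> real) \<Rightarrow> bool" where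
  "is_solution F \<tau> u0 u \<longleftrightarrow>
     (\<forall>t\<ge>\<tau>. inH (u t)) \<and>
     (\<forall>t\<ge>\<tau>. ((\<lambda>s. Hnorm (\<lambda>x. u s x - u t x)) \<longlongrightarrow> 0) (at t within {\<tau>..})) \<and>
     Hnorm (\<lambda>x. u \<tau> x - u0 x) = 0 \<and>
     (\<forall>T1 T2. \<tau> < T1 \<and> T1 < T2 \<longrightarrow> H_abs_cont u T1 T2) \<and>
     (\<exists>r :: real \<Rightarrow> real \<Rightarrow> real.
        (\<lambda>(t, x). r t x) \<in> borel_measurable (lborel \<Otimes>\<^sub>M lborel) \<and>
        (\<forall>T>\<tau>. set_integrable (lborel \<Otimes>\<^sub>M lborel) ({\<tau><..<T} \<times> {0<..<1})
                    (\<lambda>(t, x). (r t x)^2)) \<and>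
        (AE t in lborel. \<tau> < t \<longrightarrow>
            (AE x in lborel. 0 < x \<and> x < 1 \<longrightarrow> F (u t x) (r t x))) \<and>
        (AE t in lborel. \<tau> < t \<longrightarrow>
            (\<exists>v w. H_deriv u t v \<and> opA (u t) w \<and>
                   Hnorm (\<lambda>x. v x + w x - r t x) = 0)))"

definition H0 :: "real \<Rightarrow> real set" where
  "H0 s = (if s < 0 then {-1} else if s = 0 then {-1..1} else {1})"

definition F_P :: "real \<Rightarrow> real \<Rightarrow> real \<Rightarrow> real \<Rightarrow> bool" where
  "F_P b \<omega> s y \<longleftrightarrow> y - \<omega> * s \<in> (\<lambda>z. b * z) ` H0 s"

definition F_lin :: "real \<Rightarrow> real \<Rightarrow> real \<Rightarrow> real \<Rightarrow> bool" where
  "F_lin b \<omega> s y \<longleftrightarrow> y = b + \<omega> * s"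

definition complete_trajectory :: "(real \<Rightarrow> real \<Rightarrow> bool) \<Rightarrow> (real \<Rightarrow> real \<Rightarrow> real) \<Rightarrow> bool" where
  "complete_trajectory F \<phi> \<longleftrightarrow> (\<forall>\<tau>. is_solution F \<tau> (\<phi> \<tau>) \<phi>)"

text \<open>Positive stationary solution (continuous representative on [0,1]).\<close>
definition pos_stationary :: "real \<Rightarrow> real \<Rightarrow> (real \<Rightarrow> real) \<Rightarrow> bool" where
  "pos_stationary b \<omega> v \<longleftrightarrow> v 0 = 0 \<and> v 1 = 0 \<and>
     second_deriv_L2 v (\<lambda>x. - (b + \<omega> * v x)) \<and> (\<forall>x\<in>{0<..<1}. v x > 0)"

definition v1plus :: "real \<Rightarrow> real \<Rightarrow> real \<Rightarrow> real" where
  "v1plus b \<omega> = (THE v. pos_stationary b \<omega> v \<and> (\<forall>x. x \<notin> {0..1} \<longrightarrow> v x = 0))"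

end

theory Submission
  imports Defs
begin

text \<open>
  A non-negative solution has vanishing time derivative (it is minimal there) and vanishing second
  space derivative almost everywhere on its zero set. So the source, which is \<open>b + \<omega>u\<close> where
  \<open>u > 0\<close>, is \<open>0\<close> almost everywhere where \<open>u = 0\<close>, and \<open>u\<close> is a supersolution of the heat equation.
  Testing with non-negative subsolutions \<open>z\<close> of the backward heat equation, \<open>\<integral>u z\<close> is
  nondecreasing in time. The choice \<open>z = exp (\<pi>\<^sup>2t) sin (\<pi>x)\<close> shows that \<open>u\<close>, once nonzero, stays
  nonzero; a cut-off of the heat kernel reflected at the end points, concentrating at a given point,
  shows that \<open>u > 0\<close> on \<open>(0,1)\<close> as long as \<open>u\<close> is nonzero. From its first nonzero time on, the
  trajectory therefore solves the linear problem. Differences of solutions of the linear problem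
  decay exponentially by the Poincare inequality and \<open>\<omega> < \<pi>\<^sup>2\<close>. This gives uniqueness forward in
  time, and it makes a trajectory that is never zero invariant under time shifts, hence equal to the
  positive stationary solution.
\<close>

section \<open>The Hilbert space \<open>L\<^sup>2(0,1)\<close>\<close>

text \<open>Two features of the problem shape the argument. Zero data admit several solutions, so
  (P) has no comparison principle; only after the source is known to vanish on the zero set is it
  non-negative (here \<omega> \<ge> 0 enters), and then linear heat comparison suffices. Moreover,
  the equation holds only at almost every time and with values in H. Monotonicity in time is
  therefore proved for real functions of t whose derivative has a sign almost everywhere and whose
  increments are controlled by the absolutely continuous trajectory. One reflection of the kernel in
  each end point is enough: it makes the boundary values non-positive, and a convex cut-off turns
  them into zeros while keeping a subsolution. Concentration at a point a detects a zero of g there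
  because g x = O(|x - a|), which balances the growth of the kernel: the product stays bounded and
  tends to 0 off a, whereas the transported mass stays above a positive constant. A trajectory that
  is never zero is compared with its own translates from arbitrarily far in the past, where
  boundedness controls the difference.\<close>

definition U01 :: "real measure" where
  "U01 = restrict_space lborel {0<..<1}"

lemma space_U01 [simp]: "space U01 = {0<..<1}"
  by (simp add: U01_def)

lemma finite_measure_U01: "finite_measure U01"
  by (rule finite_measureI) (simp add: U01_def emeasure_restrict_space)

lemma measure_U01_le: "measure U01 A \<le> 1"
proof (cases "A \<in> sets U01")
  case True
  then have "measure U01 A \<le> measure U01 (space U01)"
    by (intro finite_measure.bounded_measure finite_measure_U01)
  also have "\<dots> = 1" unfolding U01_def by (simp add: measure_restrict_space)
  finally show ?thesis .
qed (simp add: measure_notin_sets)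

lemma AE_U01: "(AE x in U01. P x) \<longleftrightarrow> (AE x in lborel. 0 < x \<and> x < 1 \<longrightarrow> P x)"
  unfolding U01_def by (subst AE_restrict_space_iff) auto

lemma measurable_U01: "f \<in> borel_measurable U01 \<longleftrightarrow> set_borel_measurable lborel {0<..<1} f"
  for f :: "real \<Rightarrow> real"
  unfolding U01_def set_borel_measurable_def
  by (subst borel_measurable_restrict_space_iff) auto

lemma integrable_U01: "integrable U01 f \<longleftrightarrow> set_integrable lborel {0<..<1} f"
  for f :: "real \<Rightarrow> real"
  unfolding U01_def set_integrable_def by (subst integrable_restrict_space) auto

lemma integral_U01: "integral\<^sup>L U01 f = (LINT x:{0<..<1}|lborel. f x)"
  for f :: "real \<Rightarrow> real"
  unfolding U01_def set_lebesgue_integral_def by (subst integral_restrict_space) auto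

lemma inH_iff: "inH f \<longleftrightarrow> f \<in> borel_measurable U01 \<and> integrable U01 (\<lambda>x. (f x)^2)"
  unfolding inH_def measurable_U01 integrable_U01 ..

lemma Hnorm_eq: "Hnorm f = sqrt (\<integral>x. (f x)^2 \<partial>U01)"
  unfolding Hnorm_def integral_U01 ..

lemma Hnorm_nonneg: "0 \<le> Hnorm f"
  unfolding Hnorm_eq by (simp add: integral_nonneg_AE)

lemma Hnorm_power2: "(Hnorm f)^2 = (\<integral>x. (f x)^2 \<partial>U01)"
  unfolding Hnorm_eq by (simp add: integral_nonneg_AE)

lemma inH_measurable [measurable_dest]: "inH f \<Longrightarrow> f \<in> borel_measurable U01"
  by (simp add: inH_iff)

lemma integrable_mult_inH:
  assumes "inH f" "inH g" shows "integrable U01 (\<lambda>x. f x * g x)"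
proof (rule Bochner_Integration.integrable_bound)
  show "integrable U01 (\<lambda>x. (f x)^2 + (g x)^2)"
    using assms by (auto simp: inH_iff)
  show "(\<lambda>x. f x * g x) \<in> borel_measurable U01"
    using assms by measurable
  have "\<bar>a * c\<bar> \<le> \<bar>a^2 + c^2\<bar>" for a c :: real
    using sum_squares_bound[of "\<bar>a\<bar>" "\<bar>c\<bar>", unfolded power2_abs mult.assoc]
      mult_nonneg_nonneg[OF abs_ge_zero abs_ge_zero, of a c]
    unfolding abs_mult by linarith
  then show "AE x in U01. norm (f x * g x) \<le> norm ((f x)^2 + (g x)^2)"
    by simp
qed

lemma inH_add [intro]: assumes "inH f" "inH g" shows "inH (\<lambda>x. f x + g x)"
proof -
  have "integrable U01 (\<lambda>x. (f x)^2 + (g x)^2 + 2 * (f x * g x))"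
    using assms integrable_mult_inH[OF assms]
    by (intro Bochner_Integration.integrable_add integrable_mult_right) (auto simp: inH_iff)
  then show ?thesis
    using assms by (auto simp: inH_iff power2_sum mult.assoc)
qed

lemma inH_cmult [intro]: "inH f \<Longrightarrow> inH (\<lambda>x. c * f x)"
  by (auto simp: inH_iff power_mult_distrib)

lemma inH_minus [intro]: "inH f \<Longrightarrow> inH (\<lambda>x. - f x)"
  using inH_cmult[of f "-1"] by simp

lemma inH_diff [intro]: "inH f \<Longrightarrow> inH g \<Longrightarrow> inH (\<lambda>x. f x - g x)"
  using inH_add[of f "\<lambda>x. - g x"] by auto

lemma inH_divide [intro]: "inH f \<Longrightarrow> inH (\<lambda>x. f x / c)"
  using inH_cmult[of f "1/c"] by simp

lemma inH_bounded:
  assumes "f \<in> borel_measurable U01" "inH g" "AE x in U01. \<bar>f x\<bar> \<le> \<bar>g x\<bar>"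
  shows "inH f"
  unfolding inH_iff
proof
  show "integrable U01 (\<lambda>x. (f x)^2)"
  proof (rule Bochner_Integration.integrable_bound)
    show "integrable U01 (\<lambda>x. (g x)^2)" using assms by (simp add: inH_iff)
    show "(\<lambda>x. (f x)^2) \<in> borel_measurable U01" using assms by measurable
    show "AE x in U01. norm ((f x)\<^sup>2) \<le> norm ((g x)\<^sup>2)"
      using assms(3) by eventually_elim (simp add: abs_le_square_iff)
  qed
qed fact

lemma inH_const [intro, simp]: "inH (\<lambda>x. c)"
  unfolding inH_iff using finite_measure.integrable_const[OF finite_measure_U01] by auto

lemma inH_const_bounded:
  assumes "f \<in> borel_measurable U01" "AE x in U01. \<bar>f x\<bar> \<le> B"
  shows "inH f"
  by (rule inH_bounded[OF assms(1) inH_const[of B]]) (use assms(2) in auto)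

lemma inH_integrable: "inH f \<Longrightarrow> integrable U01 f"
  using integrable_mult_inH[of f "\<lambda>x. 1"] by simp

lemma continuous_on_measurable_U01:
  fixes f :: "real \<Rightarrow> real"
  assumes "continuous_on {0..1} f"
  shows "f \<in> borel_measurable U01"
proof -
  have "continuous_on {0<..<1} f"
    by (rule continuous_on_subset[OF assms]) auto
  then have "f \<in> borel_measurable (restrict_space borel {0<..<1})"
    by (rule borel_measurable_continuous_on_restrict)
  also have "borel_measurable (restrict_space borel {0<..<1}) = (borel_measurable U01 :: (real \<Rightarrow> real) set)"
    unfolding U01_def by (intro measurable_cong_sets sets_restrict_space_cong) auto
  finally show ?thesis .
qed

lemma continuous_on_bounded_abs:
  fixes f :: "real \<Rightarrow> real"
  assumes "continuous_on {0..1} f"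
  obtains B where "B > 0" "\<And>x. x \<in> {0..1} \<Longrightarrow> \<bar>f x\<bar> \<le> B"
proof -
  have "bounded (f ` {0..1})"
    by (intro compact_imp_bounded compact_continuous_image assms) auto
  then show ?thesis
    unfolding bounded_pos using that by auto
qed

lemma continuous_on_inH:
  fixes f :: "real \<Rightarrow> real"
  assumes "continuous_on {0..1} f"
  shows "inH f"
proof -
  obtain B where "\<And>x. x \<in> {0..1} \<Longrightarrow> \<bar>f x\<bar> \<le> B"
    using continuous_on_bounded_abs[OF assms] by metis
  then show ?thesis
    by (intro inH_const_bounded[of _ B] continuous_on_measurable_U01 assms AE_I2) auto
qed

lemma inH_cong_AE:
  assumes "inH f" "g \<in> borel_measurable U01" "AE x in U01. f x = g x"
  shows "inH g"
  by (rule inH_bounded[OF assms(2,1)]) (use assms(3) in auto)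

lemma Hnorm_cong_AE:
  assumes "f \<in> borel_measurable U01" "g \<in> borel_measurable U01" "AE x in U01. f x = g x"
  shows "Hnorm f = Hnorm g"
  unfolding Hnorm_eq
  by (intro arg_cong[where f = sqrt] integral_cong_AE) (use assms in auto)

lemma Hnorm_eq_0_iff:
  assumes "inH f" shows "Hnorm f = 0 \<longleftrightarrow> (AE x in U01. f x = 0)"
proof -
  have "Hnorm f = 0 \<longleftrightarrow> (AE x in U01. (f x)^2 = 0)"
    unfolding Hnorm_eq real_sqrt_eq_zero_cancel_iff
    by (rule integral_nonneg_eq_0_iff_AE) (use assms in \<open>auto simp: inH_iff\<close>)
  then show ?thesis by simp
qed

lemma Cauchy_Schwarz_U01:
  assumes "inH f" "inH g"
  shows "\<bar>\<integral>x. f x * g x \<partial>U01\<bar> \<le> Hnorm f * Hnorm g"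
proof -
  define a where "a = (Hnorm f)^2"
  define c where "c = (Hnorm g)^2"
  define m where "m = (\<integral>x. f x * g x \<partial>U01)"
  have ints: "integrable U01 (\<lambda>x. (f x)^2)" "integrable U01 (\<lambda>x. (g x)^2)"
    "integrable U01 (\<lambda>x. f x * g x)"
    using assms integrable_mult_inH[OF assms] by (auto simp: inH_iff)
  have q: "0 \<le> p^2 * a + 2 * p * q * m + q^2 * c" for p q
  proof -
    have "0 \<le> (\<integral>x. (p * f x + q * g x)^2 \<partial>U01)"
      by (simp add: integral_nonneg_AE)
    also have "\<dots> = (\<integral>x. p^2 * (f x)^2 + 2 * p * q * (f x * g x) + q^2 * (g x)^2 \<partial>U01)"
      by (intro Bochner_Integration.integral_cong) (auto simp: power2_eq_square algebra_simps)
    also have "\<dots> = p^2 * a + 2 * p * q * m + q^2 * c"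
      using ints by (simp add: a_def c_def m_def Hnorm_power2)
    finally show ?thesis .
  qed
  have "m^2 \<le> a * c"
  \<comment> \<open>The quadratic form in fact \<open>q\<close> is non-negative. If c = 0 it is
    affine in its second variable, and the witness below, which makes \<open>a - 2 * k * m^2\<close>
    equal to -1, excludes m \<noteq> 0; otherwise the arguments c and -m give the discriminant
    bound.\<close>
  proof (cases "c = 0")
    case True
    have "\<exists>k. a - 2 * k * m^2 < 0" if "m \<noteq> 0"
      by (rule exI[of _ "(a+1)/(2*m^2)"]) (use that in simp)
    moreover have "0 \<le> a - 2 * k * m^2" for k
      using q[of 1 "-k*m"] True by (simp add: power2_eq_square)
    ultimately have "m = 0" by (meson not_le)
    then show ?thesis using True by simp
  next
    case False
    then have "c > 0" by (simp add: c_def)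
    have "0 \<le> c * (a * c - m^2)"
      using q[of c "-m"] by (simp add: power2_eq_square algebra_simps)
    then show ?thesis using \<open>c > 0\<close> by (simp add: zero_le_mult_iff)
  qed
  then have "sqrt (m^2) \<le> sqrt (a * c)" by (rule real_sqrt_le_mono)
  then show ?thesis
    by (simp add: m_def a_def c_def real_sqrt_mult Hnorm_nonneg)
qed

lemma integral_abs_le_Hnorm:
  assumes "inH f"
  shows "(\<integral>x. \<bar>f x\<bar> \<partial>U01) \<le> Hnorm f"
proof -
  have "inH (\<lambda>x. \<bar>f x\<bar>)"
    by (rule inH_bounded[OF _ assms]) (use assms in auto)
  then have "\<bar>\<integral>x. \<bar>f x\<bar> * 1 \<partial>U01\<bar> \<le> Hnorm (\<lambda>x. \<bar>f x\<bar>) * Hnorm (\<lambda>x. 1)"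
    by (rule Cauchy_Schwarz_U01) simp
  moreover have "Hnorm (\<lambda>x. 1) \<le> 1"
    unfolding Hnorm_eq using measure_U01_le[of "{0<..<1}"] by simp
  moreover have "Hnorm (\<lambda>x. \<bar>f x\<bar>) = Hnorm f" by (simp add: Hnorm_eq)
  ultimately show ?thesis
    using mult_left_mono[of "Hnorm (\<lambda>x. 1)" 1 "Hnorm f"] Hnorm_nonneg[of f] by simp
qed

text \<open>Test functions come with pointwise bounds, so the pairing is estimated by their
  supremum; no further constant arises because the interval has length 1.\<close>

lemma integral_bounded_mult_le:
  assumes "inH f" "z \<in> borel_measurable U01" "\<And>x. x \<in> {0<..<1} \<Longrightarrow> \<bar>z x\<bar> \<le> B"
  shows "\<bar>\<integral>x. f x * z x \<partial>U01\<bar> \<le> B * Hnorm f"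
proof -
  have B: "0 \<le> B" using assms(3)[of "1/2"] by force
  have "inH z" using assms by (intro inH_const_bounded[of _ B] AE_I2) auto
  then have i: "integrable U01 (\<lambda>x. f x * z x)" using assms by (intro integrable_mult_inH)
  have "\<bar>\<integral>x. f x * z x \<partial>U01\<bar> \<le> (\<integral>x. \<bar>f x * z x\<bar> \<partial>U01)" by (rule integral_abs_bound)
  also have "\<dots> \<le> (\<integral>x. B * \<bar>f x\<bar> \<partial>U01)"
  proof (rule integral_mono)
    show "integrable U01 (\<lambda>x. \<bar>f x * z x\<bar>)" using i by (rule integrable_abs)
    show "\<bar>f x * z x\<bar> \<le> B * \<bar>f x\<bar>" if "x \<in> space U01" for x
      using assms(3)[of x] that mult_right_mono[of "\<bar>z x\<bar>" B "\<bar>f x\<bar>"]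
      by (simp add: abs_mult mult.commute)
  qed (use inH_integrable[OF assms(1)] in auto)
  also have "\<dots> = B * (\<integral>x. \<bar>f x\<bar> \<partial>U01)" by simp
  also have "\<dots> \<le> B * Hnorm f"
    by (intro mult_left_mono integral_abs_le_Hnorm assms B)
  finally show ?thesis .
qed

lemma Hnorm_triangle:
  assumes "inH f" "inH g"
  shows "Hnorm (\<lambda>x. f x + g x) \<le> Hnorm f + Hnorm g"
proof (rule power2_le_imp_le)
  have ints: "integrable U01 (\<lambda>x. (f x)^2)" "integrable U01 (\<lambda>x. (g x)^2)"
    "integrable U01 (\<lambda>x. f x * g x)"
    using assms integrable_mult_inH[OF assms] by (auto simp: inH_iff)
  have "(Hnorm (\<lambda>x. f x + g x))^2 = (\<integral>x. (f x)^2 + (g x)^2 + 2 * (f x * g x) \<partial>U01)"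
    unfolding Hnorm_power2
    by (intro Bochner_Integration.integral_cong) (auto simp: power2_eq_square algebra_simps)
  also have "\<dots> = (Hnorm f)^2 + (Hnorm g)^2 + 2 * (\<integral>x. f x * g x \<partial>U01)"
    using ints by (simp add: Hnorm_power2)
  also have "\<dots> \<le> (Hnorm f + Hnorm g)^2"
    using Cauchy_Schwarz_U01[OF assms] by (simp add: power2_sum)
  finally show "(Hnorm (\<lambda>x. f x + g x))\<^sup>2 \<le> (Hnorm f + Hnorm g)\<^sup>2" .
qed (simp add: Hnorm_nonneg)

lemma Hnorm_uminus: "Hnorm (\<lambda>x. - f x) = Hnorm f"
  by (simp add: Hnorm_eq)

lemma Hnorm_minus_commute: "Hnorm (\<lambda>x. f x - g x) = Hnorm (\<lambda>x. g x - f x)"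
  by (simp add: Hnorm_eq power2_commute)

lemma Hnorm_triangle_diff:
  assumes "inH f" "inH g"
  shows "Hnorm (\<lambda>x. f x - g x) \<le> Hnorm f + Hnorm g"
  using Hnorm_triangle[OF assms(1) inH_minus[OF assms(2)]] by (simp add: Hnorm_uminus)

lemma Hnorm_diff_le:
  assumes "inH f" "inH g"
  shows "\<bar>Hnorm f - Hnorm g\<bar> \<le> Hnorm (\<lambda>x. f x - g x)"
  using Hnorm_triangle[OF inH_diff[OF assms] assms(2)]
    Hnorm_triangle[OF inH_diff[OF assms(2,1)] assms(1)] Hnorm_minus_commute[of f g] by simp

lemma Hnorm_mono:
  assumes "f \<in> borel_measurable U01" "inH g" "AE x in U01. \<bar>f x\<bar> \<le> \<bar>g x\<bar>"
  shows "Hnorm f \<le> Hnorm g"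
proof -
  have "inH f" by (rule inH_bounded[OF assms])
  then show ?thesis
    unfolding Hnorm_eq using assms
    by (intro real_sqrt_le_mono integral_mono_AE) (auto simp: inH_iff abs_le_square_iff)
qed

section \<open>Monotonicity from the sign of the derivative almost everywhere\<close>

text \<open>Divisions fine for a gauge are indexed by tagged intervals, \<open>H_abs_cont\<close> by
  an initial segment of the naturals; a bijection carries one to the other.\<close>

lemma H_abs_cont_finite_family:
  assumes "H_abs_cont u T1 T2" "\<epsilon> > 0"
  shows "\<exists>\<delta>>0. \<forall>(P :: 'i set) l r. finite P \<and> (\<forall>i\<in>P. T1 \<le> l i \<and> l i \<le> r i \<and> r i \<le> T2) \<and>
      disjoint_family_on (\<lambda>i. {l i<..<r i}) P \<and> (\<Sum>i\<in>P. r i - l i) < \<delta> \<longrightarrow>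
      (\<Sum>i\<in>P. Hnorm (\<lambda>x. u (r i) x - u (l i) x)) < \<epsilon>"
proof -
  obtain \<delta> where \<delta>: "\<delta> > 0" and *: "\<And>n (a :: nat \<Rightarrow> real) c.
        (\<forall>i<n. T1 \<le> a i \<and> a i \<le> c i \<and> c i \<le> T2) \<and>
        disjoint_family_on (\<lambda>i. {a i<..<c i}) {..<n} \<and>
        (\<Sum>i<n. c i - a i) < \<delta> \<longrightarrow>
        (\<Sum>i<n. Hnorm (\<lambda>x. u (c i) x - u (a i) x)) < \<epsilon>"
    using assms unfolding H_abs_cont_def by blast
  show ?thesis
  proof (intro exI[of _ \<delta>] conjI allI impI \<delta>)
    fix P :: "'i set" and l r
    assume "finite P \<and> (\<forall>i\<in>P. T1 \<le> l i \<and> l i \<le> r i \<and> r i \<le> T2) \<and>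
      disjoint_family_on (\<lambda>i. {l i<..<r i}) P \<and> (\<Sum>i\<in>P. r i - l i) < \<delta>"
    then have P: "finite P" "\<And>i. i \<in> P \<Longrightarrow> T1 \<le> l i \<and> l i \<le> r i \<and> r i \<le> T2"
      "disjoint_family_on (\<lambda>i. {l i<..<r i}) P" "(\<Sum>i\<in>P. r i - l i) < \<delta>" by auto
    obtain h where h: "bij_betw h {..<card P} P"
      using ex_bij_betw_nat_finite[OF P(1)] atLeast0LessThan by auto
    have hP: "h i \<in> P" if "i < card P" for i
      using h that by (auto simp: bij_betw_def)
    have sums: "(\<Sum>i<card P. F (h i)) = (\<Sum>i\<in>P. F i)" for F :: "'i \<Rightarrow> real"
      by (rule sum.reindex_bij_betw[OF h])
    have "disjoint_family_on (\<lambda>i. {l (h i)<..<r (h i)}) {..<card P}"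
      unfolding disjoint_family_on_def
    proof (intro ballI impI)
      fix m n assume "m \<in> {..<card P}" "n \<in> {..<card P}" "m \<noteq> n"
      then have "h m \<noteq> h n" "h m \<in> P" "h n \<in> P"
        using h hP by (auto simp: bij_betw_def inj_on_def)
      then show "{l (h m)<..<r (h m)} \<inter> {l (h n)<..<r (h n)} = {}"
        using P(3) unfolding disjoint_family_on_def by blast
    qed
    then show "(\<Sum>i\<in>P. Hnorm (\<lambda>x. u (r i) x - u (l i) x)) < \<epsilon>"
      using *[of "card P" "l \<circ> h" "r \<circ> h"] P hP sums[of "\<lambda>i. r i - l i"]
        sums[of "\<lambda>i. Hnorm (\<lambda>x. u (r i) x - u (l i) x)"] by auto
  qed
qed

text \<open>Cousin's lemma gives a tagged division fine for a gauge that treats good and bad tags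
  differently. At a good tag the derivative bounds the increment below by -\<epsilon> times the
  length; the intervals with bad tags have small total length, and absolute continuity of
  \<open>u\<close> together with \<open>lip\<close> bounds the loss there. Absolute continuity is
  asked of \<open>u\<close> because that is what a solution provides; \<open>f\<close> will be a
  scalar quantity computed from it.\<close>

lemma nonneg_AE_deriv_imp_mono:
  fixes f :: "real \<Rightarrow> real"
  assumes T: "T1 \<le> T2" and ac: "H_abs_cont u T1 T2"
    and lip: "\<And>s t. s \<in> {T1..T2} \<Longrightarrow> t \<in> {T1..T2} \<Longrightarrow>
       \<bar>f s - f t\<bar> \<le> C * Hnorm (\<lambda>x. u s x - u t x) + L * \<bar>s - t\<bar>"
    and C: "C \<ge> 0" and L: "L \<ge> 0"
    and der: "AE t in lborel. T1 < t \<and> t < T2 \<longrightarrow> (\<exists>D\<ge>0. (f has_real_derivative D) (at t))"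
  shows "f T1 \<le> f T2"
proof (rule field_le_epsilon)
  fix \<epsilon>' :: real assume "\<epsilon>' > 0"
  \<comment> \<open>The losses are \<epsilon> (T2 - T1) at good tags and (C + L) \<epsilon> at bad
    ones; the summand 1 makes \<open>K\<close> positive.\<close>
  define K where "K = (T2 - T1) + C + L + 1"
  have K: "K > 0" using T C L by (simp add: K_def)
  define \<epsilon> where "\<epsilon> = \<epsilon>' / K"
  have \<epsilon>: "\<epsilon> > 0" using \<open>\<epsilon>' > 0\<close> K by (simp add: \<epsilon>_def)
  obtain \<delta> where \<delta>: "\<delta> > 0" and acP:
    "\<forall>(P :: (real \<times> real set) set) l r. finite P \<and> (\<forall>i\<in>P. T1 \<le> l i \<and> l i \<le> r i \<and> r i \<le> T2) \<and>
      disjoint_family_on (\<lambda>i. {l i<..<r i}) P \<and> (\<Sum>i\<in>P. r i - l i) < \<delta> \<longrightarrow>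
      (\<Sum>i\<in>P. Hnorm (\<lambda>x. u (r i) x - u (l i) x)) < \<epsilon>"
    using H_abs_cont_finite_family[OF ac \<epsilon>, where 'i = "real \<times> real set"] by blast
  define \<delta>' where "\<delta>' = min \<delta> \<epsilon>"
  have \<delta>': "\<delta>' > 0" "\<delta>' \<le> \<delta>" "\<delta>' \<le> \<epsilon>" using \<delta> \<epsilon> by (auto simp: \<delta>'_def)
  obtain N0 where N0: "{t. \<not> (T1 < t \<and> t < T2 \<longrightarrow> (\<exists>D\<ge>0. (f has_real_derivative D) (at t)))} \<subseteq> N0"
    "emeasure lborel N0 = 0" "N0 \<in> sets lborel"
    using AE_E[OF der] by auto
  \<comment> \<open>The end points count as bad tags, since the derivative is controlled only inside
    the interval.\<close>
  define N where "N = N0 \<union> {T1, T2}"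
  have "N0 \<in> null_sets lborel" using N0 by auto
  moreover have "{T1, T2} \<in> null_sets lborel" by (intro finite_imp_null_set_lborel) auto
  ultimately have N_null: "N \<in> null_sets lborel" unfolding N_def by (rule null_sets.Un)
  then have "N \<in> sets borel" by auto
  from outer_regular_lborel[OF this \<delta>'(1)]
  obtain U where U: "open U" "N \<subseteq> U" "emeasure lborel (U - N) < \<delta>'" .
  have "emeasure lborel U = emeasure lborel (U - N)"
    using N_null U by (intro emeasure_Diff_null_set[symmetric]) auto
  with U(3) have emU: "emeasure lborel U < \<delta>'" by simp
  \<comment> \<open>The tag t lies between x and y, so the one-sided estimates on [x, t] and [t, y]
    add up.\<close>
  have "\<exists>d>0. \<forall>x y. x \<le> t \<and> t \<le> y \<and> x \<in> ball t d \<and> y \<in> ball t d \<longrightarrow> f y - f x \<ge> - \<epsilon> * (y - x)"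
    if t: "t \<notin> N" "t \<in> {T1..T2}" for t
  proof -
    have "T1 < t" "t < T2" using t by (auto simp: N_def)
    moreover have "t \<notin> N0" using t by (auto simp: N_def)
    ultimately obtain D where D: "D \<ge> 0" "(f has_real_derivative D) (at t)" using N0(1) by blast
    then have "((\<lambda>y. (f y - f t) / (y - t)) \<longlongrightarrow> D) (at t)"
      by (simp add: has_field_derivative_iff)
    then have "\<forall>\<^sub>F y in at t. dist ((f y - f t) / (y - t)) D < \<epsilon>" using \<epsilon> by (rule tendstoD)
    then obtain d where d: "d > 0" "\<And>y. y \<noteq> t \<Longrightarrow> dist y t < d \<Longrightarrow> dist ((f y - f t) / (y - t)) D < \<epsilon>"
      unfolding eventually_at by auto
    have q: "(f y - f t) / (y - t) > - \<epsilon>" if "y \<noteq> t" "dist y t < d" for y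
      using d(2)[OF that] D(1) by (auto simp: dist_real_def abs_if split: if_splits)
    have up: "f y - f t \<ge> - \<epsilon> * (y - t)" if "t \<le> y" "dist y t < d" for y
      using q[of y] that by (cases "y = t") (auto simp: pos_less_divide_eq)
    have lo: "f t - f x \<ge> - \<epsilon> * (t - x)" if "x \<le> t" "dist x t < d" for x
      using q[of x] that by (cases "x = t") (auto simp: neg_less_divide_eq algebra_simps)
    show ?thesis
    proof (intro exI[of _ d] conjI allI impI d(1))
      fix x y assume "x \<le> t \<and> t \<le> y \<and> x \<in> ball t d \<and> y \<in> ball t d"
      then show "f y - f x \<ge> - \<epsilon> * (y - x)"
        using up[of y] lo[of x] by (simp add: dist_commute algebra_simps)
    qed
  qed
  then obtain d where d: "\<And>t. t \<notin> N \<Longrightarrow> t \<in> {T1..T2} \<Longrightarrow> d t > 0"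
    "\<And>t x y. t \<notin> N \<Longrightarrow> t \<in> {T1..T2} \<Longrightarrow> x \<le> t \<Longrightarrow> t \<le> y \<Longrightarrow> x \<in> ball t (d t) \<Longrightarrow> y \<in> ball t (d t) \<Longrightarrow>
       f y - f x \<ge> - \<epsilon> * (y - x)"
    by metis
  \<comment> \<open>An interval tagged in \<open>N\<close> must stay in the open set
    \<open>U\<close> of small measure, one tagged elsewhere in the ball where the difference
    quotients exceed -\<epsilon>.\<close>
  define \<gamma> where "\<gamma> t = (if t \<in> N then U else if t \<in> {T1..T2} then ball t (d t) else UNIV)" for t
  have "gauge \<gamma>"
    unfolding gauge_def \<gamma>_def using U d(1) by auto
  then obtain p where p: "p tagged_division_of {T1..T2}" "\<gamma> fine p"
    using fine_division_exists_real by blast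
  note pD = tagged_division_ofD[OF p(1)]
  have pK: "K = {Inf K..Sup K} \<and> T1 \<le> Inf K \<and> Inf K \<le> x \<and> x \<le> Sup K \<and> Sup K \<le> T2 \<and> x \<in> {T1..T2} \<and> K \<subseteq> \<gamma> x"
    if xK: "(x, K) \<in> p" for x K
  proof -
    obtain a b where ab: "K = {a..b}" using pD(4)[OF xK] by auto
    have "x \<in> K" "K \<subseteq> {T1..T2}" using pD(2,3)[OF xK] by auto
    moreover have "K \<subseteq> \<gamma> x" using p(2) xK unfolding fine_def by auto
    ultimately show ?thesis unfolding ab by auto
  qed
  define P1 where "P1 = {i \<in> p. fst i \<in> N}"
  define P2 where "P2 = {i \<in> p. fst i \<notin> N}"
  define l where "l i = Inf (snd i)" for i :: "real \<times> real set"
  define r where "r i = Sup (snd i)" for i :: "real \<times> real set"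
  have fin: "finite p" "finite P1" "finite P2" using pD(1) by (auto simp: P1_def P2_def)
  have split: "sum F p = sum F P1 + sum F P2" for F :: "_ \<Rightarrow> real"
    unfolding P1_def P2_def using fin(1)
    by (subst sum.union_disjoint[symmetric]) (auto intro!: sum.cong)
  have len: "(\<Sum>i\<in>p. r i - l i) = T2 - T1"
    using additive_tagged_division_1[OF T p(1), of "\<lambda>x. x"] by (simp add: l_def r_def case_prod_unfold)
  have tot: "(\<Sum>i\<in>p. f (r i) - f (l i)) = f T2 - f T1"
    using additive_tagged_division_1[OF T p(1), of f] by (simp add: l_def r_def case_prod_unfold)
  have lr: "T1 \<le> l i \<and> l i \<le> r i \<and> r i \<le> T2" if "i \<in> p" for i
    using pK[of "fst i" "snd i"] that by (auto simp: l_def r_def)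
  have disj: "disjoint_family_on (\<lambda>i. {l i<..<r i}) p"
    unfolding disjoint_family_on_def
  proof (intro ballI impI)
    fix i j assume ij: "i \<in> p" "j \<in> p" "i \<noteq> j"
    have "interior (snd i) \<inter> interior (snd j) = {}"
      using pD(5)[of "fst i" "snd i" "fst j" "snd j"] ij by auto
    moreover have "interior (snd k) = {l k<..<r k}" if "k \<in> p" for k
    proof -
      have "snd k = {l k..r k}" using pK[of "fst k" "snd k"] that by (auto simp: l_def r_def)
      then show ?thesis by (simp add: interior_atLeastAtMost_real)
    qed
    ultimately show "{l i<..<r i} \<inter> {l j<..<r j} = {}" using ij by simp
  qed
  have disj1: "disjoint_family_on (\<lambda>i. {l i<..<r i}) P1"
    by (rule disjoint_family_on_mono[OF _ disj]) (auto simp: P1_def)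
  have subU: "{l i<..<r i} \<subseteq> U" if "i \<in> P1" for i
    using pK[of "fst i" "snd i"] that by (auto simp: P1_def \<gamma>_def l_def r_def)
  have "ennreal (\<Sum>i\<in>P1. r i - l i) = (\<Sum>i\<in>P1. emeasure lborel {l i<..<r i})"
    using lr by (subst sum_ennreal[symmetric]) (auto simp: P1_def intro!: sum.cong)
  also have "\<dots> = emeasure lborel (\<Union>i\<in>P1. {l i<..<r i})"
    using disj1 fin by (intro sum_emeasure) auto
  also have "\<dots> \<le> emeasure lborel U"
    using subU U(1) by (intro emeasure_mono) auto
  also have "\<dots> < \<delta>'" by (rule emU)
  finally have "ennreal (\<Sum>i\<in>P1. r i - l i) < ennreal \<delta>'" .
  moreover have "0 \<le> (\<Sum>i\<in>P1. r i - l i)" using lr by (intro sum_nonneg) (auto simp: P1_def)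
  ultimately have len1: "(\<Sum>i\<in>P1. r i - l i) < \<delta>'" by (simp add: ennreal_less_iff)
  have ac1: "(\<Sum>i\<in>P1. Hnorm (\<lambda>x. u (r i) x - u (l i) x)) < \<epsilon>"
    using len1 \<delta>' lr disj1 fin by (intro acP[rule_format]) (auto simp: P1_def)
  have "- (C * \<epsilon> + L * \<epsilon>) \<le> - (C * (\<Sum>i\<in>P1. Hnorm (\<lambda>x. u (r i) x - u (l i) x)) + L * (\<Sum>i\<in>P1. r i - l i))"
    using mult_left_mono[OF less_imp_le[OF ac1] C]
      mult_left_mono[OF less_imp_le[OF less_le_trans[OF len1 \<delta>'(3)]] L] by linarith
  also have "\<dots> = (\<Sum>i\<in>P1. - (C * Hnorm (\<lambda>x. u (r i) x - u (l i) x) + L * (r i - l i)))"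
    by (simp only: sum_negf sum.distrib sum_distrib_left)
  also have "\<dots> \<le> (\<Sum>i\<in>P1. f (r i) - f (l i))"
  proof (rule sum_mono)
    fix i assume "i \<in> P1"
    then have "T1 \<le> l i \<and> l i \<le> r i \<and> r i \<le> T2" using lr by (auto simp: P1_def)
    then show "- (C * Hnorm (\<lambda>x. u (r i) x - u (l i) x) + L * (r i - l i)) \<le> f (r i) - f (l i)"
      using lip[of "r i" "l i"] by auto
  qed
  finally have 1: "- (C * \<epsilon> + L * \<epsilon>) \<le> (\<Sum>i\<in>P1. f (r i) - f (l i))" .
  have "(\<Sum>i\<in>P2. r i - l i) \<le> T2 - T1"
    using len split[of "\<lambda>i. r i - l i"] sum_nonneg[of P1 "\<lambda>i. r i - l i"] lr by (auto simp: P1_def)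
  then have "- \<epsilon> * (T2 - T1) \<le> - \<epsilon> * (\<Sum>i\<in>P2. r i - l i)"
    using \<epsilon> by simp
  also have "\<dots> = (\<Sum>i\<in>P2. - \<epsilon> * (r i - l i))" by (simp add: sum_distrib_left)
  also have "\<dots> \<le> (\<Sum>i\<in>P2. f (r i) - f (l i))"
  proof (rule sum_mono)
    fix i assume i: "i \<in> P2"
    define t where "t = fst i"
    have K: "snd i = {l i..r i}" "l i \<le> t" "t \<le> r i" "t \<in> {T1..T2}" "snd i \<subseteq> \<gamma> t"
      using pK[of t "snd i"] i by (auto simp: P2_def l_def r_def t_def)
    have tN: "t \<notin> N" using i by (auto simp: P2_def t_def)
    have "{l i..r i} \<subseteq> ball t (d t)" using K tN by (auto simp: \<gamma>_def)
    moreover have "l i \<in> {l i..r i}" "r i \<in> {l i..r i}" using K by auto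
    ultimately show "- \<epsilon> * (r i - l i) \<le> f (r i) - f (l i)"
      using d(2)[OF tN K(4,2,3)] by blast
  qed
  finally have 2: "- \<epsilon> * (T2 - T1) \<le> (\<Sum>i\<in>P2. f (r i) - f (l i))" .
  have "f T1 - f T2 \<le> \<epsilon> * (T2 - T1) + (C * \<epsilon> + L * \<epsilon>)"
    using 1 2 tot split[of "\<lambda>i. f (r i) - f (l i)"] by simp
  also have "\<dots> \<le> \<epsilon> * K" using \<epsilon> by (simp add: K_def algebra_simps)
  also have "\<dots> = \<epsilon>'" using K by (simp add: \<epsilon>_def)
  finally show "f T1 \<le> f T2 + \<epsilon>'" by simp
qed

section \<open>Integration by parts and the Poincare inequality\<close>

lemma interval_integral_U01:
  fixes h :: "real \<Rightarrow> real"
  assumes "x \<in> {0..1}"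
  shows "(LBINT y=0..x. h y) = (\<integral>y. indicator {..<x} y * h y \<partial>U01)"
proof -
  have "(LBINT y=0..x. h y) = (LINT y:{0<..<x}|lborel. h y)"
    using assms by (simp add: interval_lebesgue_integral_def zero_ereal_def)
  also have "\<dots> = (LINT y:{0<..<1}|lborel. indicator {..<x} y * h y)"
    unfolding set_lebesgue_integral_def using assms
    by (intro Bochner_Integration.integral_cong) (auto simp: indicator_def)
  finally show ?thesis by (simp add: integral_U01)
qed

lemma second_deriv_L2_iff:
  "second_deriv_L2 g h \<longleftrightarrow> inH h \<and>
     (\<exists>g1. \<forall>x\<in>{0..1}. (g has_real_derivative g1 x) (at x within {0..1}) \<and>
                        g1 x = g1 0 + (\<integral>y. indicator {..<x} y * h y \<partial>U01))"
proof -
  have "(\<forall>x\<in>{0..1}. (g has_real_derivative g1 x) (at x within {0..1}) \<and> g1 x = g1 0 + (LBINT y=0..x. h y)) \<longleftrightarrow>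
    (\<forall>x\<in>{0..1}. (g has_real_derivative g1 x) (at x within {0..1}) \<and>
      g1 x = g1 0 + (\<integral>y. indicator {..<x} y * h y \<partial>U01))" for g1
    by (intro ball_cong refl) (simp add: interval_integral_U01)
  then show ?thesis unfolding second_deriv_L2_def by simp
qed

lemma inH_indicator_mult:
  assumes "inH h" "A \<in> sets borel" shows "inH (\<lambda>y. indicator A y * h y)"
proof (rule inH_bounded[OF _ assms(1)])
  have "indicator A \<in> borel_measurable U01"
    unfolding U01_def using assms(2) by (intro measurable_restrict_space1) auto
  then show "(\<lambda>y. indicator A y * h y) \<in> borel_measurable U01"
    using assms by measurable
qed (auto simp: indicator_def)

text \<open>Cauchy-Schwarz against the indicator of [x, y) gives Hoelder continuity with exponent
  1/2.\<close>

lemma indefinite_integral_continuous: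
  assumes h: "inH h" and g1: "\<And>x. x \<in> {0..1} \<Longrightarrow> g1 x = c + (\<integral>y. indicator {..<x} y * h y \<partial>U01)"
  shows "continuous_on {0..1} g1"
proof -
  have le: "\<bar>g1 y - g1 x\<bar> \<le> sqrt \<bar>y - x\<bar> * Hnorm h" if "x \<in> {0..1}" "y \<in> {0..1}" "x \<le> y" for x y
  proof -
    have "g1 y - g1 x = (\<integral>t. indicator {..<y} t * h t - indicator {..<x} t * h t \<partial>U01)"
      using that h by (simp add: g1 inH_integrable inH_indicator_mult)
    also have "\<dots> = (\<integral>t. indicator {x..<y} t * h t \<partial>U01)"
      using that by (intro Bochner_Integration.integral_cong) (auto simp: indicator_def)
    also have "\<bar>\<dots>\<bar> \<le> Hnorm (indicator {x..<y}) * Hnorm h"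
      using inH_indicator_mult[OF inH_const[of 1], of "{x..<y}"]
      by (intro Cauchy_Schwarz_U01 h) auto
    also have "Hnorm (indicator {x..<y}) \<le> sqrt \<bar>y - x\<bar>"
    proof -
      have "(\<integral>t. (indicator {x..<y} t :: real)^2 \<partial>U01) = (\<integral>t. indicator ({0<..<1} \<inter> {x..<y}) t \<partial>lborel)"
        unfolding integral_U01 set_lebesgue_integral_def
        by (intro Bochner_Integration.integral_cong) (auto simp: indicator_def)
      also have "\<dots> = measure lborel ({0<..<1} \<inter> {x..<y})" by simp
      also have "\<dots> \<le> measure lborel {x..<y}"
        using that by (intro measure_mono_fmeasurable fmeasurableI) auto
      also have "\<dots> = \<bar>y - x\<bar>" using that by simp
      finally show ?thesis unfolding Hnorm_eq by simp
    qed
    finally show ?thesis using Hnorm_nonneg[of h] by (simp add: mult_right_mono)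
  qed
  have le': "\<bar>g1 y - g1 x\<bar> \<le> sqrt \<bar>y - x\<bar> * Hnorm h" if "x \<in> {0..1}" "y \<in> {0..1}" for x y
    using le[of x y] le[of y x] that by (cases "x \<le> y") (auto simp: abs_minus_commute)
  show ?thesis
    unfolding continuous_on_def
  proof
    fix x :: real assume x: "x \<in> {0..1}"
    have "((\<lambda>y. sqrt \<bar>y - x\<bar> * Hnorm h) \<longlongrightarrow> sqrt \<bar>x - x\<bar> * Hnorm h) (at x within {0..1})"
      by (intro tendsto_intros)
    then have "((\<lambda>y. sqrt \<bar>y - x\<bar> * Hnorm h) \<longlongrightarrow> 0) (at x within {0..1})" by simp
    then have "((\<lambda>y. g1 y - g1 x) \<longlongrightarrow> 0) (at x within {0..1})"
      by (rule Lim_null_comparison[rotated])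
        (use x le' in \<open>auto simp: eventually_at_filter\<close>)
    then show "(g1 \<longlongrightarrow> g1 x) (at x within {0..1})" by (rule LIM_zero_cancel)
  qed
qed

lemma has_real_derivative_imp_continuous_on:
  fixes F :: "real \<Rightarrow> real"
  assumes "\<And>y. y \<in> S \<Longrightarrow> (F has_real_derivative f y) (at y within S)"
  shows "continuous_on S F"
  using assms DERIV_continuous continuous_on_eq_continuous_within by blast

lemma FTC_U01:
  fixes F f :: "real \<Rightarrow> real"
  assumes F: "\<And>y. y \<in> {0..1} \<Longrightarrow> (F has_real_derivative f y) (at y within {0..1})"
    and f: "continuous_on {0..1} f" and x: "x \<in> {0..1}"
  shows "(\<integral>y. indicator {..<x} y * f y \<partial>U01) = F x - F 0"
proof -
  have "(\<integral>y. indicator {..<x} y * f y \<partial>U01) = (LBINT y=0..x. f y)"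
    by (rule interval_integral_U01[OF x, symmetric])
  also have "\<dots> = (LINT y:{0..x}|lborel. f y)"
    using x by (simp add: interval_integral_Icc zero_ereal_def)
  also have "\<dots> = (LINT y|lborel. indicator {0..x} y *\<^sub>R f y)"
    by (simp add: set_lebesgue_integral_def)
  also have "\<dots> = F x - F 0"
  proof (rule integral_FTC_Icc)
    show "(F has_vector_derivative f y) (at y within {0..x})" if "0 \<le> y" "y \<le> x" for y
      using has_field_derivative_subset[OF F[of y], of "{0..x}"] that x
      by (auto simp: has_real_derivative_iff_has_vector_derivative)
    show "continuous_on {0..x} f" by (rule continuous_on_subset[OF f]) (use x in auto)
  qed (use x in auto)
  finally show ?thesis .
qed

lemma FTC_U01_total:
  fixes F f :: "real \<Rightarrow> real"
  assumes F: "\<And>y. y \<in> {0..1} \<Longrightarrow> (F has_real_derivative f y) (at y within {0..1})"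
    and f: "continuous_on {0..1} f"
  shows "(\<integral>y. f y \<partial>U01) = F 1 - F 0"
proof -
  have "(\<integral>y. f y \<partial>U01) = (\<integral>y. indicator {..<1} y * f y \<partial>U01)"
    by (intro Bochner_Integration.integral_cong) auto
  then show ?thesis using FTC_U01[OF F f, of 1] by simp
qed

lemma AE_U01_neq: "AE y in U01. y \<noteq> x"
proof -
  have "AE y in lborel. y \<noteq> x" by (rule AE_lborel_singleton)
  then show ?thesis unfolding AE_U01 by eventually_elim simp
qed

text \<open>As h is merely in H, \<open>g1\<close> has no classical derivative to which a product
  rule could be applied. Instead z x is written as z 1 minus the integral of z' over (x, 1), and
  Fubini exchanges the two integrations over x < y.\<close>

lemma integral_by_parts_U01:
  fixes h g1 z z' :: "real \<Rightarrow> real"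
  assumes h: "inH h" and g1: "\<And>x. x \<in> {0..1} \<Longrightarrow> g1 x = g1 0 + (\<integral>y. indicator {..<x} y * h y \<partial>U01)"
    and z: "\<And>y. y \<in> {0..1} \<Longrightarrow> (z has_real_derivative z' y) (at y within {0..1})"
    and z': "continuous_on {0..1} z'"
  shows "(\<integral>x. h x * z x \<partial>U01) = g1 1 * z 1 - g1 0 * z 0 - (\<integral>x. g1 x * z' x \<partial>U01)"
proof -
  interpret finite_measure U01 by (rule finite_measure_U01)
  interpret pair_sigma_finite U01 U01 ..
  note ih = inH_integrable[OF h]
  have z'H: "inH z'" by (rule continuous_on_inH[OF z'])
  have zc: "continuous_on {0..1} z" using z by (rule has_real_derivative_imp_continuous_on)
  have zH: "inH z" by (rule continuous_on_inH[OF zc])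
  have g1c: "continuous_on {0..1} g1" using h g1 by (rule indefinite_integral_continuous)
  have g1H: "inH g1" by (rule continuous_on_inH[OF g1c])
  note [measurable] = inH_measurable[OF h] inH_measurable[OF z'H]
  have id_meas [measurable]: "(\<lambda>x. x) \<in> borel_measurable U01"
    by (intro continuous_on_measurable_U01 continuous_intros)
  have int: "integrable (U01 \<Otimes>\<^sub>M U01) (case_prod (\<lambda>x y. if x < y then h x * z' y else 0))"
  proof (rule Bochner_Integration.integrable_bound)
    have "integrable (U01 \<Otimes>\<^sub>M U01) (\<lambda>(x, y). h x * z' y)"
    proof (rule Fubini_integrable)
      show "(\<lambda>(x, y). h x * z' y) \<in> borel_measurable (U01 \<Otimes>\<^sub>M U01)" by measurable
      show "integrable U01 (\<lambda>x. \<integral>y. norm (case (x, y) of (x, y) \<Rightarrow> h x * z' y) \<partial>U01)"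
        using ih by (simp add: abs_mult)
      show "AE x in U01. integrable U01 (\<lambda>y. case (x, y) of (x, y) \<Rightarrow> h x * z' y)"
        using inH_integrable[OF z'H] by simp
    qed
    then show "integrable (U01 \<Otimes>\<^sub>M U01) (\<lambda>p. h (fst p) * z' (snd p))" by (simp add: case_prod_unfold)
    have "(\<lambda>p. if fst p < snd p then h (fst p) * z' (snd p) else 0) \<in> borel_measurable (U01 \<Otimes>\<^sub>M U01)"
      by measurable
    then show "case_prod (\<lambda>x y. if x < y then h x * z' y else 0) \<in> borel_measurable (U01 \<Otimes>\<^sub>M U01)"
      by (simp add: case_prod_unfold)
  qed auto
  have zx: "z x = z 1 - (\<integral>y. indicator {x<..} y * z' y \<partial>U01)" if x: "x \<in> {0<..<1}" for x
  proof -
    have "(\<integral>y. indicator {x<..} y * z' y \<partial>U01) = (\<integral>y. z' y - indicator {..<x} y * z' y \<partial>U01)"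
    proof (rule integral_cong_AE)
      show "AE y in U01. indicator {x<..} y * z' y = z' y - indicator {..<x} y * z' y"
        using AE_U01_neq[of x] by eventually_elim (auto simp: indicator_def)
    qed (use z'H inH_indicator_mult[OF z'H] in \<open>auto intro!: inH_measurable\<close>)
    also have "\<dots> = (z 1 - z 0) - (z x - z 0)"
      using x z'H FTC_U01[OF z z', of x] FTC_U01_total[OF z z']
      by (simp add: inH_integrable inH_indicator_mult)
    finally show ?thesis by simp
  qed
  have inner: "(\<integral>x. h x * (\<integral>y. indicator {x<..} y * z' y \<partial>U01) \<partial>U01) = (\<integral>y. (g1 y - g1 0) * z' y \<partial>U01)"
  proof -
    have "(\<integral>x. h x * (\<integral>y. indicator {x<..} y * z' y \<partial>U01) \<partial>U01)
        = (\<integral>x. (\<integral>y. (if x < y then h x * z' y else 0) \<partial>U01) \<partial>U01)"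
      by (subst integral_mult_right_zero[symmetric], intro Bochner_Integration.integral_cong refl)
        (auto simp: indicator_def)
    also have "\<dots> = (\<integral>y. (\<integral>x. (if x < y then h x * z' y else 0) \<partial>U01) \<partial>U01)"
      by (rule Fubini_integral[OF int, symmetric])
    also have "\<dots> = (\<integral>y. (\<integral>x. indicator {..<y} x * h x \<partial>U01) * z' y \<partial>U01)"
      by (subst integral_mult_left_zero[symmetric], intro Bochner_Integration.integral_cong refl)
        (auto simp: indicator_def)
    also have "\<dots> = (\<integral>y. (g1 y - g1 0) * z' y \<partial>U01)"
    proof (rule Bochner_Integration.integral_cong[OF refl])
      fix y assume "y \<in> space U01"
      then show "(\<integral>x. indicator {..<y} x * h x \<partial>U01) * z' y = (g1 y - g1 0) * z' y"
        using g1[of y] by simp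
    qed
    finally show ?thesis .
  qed
  have "(\<integral>x. h x * z x \<partial>U01) = (\<integral>x. h x * z 1 - h x * (\<integral>y. indicator {x<..} y * z' y \<partial>U01) \<partial>U01)"
  proof (rule Bochner_Integration.integral_cong[OF refl])
    fix x assume "x \<in> space U01"
    then show "h x * z x = h x * z 1 - h x * (\<integral>y. indicator {x<..} y * z' y \<partial>U01)"
      using zx[of x] by (simp add: right_diff_distrib[symmetric])
  qed
  also have "\<dots> = (\<integral>x. h x * z 1 \<partial>U01) - (\<integral>x. h x * (\<integral>y. indicator {x<..} y * z' y \<partial>U01) \<partial>U01)"
  proof (rule Bochner_Integration.integral_diff)
    show "integrable U01 (\<lambda>x. h x * z 1)" using ih by simp
    \<comment> \<open>The inner integral equals z 1 - z x, so the integrability claimed next is that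
      of this difference.\<close>
    have "integrable U01 (\<lambda>x. h x * z 1 - h x * z x)"
      using ih integrable_mult_inH[OF h zH] by simp
    then show "integrable U01 (\<lambda>x. h x * (\<integral>y. indicator {x<..} y * z' y \<partial>U01))"
    proof (rule Bochner_Integration.integrable_cong[THEN iffD1, rotated 2])
      fix x assume "x \<in> space U01"
      then show "h x * z 1 - h x * z x = h x * (\<integral>y. indicator {x<..} y * z' y \<partial>U01)"
        using zx[of x] by (simp add: right_diff_distrib[symmetric])
    qed simp
  qed
  also have "(\<integral>x. h x * z 1 \<partial>U01) = (g1 1 - g1 0) * z 1"
  proof -
    have "(\<integral>x. h x \<partial>U01) = (\<integral>x. indicator {..<1} x * h x \<partial>U01)"
      by (intro Bochner_Integration.integral_cong) auto
    then show ?thesis using g1[of 1] by simp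
  qed
  also have "(\<integral>x. h x * (\<integral>y. indicator {x<..} y * z' y \<partial>U01) \<partial>U01)
      = (\<integral>y. g1 y * z' y - g1 0 * z' y \<partial>U01)"
    unfolding inner by (simp add: algebra_simps)
  also have "\<dots> = (\<integral>y. g1 y * z' y \<partial>U01) - g1 0 * (z 1 - z 0)"
    using integrable_mult_inH[OF g1H z'H] inH_integrable[OF z'H] FTC_U01_total[OF z z'] by simp
  finally show ?thesis by (simp add: algebra_simps)
qed

lemma second_deriv_L2_E:
  assumes "second_deriv_L2 g h"
  obtains g1 where "inH h"
    "\<And>x. x \<in> {0..1} \<Longrightarrow> (g has_real_derivative g1 x) (at x within {0..1})"
    "\<And>x. x \<in> {0..1} \<Longrightarrow> g1 x = g1 0 + (\<integral>y. indicator {..<x} y * h y \<partial>U01)"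
    "continuous_on {0..1} g1" "continuous_on {0..1} g"
proof -
  obtain g1 where g1: "inH h" "\<And>x. x \<in> {0..1} \<Longrightarrow> (g has_real_derivative g1 x) (at x within {0..1})"
    "\<And>x. x \<in> {0..1} \<Longrightarrow> g1 x = g1 0 + (\<integral>y. indicator {..<x} y * h y \<partial>U01)"
    using assms unfolding second_deriv_L2_iff by blast
  show ?thesis
    by (rule that[OF g1 indefinite_integral_continuous[OF g1(1,3)]
          has_real_derivative_imp_continuous_on[OF g1(2)]])
qed

text \<open>Both sides equal minus the integral of \<open>g1 * z'\<close>: one integration by parts
  uses the zero boundary values of z, the other those of g.\<close>

lemma Green_U01:
  assumes g: "second_deriv_L2 g h" "g 0 = 0" "g 1 = 0"
    and z: "\<And>y. y \<in> {0..1} \<Longrightarrow> (z has_real_derivative z' y) (at y within {0..1})"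
      "\<And>y. y \<in> {0..1} \<Longrightarrow> (z' has_real_derivative z'' y) (at y within {0..1})"
      "continuous_on {0..1} z''" "z 0 = 0" "z 1 = 0"
  shows "(\<integral>x. h x * z x \<partial>U01) = (\<integral>x. g x * z'' x \<partial>U01)"
proof -
  obtain g1 where g1: "inH h"
    "\<And>x. x \<in> {0..1} \<Longrightarrow> (g has_real_derivative g1 x) (at x within {0..1})"
    "\<And>x. x \<in> {0..1} \<Longrightarrow> g1 x = g1 0 + (\<integral>y. indicator {..<x} y * h y \<partial>U01)"
    "continuous_on {0..1} g1" "continuous_on {0..1} g"
    using second_deriv_L2_E[OF g(1)] by blast
  have z'c: "continuous_on {0..1} z'" using z(2) by (rule has_real_derivative_imp_continuous_on)
  have "(\<integral>x. h x * z x \<partial>U01) = - (\<integral>x. g1 x * z' x \<partial>U01)"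
    using integral_by_parts_U01[OF g1(1,3) z(1) z'c] z(4,5) by simp
  moreover have "(\<integral>x. z'' x * g x \<partial>U01) = - (\<integral>x. z' x * g1 x \<partial>U01)"
  proof -
    have "z' x = z' 0 + (\<integral>y. indicator {..<x} y * z'' y \<partial>U01)" if "x \<in> {0..1}" for x
      using FTC_U01[OF z(2,3) that] by simp
    from integral_by_parts_U01[OF continuous_on_inH[OF z(3)] this g1(2,4)] g(2,3)
    show ?thesis by simp
  qed
  ultimately show ?thesis by (simp add: mult.commute)
qed

text \<open>Completing the square with \<open>T = tan (\<mu>(x - 1/2))\<close>, which is smooth on \<open>[0,1]\<close> because \<open>\<mu> < \<pi>\<close>:
  \<open>g'\<^sup>2 - \<mu>\<^sup>2g\<^sup>2 = (g' + \<mu>Tg)\<^sup>2 - (\<mu>Tg\<^sup>2)'\<close>.\<close>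

lemma Poincare_U01:
  assumes g: "second_deriv_L2 g h" "g 0 = 0" "g 1 = 0" and \<mu>: "0 \<le> \<mu>" "\<mu> < pi"
  shows "(\<integral>x. h x * g x \<partial>U01) \<le> - (\<mu>^2) * (\<integral>x. (g x)^2 \<partial>U01)"
proof -
  obtain g1 where g1: "inH h"
    "\<And>x. x \<in> {0..1} \<Longrightarrow> (g has_real_derivative g1 x) (at x within {0..1})"
    "\<And>x. x \<in> {0..1} \<Longrightarrow> g1 x = g1 0 + (\<integral>y. indicator {..<x} y * h y \<partial>U01)"
    "continuous_on {0..1} g1" "continuous_on {0..1} g"
    using second_deriv_L2_E[OF g(1)] by blast
  define T where "T x = tan (\<mu> * (x - 1/2))" for x
  define F where "F x = - \<mu> * T x * (g x)^2" for x
  define f where "f x = - (\<mu>^2) * (1 + (T x)^2) * (g x)^2 - 2 * \<mu> * T x * g x * g1 x" for x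
  \<comment> \<open>Centring at 1/2 keeps the argument within \<mu> / 2 < pi / 2 of 0.\<close>
  have cos: "cos (\<mu> * (x - 1/2)) \<noteq> 0" if "x \<in> {0..1}" for x
  proof -
    have "\<bar>x - 1/2\<bar> \<le> 1/2" unfolding abs_le_iff using that by auto
    then have "\<bar>\<mu> * (x - 1/2)\<bar> \<le> \<mu> * (1/2)"
      unfolding abs_mult using \<mu> by (intro mult_mono) auto
    then have "cos (\<mu> * (x - 1/2)) > 0" using \<mu>(2) by (intro cos_gt_zero_pi) auto
    then show ?thesis by simp
  qed
  have T': "(T has_real_derivative \<mu> * (1 + (T x)^2)) (at x within {0..1})" if "x \<in> {0..1}" for x
  proof -
    have "(T has_real_derivative \<mu> * inverse ((cos (\<mu> * (x - 1/2)))^2)) (at x within {0..1})"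
      unfolding T_def by (rule derivative_eq_intros refl cos that | simp)+
    then show ?thesis using tan_sec[OF cos[OF that]] by (simp add: T_def power_inverse)
  qed
  have Tc: "continuous_on {0..1} T" using T' by (rule has_real_derivative_imp_continuous_on)
  have F': "(F has_real_derivative f x) (at x within {0..1})" if "x \<in> {0..1}" for x
    unfolding F_def by (rule derivative_eq_intros refl T' g1(2) that)+
      (simp add: f_def power2_eq_square algebra_simps)
  have fc: "continuous_on {0..1} f"
    unfolding f_def by (intro continuous_intros Tc g1(4,5))
  have "(\<integral>x. f x \<partial>U01) = 0"
    using FTC_U01_total[OF F' fc] g(2,3) by (simp add: F_def)
  moreover have "(\<integral>x. f x \<partial>U01) \<le> (\<integral>x. g1 x * g1 x - (\<mu>^2) * (g x)^2 \<partial>U01)"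
  proof (rule integral_mono)
    show "integrable U01 f" by (rule inH_integrable[OF continuous_on_inH[OF fc]])
    show "integrable U01 (\<lambda>x. g1 x * g1 x - (\<mu>^2) * (g x)^2)"
      by (intro inH_integrable continuous_on_inH continuous_intros g1(4,5))
    fix x
    have "g1 x * g1 x - (\<mu>^2) * (g x)^2 - f x = (g1 x + \<mu> * T x * g x)^2"
      by (simp add: f_def power2_eq_square algebra_simps)
    then show "f x \<le> g1 x * g1 x - (\<mu>^2) * (g x)^2"
      using zero_le_power2[of "g1 x + \<mu> * T x * g x"] by linarith
  qed
  moreover have "(\<integral>x. g1 x * g1 x - (\<mu>^2) * (g x)^2 \<partial>U01) = (\<integral>x. g1 x * g1 x \<partial>U01) - (\<mu>^2) * (\<integral>x. (g x)^2 \<partial>U01)"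
  proof -
    have "integrable U01 (\<lambda>x. g1 x * g1 x)" "integrable U01 (\<lambda>x. (g x)^2)"
      by (intro inH_integrable continuous_on_inH continuous_intros g1(4,5))+
    then show ?thesis by simp
  qed
  \<comment> \<open>Integration by parts with g itself as the smooth factor, which is allowed
    because \<open>g1\<close> is continuous.\<close>
  moreover have "(\<integral>x. h x * g x \<partial>U01) = - (\<integral>x. g1 x * g1 x \<partial>U01)"
    using integral_by_parts_U01[OF g1(1,3,2,4)] g(2,3) by simp
  ultimately show ?thesis by simp
qed

section \<open>The second derivative vanishes on the zero set\<close>

lemma indefinite_integral_diff:
  assumes h: "inH h" and g1: "\<And>x. x \<in> {0..1} \<Longrightarrow> g1 x = g1 0 + (\<integral>y. indicator {..<x} y * h y \<partial>U01)"
    and cd: "c \<in> {0..1}" "d \<in> {0..1}" "c \<le> d"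
  shows "(\<integral>y. indicator {c..<d} y * h y \<partial>U01) = g1 d - g1 c"
proof -
  have "(\<integral>y. indicator {c..<d} y * h y \<partial>U01) = (\<integral>y. indicator {..<d} y * h y - indicator {..<c} y * h y \<partial>U01)"
    using cd by (intro Bochner_Integration.integral_cong) (auto simp: indicator_def)
  also have "\<dots> = (\<integral>y. indicator {..<d} y * h y \<partial>U01) - (\<integral>y. indicator {..<c} y * h y \<partial>U01)"
    using h by (simp add: inH_integrable inH_indicator_mult)
  also have "\<dots> = g1 d - g1 c"
    using g1[OF cd(1)] g1[OF cd(2)] by simp
  finally show ?thesis .
qed

text \<open>On a short interval meeting \<open>K\<close>, the integral of \<open>h\<close> between the extreme points of \<open>K\<close> vanishes,
  so the integral over \<open>K\<close> is controlled by that over the points close to, but outside, \<open>K\<close>.\<close>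

lemma integral_closed_subset_zero_set:
  assumes h: "inH h" and g1: "\<And>x. x \<in> {0..1} \<Longrightarrow> g1 x = g1 0 + (\<integral>y. indicator {..<x} y * h y \<partial>U01)"
    and K: "closed K" "K \<subseteq> {0<..<1}" "\<And>x. x \<in> K \<Longrightarrow> g1 x = 0"
  shows "(\<integral>x. indicator K x * h x \<partial>U01) = 0"
proof (cases "K = {}")
  case False
  have Kb: "K \<in> sets borel" using K(1) by (rule borel_closed)
  \<comment> \<open>The shell is as wide as the cells of the partition into n + 1 equal parts used
    below, so it catches every point outside \<open>K\<close> of a cell that meets
    \<open>K\<close>.\<close>
  define D where "D n = {x. 0 < infdist x K \<and> infdist x K \<le> 1 / real (Suc n)}" for n
  have Db: "D n \<in> sets borel" for n
  proof -
    have "D n = (\<lambda>x. infdist x K) -` {0<..1 / real (Suc n)} \<inter> space borel" by (auto simp: D_def)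
    also have "\<dots> \<in> sets borel"
      by (rule measurable_sets[OF borel_measurable_continuous_onI]) (auto intro!: continuous_intros)
    finally show ?thesis .
  qed
  have piece: "\<bar>\<integral>x. indicator (K \<inter> {p..<q}) x * h x \<partial>U01\<bar> \<le> (\<integral>x. indicator (D n \<inter> {p..<q}) x * \<bar>h x\<bar> \<partial>U01)"
    if pq: "0 \<le> p" "q \<le> 1" "q - p \<le> 1 / real (Suc n)" for p q n
  proof (cases "K \<inter> {p..<q} = {}")
    case False
    define S where "S = K \<inter> {p..<q}"
    have S: "S \<noteq> {}" "bdd_below S" "bdd_above S"
      using False by (auto simp: S_def intro!: bdd_belowI[of _ p] bdd_aboveI[of _ q])
    define c where "c = Inf S"
    define d where "d = Sup S"
    \<comment> \<open>Both extreme points are in \<open>K\<close>, hence zeros of \<open>g1\<close>,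
      although \<open>d\<close> may be the excluded right end \<open>q\<close> of the cell.\<close>
    have "closure S \<subseteq> K" using K(1) by (intro closure_minimal) (auto simp: S_def)
    then have cK: "c \<in> K" and dK: "d \<in> K"
      using closure_contains_Inf[OF S(1,2)] closure_contains_Sup[OF S(1,3)] by (auto simp: c_def d_def)
    have Scd: "c \<le> x \<and> x \<le> d" if "x \<in> S" for x
      using that S by (auto simp: c_def d_def intro: cInf_lower cSup_upper)
    have pc: "p \<le> c" and dq: "d \<le> q"
      using S by (auto simp: c_def d_def S_def intro!: cInf_greatest cSup_least)
    have "c \<le> d" using S(1) Scd by force
    moreover have "c \<in> {0..1}" "d \<in> {0..1}" using subsetD[OF K(2) cK] subsetD[OF K(2) dK] by auto
    ultimately have 0: "(\<integral>x. indicator {c..<d} x * h x \<partial>U01) = 0"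
      using indefinite_integral_diff[OF h g1, of c d] cK dK K(3) by auto
    have i1: "inH (\<lambda>x. indicator S x * h x)" "inH (\<lambda>x. indicator {c..<d} x * h x)"
      using h Kb by (auto simp: S_def intro!: inH_indicator_mult)
    have "(\<integral>x. indicator S x * h x \<partial>U01) = (\<integral>x. indicator S x * h x - indicator {c..<d} x * h x \<partial>U01)"
      using 0 i1 by (simp add: inH_integrable)
    also have "\<bar>\<dots>\<bar> \<le> (\<integral>x. \<bar>indicator S x * h x - indicator {c..<d} x * h x\<bar> \<partial>U01)"
      by (rule integral_abs_bound)
    also have "\<dots> \<le> (\<integral>x. indicator (D n \<inter> {p..<q}) x * \<bar>h x\<bar> \<partial>U01)"
    proof (rule integral_mono_AE)
      show "integrable U01 (\<lambda>x. \<bar>indicator S x * h x - indicator {c..<d} x * h x\<bar>)"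
        using i1 by (intro integrable_abs inH_integrable inH_diff)
      show "integrable U01 (\<lambda>x. indicator (D n \<inter> {p..<q}) x * \<bar>h x\<bar>)"
        using h Db by (intro inH_integrable inH_indicator_mult) (auto intro: inH_bounded[OF _ h])
      show "AE x in U01. \<bar>indicator S x * h x - indicator {c..<d} x * h x\<bar> \<le> indicator (D n \<inter> {p..<q}) x * \<bar>h x\<bar>"
        \<comment> \<open>If \<open>d\<close> belongs to \<open>S\<close>, it is the one point of
          \<open>S\<close> missing from the half-open interval from c to d.\<close>
        using AE_U01_neq[of d]
      proof eventually_elim
        fix x assume x: "x \<noteq> d"
        consider "x \<in> S" | "x \<notin> S" "x \<in> {c..<d}" | "x \<notin> S" "x \<notin> {c..<d}" by blast
        then show "\<bar>indicator S x * h x - indicator {c..<d} x * h x\<bar> \<le> indicator (D n \<inter> {p..<q}) x * \<bar>h x\<bar>"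
        proof cases
          case 1
          then have "x \<in> {c..<d}" using Scd[of x] x by auto
          then show ?thesis using 1 by simp
        next
          case 2
          then have xpq: "x \<in> {p..<q}" using pc dq by auto
          then have "x \<notin> K" using 2 by (auto simp: S_def)
          then have "0 < infdist x K"
            using in_closed_iff_infdist_zero[OF K(1)] \<open>K \<noteq> {}\<close> infdist_nonneg[of x K] by fastforce
          moreover have "infdist x K \<le> dist x c" by (rule infdist_le[OF cK])
          ultimately have "x \<in> D n" using 2 pc dq pq(3) by (auto simp: D_def dist_real_def)
          then show ?thesis using 2 xpq by simp
        qed auto
      qed
    qed
    finally show ?thesis unfolding S_def .
  qed (simp add: integral_nonneg_AE)
  have main: "\<bar>\<integral>x. indicator K x * h x \<partial>U01\<bar> \<le> (\<integral>x. indicator (D n) x * \<bar>h x\<bar> \<partial>U01)" for n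
  proof -
    have "\<bar>\<integral>x. indicator (K \<inter> {0..<real k / real (Suc n)}) x * h x \<partial>U01\<bar>
        \<le> (\<integral>x. indicator (D n \<inter> {0..<real k / real (Suc n)}) x * \<bar>h x\<bar> \<partial>U01)" if "k \<le> Suc n" for k
      using that
    proof (induction k)
      case (Suc k)
      define p where "p = real k / real (Suc n)"
      define q where "q = real (Suc k) / real (Suc n)"
      have pq: "0 \<le> p" "p \<le> q" "q \<le> 1" "q - p \<le> 1 / real (Suc n)"
        using Suc.prems by (auto simp: p_def q_def divide_simps)
      have splt: "(\<integral>x. indicator (A \<inter> {0..<q}) x * f x \<partial>U01)
        = (\<integral>x. indicator (A \<inter> {0..<p}) x * f x \<partial>U01) + (\<integral>x. indicator (A \<inter> {p..<q}) x * f x \<partial>U01)"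
        if "A \<in> sets borel" "inH f" for A and f :: "real \<Rightarrow> real"
      proof -
        have "(\<integral>x. indicator (A \<inter> {0..<q}) x * f x \<partial>U01)
          = (\<integral>x. indicator (A \<inter> {0..<p}) x * f x + indicator (A \<inter> {p..<q}) x * f x \<partial>U01)"
          using pq by (intro Bochner_Integration.integral_cong) (auto simp: indicator_def)
        also have "\<dots> = (\<integral>x. indicator (A \<inter> {0..<p}) x * f x \<partial>U01) + (\<integral>x. indicator (A \<inter> {p..<q}) x * f x \<partial>U01)"
          using that by (intro Bochner_Integration.integral_add inH_integrable inH_indicator_mult) auto
        finally show ?thesis .
      qed
      have ha: "inH (\<lambda>x. \<bar>h x\<bar>)" using h by (auto intro: inH_bounded[OF _ h])
      have "k \<le> Suc n" using Suc.prems by simp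
      from Suc.IH[OF this] piece[OF pq(1,3,4)] show ?case
        unfolding p_def[symmetric] q_def[symmetric] splt[OF Kb h] splt[OF Db ha] by linarith
    qed simp
    from this[of "Suc n"] have "\<bar>\<integral>x. indicator (K \<inter> {0..<1}) x * h x \<partial>U01\<bar>
        \<le> (\<integral>x. indicator (D n \<inter> {0..<1}) x * \<bar>h x\<bar> \<partial>U01)" by simp
    also have "(\<integral>x. indicator (K \<inter> {0..<1}) x * h x \<partial>U01) = (\<integral>x. indicator K x * h x \<partial>U01)"
      by (intro Bochner_Integration.integral_cong) (auto simp: indicator_def)
    also have "(\<integral>x. indicator (D n \<inter> {0..<1}) x * \<bar>h x\<bar> \<partial>U01) = (\<integral>x. indicator (D n) x * \<bar>h x\<bar> \<partial>U01)"
      by (intro Bochner_Integration.integral_cong) (auto simp: indicator_def)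
    finally show ?thesis .
  qed
  \<comment> \<open>Every point leaves the shells eventually: points at distance 0 from
    \<open>K\<close> are in none of them, all others are outside the thin ones.\<close>
  have "(\<lambda>n. \<integral>x. indicator (D n) x * \<bar>h x\<bar> \<partial>U01) \<longlonglongrightarrow> (\<integral>x. 0 \<partial>U01)"
  proof (rule integral_dominated_convergence)
    show "integrable U01 (\<lambda>x. \<bar>h x\<bar>)" using h by (intro integrable_abs inH_integrable)
    show "(\<lambda>x. indicator (D n) x * \<bar>h x\<bar>) \<in> borel_measurable U01" for n
      using h Db by (intro inH_measurable inH_indicator_mult) (auto intro: inH_bounded[OF _ h])
    show "AE x in U01. norm (indicator (D n) x * \<bar>h x\<bar>) \<le> \<bar>h x\<bar>" for n
      by (auto simp: indicator_def)
    show "AE x in U01. (\<lambda>n. indicator (D n) x * \<bar>h x\<bar>) \<longlonglongrightarrow> 0"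
    proof (rule AE_I2)
      fix x
      have "\<forall>\<^sub>F n in sequentially. x \<notin> D n"
      proof (cases "0 < infdist x K")
        case True
        have "(\<lambda>n. 1 / real (Suc n)) \<longlonglongrightarrow> 0" by (rule LIMSEQ_Suc[OF lim_1_over_n])
        then have "\<forall>\<^sub>F n in sequentially. 1 / real (Suc n) < infdist x K"
          using True by (rule order_tendstoD(2))
        then show ?thesis by eventually_elim (auto simp: D_def)
      qed (auto simp: D_def)
      then show "(\<lambda>n. indicator (D n) x * \<bar>h x\<bar>) \<longlonglongrightarrow> 0"
        by (intro tendsto_eventually) (auto elim: eventually_mono)
    qed
  qed simp
  then have "(\<lambda>n. \<integral>x. indicator (D n) x * \<bar>h x\<bar> \<partial>U01) \<longlonglongrightarrow> 0" by simp
  then have "\<bar>\<integral>x. indicator K x * h x \<partial>U01\<bar> \<le> 0"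
    by (rule LIMSEQ_le_const) (use main in blast)
  then show ?thesis by simp
qed simp

text \<open>If the exceptional set had positive measure, it would contain a closed set of positive
  measure; there h is positive, while its integral is 0 by
  \<open>integral_closed_subset_zero_set\<close>.\<close>

lemma AE_not_pos_on_zero_set:
  assumes h: "inH h" and g1: "\<And>x. x \<in> {0..1} \<Longrightarrow> g1 x = g1 0 + (\<integral>y. indicator {..<x} y * h y \<partial>U01)"
  shows "AE x in U01. \<not> (g1 x = 0 \<and> h x > 0)"
proof -
  have [measurable]: "h \<in> borel_measurable U01" "g1 \<in> borel_measurable U01"
    using h indefinite_integral_continuous[OF h g1] by (auto intro: continuous_on_measurable_U01)
  define P where "P = {x \<in> space U01. g1 x = 0 \<and> h x > 0}"
  have "P \<in> sets U01" unfolding P_def by measurable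
  then have Pb: "P \<in> sets borel" and P01: "P \<subseteq> {0<..<1}"
    unfolding U01_def by (auto simp: sets_restrict_space_iff)
  have "emeasure lebesgue P = 0"
  proof (rule ccontr)
    assume "emeasure lebesgue P \<noteq> 0"
    moreover have "emeasure lebesgue P \<le> emeasure lebesgue {0<..<1::real}"
      using P01 by (intro emeasure_mono) auto
    then have "emeasure lebesgue P \<le> 1" by simp
    ultimately obtain e where e: "emeasure lebesgue P = ennreal e" "e > 0"
      by (cases "emeasure lebesgue P") (auto simp: top_unique)
    have "P \<in> sets lebesgue" using Pb by auto
    from sets_lebesgue_inner_closed[OF this e(2)]
    obtain T where T: "closed T" "T \<subseteq> P" "emeasure lebesgue (P - T) < ennreal e" by metis
    have Tb: "T \<in> sets borel" using T(1) by (rule borel_closed)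
    have "(\<integral>x. indicator T x * h x \<partial>U01) = 0"
      using T P01 by (intro integral_closed_subset_zero_set[OF h g1]) (auto simp: P_def)
    moreover have "(\<integral>x. indicator T x * h x \<partial>U01) = 0 \<longleftrightarrow> (AE x in U01. indicator T x * h x = 0)"
      using T(2) inH_integrable[OF inH_indicator_mult[OF h Tb]]
      by (intro integral_nonneg_eq_0_iff_AE AE_I2) (auto simp: P_def indicator_def subset_iff less_imp_le)
    ultimately have "AE x in U01. indicator T x * h x = 0" by simp
    then have "AE x in lborel. x \<notin> T"
      unfolding AE_U01 using T(2)
      by (elim eventually_mono) (auto simp: P_def indicator_def split: if_splits)
    then have "emeasure lborel T = 0"
      using Tb AE_iff_null_sets[of T lborel] by auto
    then have "emeasure lebesgue T = 0" using Tb by simp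
    moreover have "emeasure lebesgue P \<le> emeasure lebesgue (P - T) + emeasure lebesgue T"
      using Pb Tb T(2) by (subst plus_emeasure) (auto simp: Diff_partition Un_absorb2)
    ultimately show False using T(3) e by auto
  qed
  then have "P \<in> null_sets lborel" using Pb by auto
  then show ?thesis
    unfolding AE_U01 using AE_not_in[of P lborel]
    by (auto simp: P_def elim: eventually_mono)
qed

lemma AE_zero_on_zero_set:
  assumes h: "inH h" and g1: "\<And>x. x \<in> {0..1} \<Longrightarrow> g1 x = g1 0 + (\<integral>y. indicator {..<x} y * h y \<partial>U01)"
  shows "AE x in U01. g1 x = 0 \<longrightarrow> h x = 0"
proof -
  have "- g1 x = - g1 0 + (\<integral>y. indicator {..<x} y * (- h y) \<partial>U01)" if "x \<in> {0..1}" for x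
    using g1[OF that] by simp
  then have "AE x in U01. \<not> (- g1 x = 0 \<and> - h x > 0)"
    by (intro AE_not_pos_on_zero_set inH_minus h)
  moreover have "AE x in U01. \<not> (g1 x = 0 \<and> h x > 0)"
    by (intro AE_not_pos_on_zero_set h g1)
  ultimately show ?thesis by eventually_elim auto
qed

text \<open>An interior zero of a non-negative function is a minimum, so the zeros of g in (0,1) are
  zeros of its derivative, and the first-order fact applies to that derivative.\<close>

lemma AE_second_deriv_zero:
  assumes g: "second_deriv_L2 g h" and nn: "\<And>x. x \<in> {0..1} \<Longrightarrow> g x \<ge> 0"
  shows "AE x in U01. g x = 0 \<longrightarrow> h x = 0"
proof -
  obtain g1 where g1: "inH h"
    "\<And>x. x \<in> {0..1} \<Longrightarrow> (g has_real_derivative g1 x) (at x within {0..1})"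
    "\<And>x. x \<in> {0..1} \<Longrightarrow> g1 x = g1 0 + (\<integral>y. indicator {..<x} y * h y \<partial>U01)"
    "continuous_on {0..1} g1" "continuous_on {0..1} g"
    using second_deriv_L2_E[OF g] by blast
  have "g1 x = 0" if x: "x \<in> {0<..<1}" "g x = 0" for x
  proof -
    have "(g has_real_derivative g1 x) (at x)"
      using g1(2)[of x] x by (simp add: at_within_Icc_at)
    moreover have "\<forall>y. \<bar>x - y\<bar> < min x (1 - x) \<longrightarrow> g x \<le> g y"
      using nn x by (auto simp: abs_if split: if_splits)
    ultimately show ?thesis using x by (intro DERIV_local_min[of g "g1 x" x "min x (1 - x)"]) auto
  qed
  moreover have "AE x in U01. g1 x = 0 \<longrightarrow> h x = 0"
    by (intro AE_zero_on_zero_set g1(1,3))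
  ultimately show ?thesis
    using AE_space[of U01] by (elim AE_mp) (auto intro!: AE_I2)
qed

lemma AE_U01_dense:
  assumes "AE x in U01. P x" "0 \<le> a" "a < c" "c \<le> 1"
  obtains x where "a < x" "x < c" "P x"
proof -
  have "\<exists>x. a < x \<and> x < c \<and> P x"
  proof (rule ccontr)
    assume "\<nexists>x. a < x \<and> x < c \<and> P x"
    then have "AE x in lborel. x \<notin> {a<..<c}"
      using assms unfolding AE_U01 by (auto elim!: eventually_mono)
    then have "emeasure lborel {a<..<c} = 0"
      using AE_iff_null_sets[of "{a<..<c}" lborel] by auto
    then show False using assms by simp
  qed
  then show ?thesis using that by blast
qed

lemma AE_U01_nonneg_continuous:
  fixes g :: "real \<Rightarrow> real"
  assumes g: "continuous_on {0..1} g" and ae: "AE x in U01. g x \<ge> 0" and x: "x \<in> {0..1}"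
  shows "g x \<ge> 0"
proof (rule ccontr)
  assume "\<not> g x \<ge> 0"
  then obtain d where d: "d > 0" "\<And>y. y \<in> {0..1} \<Longrightarrow> dist y x < d \<Longrightarrow> dist (g y) (g x) < - g x"
    using g x unfolding continuous_on_iff by (metis neg_0_less_iff_less not_le)
  obtain y where y: "max 0 (x - d) < y" "y < min 1 (x + d)" "g y \<ge> 0"
    by (rule AE_U01_dense[OF ae, of "max 0 (x - d)" "min 1 (x + d)"]) (use x d(1) in auto)
  then have "dist (g y) (g x) < - g x" by (intro d(2)) (auto simp: dist_real_def)
  then show False using y(3) by (auto simp: dist_real_def)
qed

section \<open>The source of a non-negative trajectory and monotone test integrals\<close>

text \<open>Where u t vanishes, the difference quotients are non-negative from the right and
  non-positive from the left. Their distance to v therefore dominates the negative part of v on one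
  side and the positive part on the other.\<close>

lemma H_deriv_eq_0_where_minimal:
  assumes v: "H_deriv u t v" and u: "\<And>s. inH (u s)"
    and nn: "\<And>s. AE x in U01. u s x \<ge> 0"
  shows "AE x in U01. u t x = 0 \<longrightarrow> v x = 0"
proof -
  have vH: "inH v" using v by (simp add: H_deriv_def)
  note [measurable] = inH_measurable[OF vH] inH_measurable[OF u]
  define q where "q s x = (u s x - u t x) / (s - t)" for s x
  have q: "inH (\<lambda>x. q s x - v x)" for s unfolding q_def by (intro inH_diff inH_divide u vH)
  have lim: "((\<lambda>s. Hnorm (\<lambda>x. q s x - v x)) \<longlongrightarrow> 0) (at t)"
    using v by (simp add: H_deriv_def q_def)
  \<comment> \<open>The exceptional set in \<open>nn\<close> depends on s, so a pointwise limit in s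
    is not justified; the bound is passed to norms instead.\<close>
  have zero: "AE x in U01. m x = 0"
    if m: "m \<in> borel_measurable U01" and F: "F \<le> at t" "F \<noteq> bot"
      and ev: "\<forall>\<^sub>F s in F. AE x in U01. \<bar>m x\<bar> \<le> \<bar>q s x - v x\<bar>" for m F
  proof -
    have "\<forall>\<^sub>F s in F. Hnorm m \<le> Hnorm (\<lambda>x. q s x - v x)"
      using ev by eventually_elim (rule Hnorm_mono[OF m q])
    moreover have "((\<lambda>s. Hnorm (\<lambda>x. q s x - v x)) \<longlongrightarrow> 0) F"
      using lim F(1) by (rule tendsto_mono[rotated])
    ultimately have "Hnorm m \<le> 0" using tendsto_lowerbound F(2) by blast
    then have m0: "Hnorm m = 0" using Hnorm_nonneg[of m] by simp
    obtain s where "AE x in U01. \<bar>m x\<bar> \<le> \<bar>q s x - v x\<bar>"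
      using eventually_happens'[OF F(2) ev] by blast
    then have "inH m" by (rule inH_bounded[OF m q])
    then show ?thesis using Hnorm_eq_0_iff m0 by blast
  qed
  have "AE x in U01. (if u t x = 0 then min (v x) 0 else 0) = 0"
  proof (rule zero)
    show "\<forall>\<^sub>F s in at_right t. AE x in U01. \<bar>if u t x = 0 then min (v x) 0 else 0\<bar> \<le> \<bar>q s x - v x\<bar>"
      using eventually_at_right_less[of t]
    proof eventually_elim
      case (elim s)
      show ?case using nn[of s]
      proof eventually_elim
        case (elim x)
        then have "q s x \<ge> 0" if "u t x = 0"
          unfolding q_def using that \<open>t < s\<close> by simp
        then show ?case by (auto simp: min_def)
      qed
    qed
  qed (auto simp: at_within_le_at)
  moreover have "AE x in U01. (if u t x = 0 then max (v x) 0 else 0) = 0"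
  proof (rule zero)
    have "\<forall>\<^sub>F s in at_left t. s < t" by (auto simp: eventually_at_filter)
    then show "\<forall>\<^sub>F s in at_left t. AE x in U01. \<bar>if u t x = 0 then max (v x) 0 else 0\<bar> \<le> \<bar>q s x - v x\<bar>"
    proof eventually_elim
      case (elim s)
      show ?case using nn[of s]
      proof eventually_elim
        case (elim x)
        then have "q s x \<le> 0" if "u t x = 0"
          unfolding q_def using that \<open>s < t\<close> by (simp add: divide_nonneg_neg)
        then show ?case by (auto simp: max_def)
      qed
    qed
  qed (auto simp: at_within_le_at)
  ultimately show ?thesis by eventually_elim (auto simp: min_def max_def split: if_splits)
qed

text \<open>At almost every time the equation holds with the source vanishing on the zero set of the solution,
  because there both the time derivative and the second space derivative vanish.\<close>

definition regular_at :: "real \<Rightarrow> real \<Rightarrow> (real \<Rightarrow> real \<Rightarrow> real) \<Rightarrow> real \<Rightarrow> bool" where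
  "regular_at b \<omega> \<phi> t \<longleftrightarrow> (\<exists>v g h. H_deriv \<phi> t v \<and> (AE x in U01. \<phi> t x = g x) \<and> g 0 = 0 \<and> g 1 = 0 \<and>
     second_deriv_L2 g h \<and> (\<forall>x\<in>{0..1}. 0 \<le> g x) \<and>
     (AE x in U01. v x = h x + (if g x = 0 then 0 else b + \<omega> * g x)))"

lemma source_slice_measurable:
  assumes "(\<lambda>(t, x). r t x) \<in> borel_measurable (lborel \<Otimes>\<^sub>M lborel)"
  shows "(r t :: real \<Rightarrow> real) \<in> borel_measurable U01"
proof -
  have "(\<lambda>x. (\<lambda>(t, x). r t x) (t, x)) \<in> borel_measurable lborel"
    by (rule measurable_Pair2[OF assms]) simp
  then show ?thesis unfolding U01_def by (intro measurable_restrict_space1) simp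
qed

lemma opA_E:
  assumes "opA u w"
  obtains g where "inH u" "inH w" "AE x in U01. u x = g x" "g 0 = 0" "g 1 = 0" "second_deriv_L2 g (\<lambda>x. - w x)"
  using assms unfolding opA_def AE_U01 by blast

text \<open>The integral of a non-integrable function is 0 by convention, so a vanishing
  \<open>Hnorm\<close> means equality almost everywhere only between elements of \<open>inH\<close>.
  This is why membership of the source must be established separately.\<close>

lemma AE_eq_source:
  assumes "inH v" "inH w" "inH r" "Hnorm (\<lambda>x. v x + w x - r x) = 0"
  shows "AE x in U01. v x + w x = r x"
proof -
  have "inH (\<lambda>x. v x + w x - r x)" using assms by (intro inH_diff inH_add)
  then have "AE x in U01. v x + w x - r x = 0" using assms(4) Hnorm_eq_0_iff by blast
  then show ?thesis by eventually_elim simp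
qed

text \<open>Elements of \<open>H0\<close> are bounded by 1, so the source is dominated by b +
  |\<omega> u|.\<close>

lemma inH_source_F_P:
  assumes "inH u" "r \<in> borel_measurable U01" "AE x in U01. F_P b \<omega> (u x) (r x)" "b \<ge> 0"
  shows "inH r"
proof (rule inH_bounded[OF assms(2)])
  have "inH (\<lambda>x. \<bar>\<omega> * u x\<bar>)" by (rule inH_bounded[of _ "\<lambda>x. \<omega> * u x"]) (use assms(1) in auto)
  then show "inH (\<lambda>x. b + \<bar>\<omega> * u x\<bar>)" by (intro inH_add inH_const)
  show "AE x in U01. \<bar>r x\<bar> \<le> \<bar>b + \<bar>\<omega> * u x\<bar>\<bar>"
    using assms(3)
  proof eventually_elim
    case (elim x)
    then obtain z where "z \<in> H0 (u x)" and z: "r x - \<omega> * u x = b * z"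
      unfolding F_P_def by blast
    then have "\<bar>z\<bar> \<le> 1" by (auto simp: H0_def split: if_splits)
    then have "\<bar>b * z\<bar> \<le> b" using assms(4) by (simp add: abs_mult mult_left_le)
    then show ?case using z by linarith
  qed
qed

text \<open>Each initial time brings its own source r. Initial times -n for all naturals n cover the
  line, and countably many exceptional null sets of times are still null.\<close>

lemma AE_regular_at:
  assumes b: "b \<ge> 0" and ct: "complete_trajectory (F_P b \<omega>) \<phi>"
    and nn: "\<And>t. AE x in U01. \<phi> t x \<ge> 0"
  shows "AE t in lborel. regular_at b \<omega> \<phi> t"
proof -
  have H: "inH (\<phi> t)" for t
    using ct by (auto simp: complete_trajectory_def is_solution_def)
  have "AE t in lborel. - real n < t \<longrightarrow> regular_at b \<omega> \<phi> t" for n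
  proof -
    have "is_solution (F_P b \<omega>) (- real n) (\<phi> (- real n)) \<phi>"
      using ct by (simp add: complete_trajectory_def)
    then obtain r where r: "(\<lambda>(t, x). r t x) \<in> borel_measurable (lborel \<Otimes>\<^sub>M lborel)"
      "AE t in lborel. - real n < t \<longrightarrow> (AE x in U01. F_P b \<omega> (\<phi> t x) (r t x))"
      "AE t in lborel. - real n < t \<longrightarrow>
         (\<exists>v w. H_deriv \<phi> t v \<and> opA (\<phi> t) w \<and> Hnorm (\<lambda>x. v x + w x - r t x) = 0)"
      unfolding is_solution_def AE_U01 by blast
    show ?thesis
      using r(2,3)
    proof eventually_elim
      case (elim t)
      show ?case
      proof
        assume t: "- real n < t"
        obtain v w where vw: "H_deriv \<phi> t v" "opA (\<phi> t) w" "Hnorm (\<lambda>x. v x + w x - r t x) = 0"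
          using elim t by blast
        obtain g where g: "inH w" "AE x in U01. \<phi> t x = g x" "g 0 = 0" "g 1 = 0"
          "second_deriv_L2 g (\<lambda>x. - w x)"
          using opA_E[OF vw(2)] by metis
        have F: "AE x in U01. F_P b \<omega> (\<phi> t x) (r t x)" using elim t by blast
        have "inH v" using vw(1) by (simp add: H_deriv_def)
        moreover have "inH (r t)"
          by (rule inH_source_F_P[OF H source_slice_measurable[OF r(1)] F b])
        ultimately have eq: "AE x in U01. v x + w x = r t x"
          using g(1) vw(3) by (intro AE_eq_source)
        have "continuous_on {0..1} g" using second_deriv_L2_E[OF g(5)] by blast
        moreover have "AE x in U01. g x \<ge> 0"
          using g(2) nn[of t] by eventually_elim simp
        ultimately have gnn: "g x \<ge> 0" if "x \<in> {0..1}" for x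
          using that by (intro AE_U01_nonneg_continuous)
        have "AE x in U01. \<phi> t x = 0 \<longrightarrow> v x = 0"
          by (rule H_deriv_eq_0_where_minimal[OF vw(1) H nn])
        moreover have "AE x in U01. g x = 0 \<longrightarrow> - w x = 0"
          by (rule AE_second_deriv_zero[OF g(5) gnn])
        ultimately have "AE x in U01. v x = - w x + (if g x = 0 then 0 else b + \<omega> * g x)"
          using F eq g(2) nn[of t]
        proof eventually_elim
          case (elim x)
          then show ?case
            by (cases "g x = 0") (auto simp: F_P_def H0_def split: if_splits)
        qed
        then show "regular_at b \<omega> \<phi> t"
          unfolding regular_at_def using vw(1) g gnn by blast
      qed
    qed
  qed
  then have "AE t in lborel. \<forall>n. - real n < t \<longrightarrow> regular_at b \<omega> \<phi> t"
    unfolding AE_all_countable by blast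
  then show ?thesis
  proof eventually_elim
    case (elim t)
    obtain n where "- t < real n" using reals_Archimedean2 by blast
    then have "- real n < t" by simp
    then show ?case using elim by blast
  qed
qed

section \<open>Integrals against non-negative backward subsolutions\<close>

lemma integral_difference_quotient_tendsto:
  assumes p: "inH p" and t: "t \<in> {T1..T2}"
    and z: "\<And>s. s \<in> {T1..T2} \<Longrightarrow> z s \<in> borel_measurable U01" "zt \<in> borel_measurable U01"
    and der: "\<And>x. x \<in> {0<..<1} \<Longrightarrow> ((\<lambda>s. z s x) has_real_derivative zt x) (at t)"
    and L: "\<And>s x. s \<in> {T1..T2} \<Longrightarrow> x \<in> {0<..<1} \<Longrightarrow> \<bar>z s x - z t x\<bar> \<le> L * \<bar>s - t\<bar>"
  shows "((\<lambda>s. \<integral>x. p x * ((z s x - z t x) / (s - t)) \<partial>U01) \<longlongrightarrow> (\<integral>x. p x * zt x \<partial>U01)) (at t within {T1..T2})"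
  unfolding tendsto_at_iff_sequentially comp_def
proof (intro allI impI)
  fix X :: "nat \<Rightarrow> real" assume X: "\<forall>i. X i \<in> {T1..T2} - {t}" "X \<longlonglongrightarrow> t"
  show "(\<lambda>i. \<integral>x. p x * ((z (X i) x - z t x) / (X i - t)) \<partial>U01) \<longlonglongrightarrow> (\<integral>x. p x * zt x \<partial>U01)"
  proof (rule integral_dominated_convergence)
    \<comment> \<open>The Lipschitz bound, uniform in x, makes this an integrable majorant of all
      the difference quotients.\<close>
    show "integrable U01 (\<lambda>x. L * \<bar>p x\<bar>)" using inH_integrable[OF p] by simp
    show "(\<lambda>x. p x * zt x) \<in> borel_measurable U01"
      using inH_measurable[OF p] z(2) by (rule borel_measurable_times)
    show "(\<lambda>x. p x * ((z (X i) x - z t x) / (X i - t))) \<in> borel_measurable U01" for i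
      using inH_measurable[OF p] z(1)[OF t] z(1)[of "X i"] X(1)
      by (intro borel_measurable_times borel_measurable_divide borel_measurable_diff borel_measurable_const) auto
    show "AE x in U01. (\<lambda>i. p x * ((z (X i) x - z t x) / (X i - t))) \<longlonglongrightarrow> p x * zt x"
    proof (rule AE_I2)
      fix x assume "x \<in> space U01"
      then have "((\<lambda>s. (z s x - z t x) / (s - t)) \<longlongrightarrow> zt x) (at t)"
        using der[of x] by (simp add: has_field_derivative_iff)
      moreover have "filterlim X (at t) sequentially"
        using X by (intro filterlim_atI) auto
      ultimately have "(\<lambda>i. (z (X i) x - z t x) / (X i - t)) \<longlonglongrightarrow> zt x"
        by (rule filterlim_compose)
      then show "(\<lambda>i. p x * ((z (X i) x - z t x) / (X i - t))) \<longlonglongrightarrow> p x * zt x"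
        by (rule tendsto_mult_left)
    qed
    show "AE x in U01. norm (p x * ((z (X i) x - z t x) / (X i - t))) \<le> L * \<bar>p x\<bar>" for i
    proof (rule AE_I2)
      fix x assume x: "x \<in> space U01"
      have Xi: "X i \<in> {T1..T2}" "X i \<noteq> t" using X(1) by auto
      then have "\<bar>(z (X i) x - z t x) / (X i - t)\<bar> \<le> L"
        using L[of "X i" x] x by (simp add: abs_divide divide_le_eq)
      then have "\<bar>(z (X i) x - z t x) / (X i - t)\<bar> * \<bar>p x\<bar> \<le> L * \<bar>p x\<bar>"
        by (rule mult_right_mono) simp
      then show "norm (p x * ((z (X i) x - z t x) / (X i - t))) \<le> L * \<bar>p x\<bar>"
        by (simp only: real_norm_def abs_mult mult.commute[of "\<bar>p x\<bar>"])
    qed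
  qed
qed

text \<open>At a regular time the derivative of the integral of \<open>\<phi> * z\<close> is that of
  \<open>v * z\<close> plus that of \<open>\<phi> * zt\<close>. Green's formula moves the space
  derivatives onto z, leaving g times \<open>zt + zxx\<close> and the source times z, both
  non-negative.\<close>

lemma integral_test_mono:
  assumes b: "b \<ge> 0" and \<omega>: "\<omega> \<ge> 0"
    and H: "\<And>t. inH (\<phi> t)" and M: "\<And>t. Hnorm (\<phi> t) \<le> M"
    and ac: "H_abs_cont \<phi> T1 T2" and T: "T1 \<le> T2"
    and reg: "AE t in lborel. regular_at b \<omega> \<phi> t"
    and zt: "\<And>t x. t \<in> {T1..T2} \<Longrightarrow> x \<in> {0..1} \<Longrightarrow> ((\<lambda>t. z t x) has_real_derivative zt t x) (at t)"
    and zt_bound: "\<And>t x. t \<in> {T1..T2} \<Longrightarrow> x \<in> {0..1} \<Longrightarrow> \<bar>zt t x\<bar> \<le> L"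
    and zt_cont: "\<And>t. t \<in> {T1..T2} \<Longrightarrow> continuous_on {0..1} (zt t)"
    and zx: "\<And>t x. t \<in> {T1..T2} \<Longrightarrow> x \<in> {0..1} \<Longrightarrow> (z t has_real_derivative zx t x) (at x within {0..1})"
    and zxx: "\<And>t x. t \<in> {T1..T2} \<Longrightarrow> x \<in> {0..1} \<Longrightarrow> (zx t has_real_derivative zxx t x) (at x within {0..1})"
    and zxx_cont: "\<And>t. t \<in> {T1..T2} \<Longrightarrow> continuous_on {0..1} (zxx t)"
    and z0: "\<And>t. t \<in> {T1..T2} \<Longrightarrow> z t 0 = 0" and z1: "\<And>t. t \<in> {T1..T2} \<Longrightarrow> z t 1 = 0"
    and znn: "\<And>t x. t \<in> {T1..T2} \<Longrightarrow> x \<in> {0..1} \<Longrightarrow> z t x \<ge> 0"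
    and sub: "\<And>t x. t \<in> {T1..T2} \<Longrightarrow> x \<in> {0..1} \<Longrightarrow> zt t x + zxx t x \<ge> 0"
  shows "(\<integral>x. \<phi> T1 x * z T1 x \<partial>U01) \<le> (\<integral>x. \<phi> T2 x * z T2 x \<partial>U01)"
proof -
  have L0: "L \<ge> 0" using zt_bound[of T1 0] T by force
  have M0: "M \<ge> 0" using Hnorm_nonneg[of "\<phi> 0"] M[of 0] by linarith
  have z_cont: "continuous_on {0..1} (z t)" if "t \<in> {T1..T2}" for t
    using zx[OF that] by (rule has_real_derivative_imp_continuous_on)
  note z_meas = continuous_on_measurable_U01[OF z_cont]
  note zH = continuous_on_inH[OF z_cont]
  have z_lip: "\<bar>z s x - z t x\<bar> \<le> L * \<bar>s - t\<bar>" if "s \<in> {T1..T2}" "t \<in> {T1..T2}" "x \<in> {0..1}" for s t x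
  proof -
    have "norm (z s x - z t x) \<le> L * norm (s - t)"
      by (rule field_differentiable_bound[of "{T1..T2}" "\<lambda>t. z t x" "\<lambda>t. zt t x"])
        (use that zt zt_bound in \<open>auto intro: has_field_derivative_at_within\<close>)
    then show ?thesis by simp
  qed
  obtain B0 where B0: "B0 > 0" "\<And>x. x \<in> {0..1} \<Longrightarrow> \<bar>z T1 x\<bar> \<le> B0"
    using continuous_on_bounded_abs[OF z_cont[of T1]] T by auto
  define B where "B = B0 + L * (T2 - T1)"
  have B: "\<bar>z t x\<bar> \<le> B" if "t \<in> {T1..T2}" "x \<in> {0..1}" for t x
  proof -
    have "\<bar>z t x - z T1 x\<bar> \<le> L * (T2 - T1)"
      using z_lip[of t T1 x] that T mult_left_mono[of "\<bar>t - T1\<bar>" "T2 - T1" L] L0 by auto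
    then show ?thesis using B0(2)[OF that(2)] by (simp add: B_def)
  qed
  have Bnn: "B \<ge> 0" using B0 L0 T by (simp add: B_def)
  define f where "f t = (\<integral>x. \<phi> t x * z t x \<partial>U01)" for t
  \<comment> \<open>The increment of \<phi> is paired with \<open>z s\<close> and that of z with
    \<open>\<phi> t\<close>: the first term is controlled by the supremum \<open>B\<close>, the
    second by the Lipschitz constant \<open>L\<close>.\<close>
  have diff: "f s - f t = (\<integral>x. (\<phi> s x - \<phi> t x) * z s x \<partial>U01) + (\<integral>x. \<phi> t x * (z s x - z t x) \<partial>U01)"
    if st: "s \<in> {T1..T2}" "t \<in> {T1..T2}" for s t
  proof -
    have "(\<integral>x. (\<phi> s x - \<phi> t x) * z s x \<partial>U01) + (\<integral>x. \<phi> t x * (z s x - z t x) \<partial>U01)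
      = (\<integral>x. (\<phi> s x - \<phi> t x) * z s x + \<phi> t x * (z s x - z t x) \<partial>U01)"
      using H zH[OF st(1)] zH[OF st(2)]
      by (intro Bochner_Integration.integral_add[symmetric] integrable_mult_inH inH_diff)
    also have "\<dots> = (\<integral>x. \<phi> s x * z s x - \<phi> t x * z t x \<partial>U01)"
      by (intro Bochner_Integration.integral_cong) (auto simp: algebra_simps)
    also have "\<dots> = f s - f t"
      unfolding f_def using H zH[OF st(1)] zH[OF st(2)]
      by (intro Bochner_Integration.integral_diff integrable_mult_inH)
    finally show ?thesis ..
  qed
  have "f T1 \<le> f T2"
  proof (rule nonneg_AE_deriv_imp_mono[OF T ac _ Bnn])
    \<comment> \<open>The part of the increment that is Lipschitz in time comes from the motion of
      z, paired with a trajectory of norm at most M.\<close>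
    show "0 \<le> L * M" using L0 M0 by simp
    fix s t assume st: "s \<in> {T1..T2}" "t \<in> {T1..T2}"
    have "\<bar>\<integral>x. (\<phi> s x - \<phi> t x) * z s x \<partial>U01\<bar> \<le> B * Hnorm (\<lambda>x. \<phi> s x - \<phi> t x)"
      using B[OF st(1)] by (intro integral_bounded_mult_le inH_diff H z_meas[OF st(1)]) auto
    moreover have "\<bar>\<integral>x. \<phi> t x * (z s x - z t x) \<partial>U01\<bar> \<le> (L * \<bar>s - t\<bar>) * Hnorm (\<phi> t)"
      using z_lip[OF st] z_meas[OF st(1)] z_meas[OF st(2)] by (intro integral_bounded_mult_le H) auto
    moreover have "(L * \<bar>s - t\<bar>) * Hnorm (\<phi> t) \<le> (L * \<bar>s - t\<bar>) * M"
      using M L0 by (intro mult_left_mono) auto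
    ultimately show "\<bar>f s - f t\<bar> \<le> B * Hnorm (\<lambda>x. \<phi> s x - \<phi> t x) + (L * M) * \<bar>s - t\<bar>"
      unfolding diff[OF st] by (simp add: mult.assoc mult.left_commute mult.commute)
  next
    show "AE t in lborel. T1 < t \<and> t < T2 \<longrightarrow> (\<exists>D\<ge>0. (f has_real_derivative D) (at t))"
      using reg
    proof eventually_elim
      case (elim t)
      show ?case
      proof
        assume t: "T1 < t \<and> t < T2"
        then have tI: "t \<in> {T1..T2}" by auto
        obtain v g h where vgh: "H_deriv \<phi> t v" "AE x in U01. \<phi> t x = g x" "g 0 = 0" "g 1 = 0"
          "second_deriv_L2 g h" "\<forall>x\<in>{0..1}. 0 \<le> g x"
          "AE x in U01. v x = h x + (if g x = 0 then 0 else b + \<omega> * g x)"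
          using elim unfolding regular_at_def by blast
        have vH: "inH v" using vgh(1) by (simp add: H_deriv_def)
        have gc: "continuous_on {0..1} g" and hH: "inH h" using second_deriv_L2_E[OF vgh(5)] by blast+
        have gH: "inH g" by (rule continuous_on_inH[OF gc])
        have ztH: "inH (zt t)" by (rule continuous_on_inH[OF zt_cont[OF tI]])
        have zxxH: "inH (zxx t)" by (rule continuous_on_inH[OF zxx_cont[OF tI]])
        define D where "D = (\<integral>x. v x * z t x \<partial>U01) + (\<integral>x. \<phi> t x * zt t x \<partial>U01)"
        have "D \<ge> 0"
        proof -
          have "(\<integral>x. \<phi> t x * zt t x \<partial>U01) = (\<integral>x. g x * zt t x \<partial>U01)"
            by (rule integral_cong_AE)
              (use vgh(2) integrable_mult_inH[OF H ztH] integrable_mult_inH[OF gH ztH] in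
                \<open>auto intro: borel_measurable_integrable\<close>)
          moreover have "(\<integral>x. h x * z t x \<partial>U01) = (\<integral>x. g x * zxx t x \<partial>U01)"
            using Green_U01[OF vgh(5,3,4) zx[OF tI] zxx[OF tI] zxx_cont[OF tI] z0[OF tI] z1[OF tI]] .
          moreover have "(\<integral>x. v x * z t x \<partial>U01) = (\<integral>x. h x * z t x \<partial>U01) + (\<integral>x. (v x - h x) * z t x \<partial>U01)"
            using integrable_mult_inH[OF vH zH[OF tI]] integrable_mult_inH[OF hH zH[OF tI]]
            by (simp add: left_diff_distrib)
          \<comment> \<open>Here v - h is the source, which is 0 or
            \<open>b + \<omega> * g\<close>.\<close>
          moreover have "(\<integral>x. (v x - h x) * z t x \<partial>U01) \<ge> 0"
          proof (rule integral_nonneg_AE)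
            show "AE x in U01. 0 \<le> (v x - h x) * z t x"
              using vgh(7) AE_space
            proof eventually_elim
              case (elim x)
              then have "x \<in> {0..1}" by auto
              then have "g x \<ge> 0" "z t x \<ge> 0" using vgh(6) znn[OF tI] by auto
              then show ?case using elim(1) b \<omega> by (auto intro!: mult_nonneg_nonneg)
            qed
          qed
          moreover have "(\<integral>x. g x * zxx t x \<partial>U01) + (\<integral>x. g x * zt t x \<partial>U01) = (\<integral>x. g x * (zt t x + zxx t x) \<partial>U01)"
            using integrable_mult_inH[OF gH ztH] integrable_mult_inH[OF gH zxxH]
            by (simp add: distrib_left)
          moreover have "(\<integral>x. g x * (zt t x + zxx t x) \<partial>U01) \<ge> 0"
            using vgh(6) sub[OF tI] by (intro integral_nonneg_AE AE_I2 mult_nonneg_nonneg) auto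
          ultimately show ?thesis unfolding D_def by linarith
        qed
        moreover have "(f has_real_derivative D) (at t within {T1..T2})"
        proof -
          define q where "q s x = (\<phi> s x - \<phi> t x) / (s - t)" for s x
          have qH: "inH (q s)" for s unfolding q_def by (intro inH_diff inH_divide H)
          \<comment> \<open>Product rule for difference quotients; the first two terms tend to 0.
            The identity also holds at s = t, where division by zero makes both sides 0.\<close>
          have quot: "(f s - f t) / (s - t) = (\<integral>x. (q s x - v x) * z s x \<partial>U01) + (\<integral>x. v x * (z s x - z t x) \<partial>U01)
             + (\<integral>x. v x * z t x \<partial>U01) + (\<integral>x. \<phi> t x * ((z s x - z t x) / (s - t)) \<partial>U01)"
            if s: "s \<in> {T1..T2}" for s
          proof -
            have "(\<integral>x. (q s x - v x) * z s x \<partial>U01) + (\<integral>x. v x * (z s x - z t x) \<partial>U01) + (\<integral>x. v x * z t x \<partial>U01)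
              = (\<integral>x. (q s x - v x) * z s x + v x * (z s x - z t x) + v x * z t x \<partial>U01)"
              using qH vH zH[OF s] zH[OF tI]
              by (simp add: integrable_mult_inH inH_diff)
            also have "\<dots> = (\<integral>x. ((\<phi> s x - \<phi> t x) * z s x) / (s - t) \<partial>U01)"
              by (intro Bochner_Integration.integral_cong) (auto simp: algebra_simps q_def)
            finally show ?thesis using diff[OF s tI] by (simp add: add_divide_distrib)
          qed
          have "((\<lambda>s. (\<integral>x. (q s x - v x) * z s x \<partial>U01) + (\<integral>x. v x * (z s x - z t x) \<partial>U01)
             + (\<integral>x. v x * z t x \<partial>U01) + (\<integral>x. \<phi> t x * ((z s x - z t x) / (s - t)) \<partial>U01)) \<longlongrightarrow>
             0 + 0 + (\<integral>x. v x * z t x \<partial>U01) + (\<integral>x. \<phi> t x * zt t x \<partial>U01)) (at t within {T1..T2})"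
          proof (intro tendsto_add tendsto_const)
            have lim: "((\<lambda>s. Hnorm (\<lambda>x. q s x - v x)) \<longlongrightarrow> 0) (at t within {T1..T2})"
              using vgh(1) unfolding H_deriv_def q_def by (auto intro: tendsto_within_subset)
            have "((\<lambda>s. B * Hnorm (\<lambda>x. q s x - v x)) \<longlongrightarrow> 0) (at t within {T1..T2})"
              using tendsto_mult_left[OF lim, of B] by simp
            then show "((\<lambda>s. \<integral>x. (q s x - v x) * z s x \<partial>U01) \<longlongrightarrow> 0) (at t within {T1..T2})"
            proof (rule Lim_null_comparison[rotated])
              show "\<forall>\<^sub>F s in at t within {T1..T2}. norm (\<integral>x. (q s x - v x) * z s x \<partial>U01) \<le> B * Hnorm (\<lambda>x. q s x - v x)"
                unfolding eventually_at_filter real_norm_def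
                using B z_meas by (intro always_eventually allI impI integral_bounded_mult_le inH_diff qH vH) auto
            qed
            have "((\<lambda>s. (L * \<bar>s - t\<bar>) * Hnorm v) \<longlongrightarrow> (L * \<bar>t - t\<bar>) * Hnorm v) (at t within {T1..T2})"
              by (intro tendsto_intros)
            then have "((\<lambda>s. (L * \<bar>s - t\<bar>) * Hnorm v) \<longlongrightarrow> 0) (at t within {T1..T2})" by simp
            then show "((\<lambda>s. \<integral>x. v x * (z s x - z t x) \<partial>U01) \<longlongrightarrow> 0) (at t within {T1..T2})"
            proof (rule Lim_null_comparison[rotated])
              show "\<forall>\<^sub>F s in at t within {T1..T2}. norm (\<integral>x. v x * (z s x - z t x) \<partial>U01) \<le> (L * \<bar>s - t\<bar>) * Hnorm v"
                unfolding eventually_at_filter real_norm_def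
                using z_lip[OF _ tI] z_meas tI
                by (intro always_eventually allI impI integral_bounded_mult_le vH) auto
            qed
            show "((\<lambda>s. \<integral>x. \<phi> t x * ((z s x - z t x) / (s - t)) \<partial>U01) \<longlongrightarrow> (\<integral>x. \<phi> t x * zt t x \<partial>U01)) (at t within {T1..T2})"
              using z_lip[OF _ tI] zt[OF tI] z_meas inH_measurable[OF ztH] tI
              by (intro integral_difference_quotient_tendsto[where L = L] H) auto
          qed
          moreover have "0 + 0 + (\<integral>x. v x * z t x \<partial>U01) + (\<integral>x. \<phi> t x * zt t x \<partial>U01) = D" by (simp add: D_def)
          ultimately have "((\<lambda>s. (f s - f t) / (s - t)) \<longlongrightarrow> D) (at t within {T1..T2})"
            using quot[symmetric] by (auto elim!: Lim_transform_within[where d = 1])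
          then show ?thesis by (simp add: has_field_derivative_iff)
        qed
        ultimately show "\<exists>D\<ge>0. (f has_real_derivative D) (at t)"
          using t by (auto simp: at_within_Icc_at)
      qed
    qed
  qed
  then show ?thesis by (simp add: f_def)
qed

section \<open>The reflected heat kernel\<close>

lemma has_real_derivative_max_zero:
  fixes p p' :: "real \<Rightarrow> real"
  assumes p: "\<And>m. m > 0 \<Longrightarrow> (p has_real_derivative p' m) (at m)" and 0: "p 0 = 0" "p' 0 = 0"
    and C: "\<And>m. m \<ge> 0 \<Longrightarrow> \<bar>p m\<bar> \<le> C * m^2"
  shows "((\<lambda>y. p (max y 0)) has_real_derivative p' (max y 0)) (at y)"
proof -
  consider "y > 0" | "y < 0" | "y = 0" by linarith
  then show ?thesis
  proof cases
    case 1
    have "((\<lambda>y. p (max y 0)) has_real_derivative p' y) (at y)"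
      by (rule has_field_derivative_transform_within_open[OF p[OF 1], of "{0<..}"]) (use 1 in auto)
    then show ?thesis using 1 by simp
  next
    case 2
    have "((\<lambda>y. p (max y 0)) has_real_derivative 0) (at y)"
      by (rule has_field_derivative_transform_within_open[of "\<lambda>y. 0", of _ _ "{..<0}"]) (use 2 0 in auto)
    then show ?thesis using 2 0 by simp
  next
    case 3
    \<comment> \<open>At the junction the quadratic bound on p makes the difference quotients O(h),
      which matches the zero branch on the left.\<close>
    have "((\<lambda>h. \<bar>C\<bar> * \<bar>h\<bar>) \<longlongrightarrow> \<bar>C\<bar> * \<bar>0\<bar>) (at (0::real))" by (intro tendsto_intros)
    then have "((\<lambda>h. \<bar>C\<bar> * \<bar>h\<bar>) \<longlongrightarrow> 0) (at (0::real))" by simp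
    then have "((\<lambda>h. p (max h 0) / h) \<longlongrightarrow> 0) (at 0)"
    proof (rule Lim_null_comparison[rotated])
      have "norm (p (max h 0) / h) \<le> \<bar>C\<bar> * \<bar>h\<bar>" if "h \<noteq> 0" for h
      proof (cases "h > 0")
        case True
        have "\<bar>p h\<bar> \<le> \<bar>C\<bar> * h^2" using True by (intro order_trans[OF C mult_right_mono]) auto
        then show ?thesis using True by (simp add: abs_divide divide_le_eq power2_eq_square mult.assoc)
      qed (use 0 in \<open>simp add: mult_nonneg_nonpos\<close>)
      then show "\<forall>\<^sub>F h in at 0. norm (p (max h 0) / h) \<le> \<bar>C\<bar> * \<bar>h\<bar>"
        by (auto simp: eventually_at_filter)
    qed
    then show ?thesis using 3 0 by (simp add: has_field_derivative_iff)
  qed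
qed

text \<open>A convex \<open>C\<^sup>2\<close> function vanishing on the negative axis and lying below the positive part:
  composed with a solution of the heat equation it gives a subsolution.\<close>

definition convex_cutoff :: "real \<Rightarrow> real" where
  "convex_cutoff y = (max y 0)^3 / (1 + max y 0)^2"

definition convex_cutoff' :: "real \<Rightarrow> real" where
  "convex_cutoff' y = (max y 0)^2 * (max y 0 + 3) / (1 + max y 0)^3"

definition convex_cutoff'' :: "real \<Rightarrow> real" where
  "convex_cutoff'' y = 6 * max y 0 / (1 + max y 0)^4"

text \<open>The cube makes value, slope and second derivative vanish at 0, so the two branches fit
  together in C^2; the squared denominator reduces the growth to linear with slope at most
  1.\<close>

lemma DERIV_convex_cutoff: "(convex_cutoff has_real_derivative convex_cutoff' y) (at y)"
proof -
  have "((\<lambda>y. (\<lambda>m. m^3 / (1 + m)^2) (max y 0)) has_real_derivative (\<lambda>m. m^2 * (m + 3) / (1 + m)^3) (max y 0)) (at y)"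
  proof (rule has_real_derivative_max_zero)
    show "((\<lambda>m. m^3 / (1 + m)^2) has_real_derivative m^2 * (m + 3) / (1 + m)^3) (at m)" if "m > 0" for m :: real
      using that by (auto intro!: derivative_eq_intros simp: divide_simps) algebra
    show "\<bar>m^3 / (1 + m)^2\<bar> \<le> 1 * m^2" if "m \<ge> 0" for m :: real
    proof -
      have "m^2 * m \<le> m^2 * (1 + m)^2"
        using that by (intro mult_left_mono) (auto simp: power2_eq_square algebra_simps)
      then show ?thesis using that by (simp add: divide_le_eq power3_eq_cube power2_eq_square)
    qed
  qed auto
  then show ?thesis by (simp add: convex_cutoff_def[abs_def] convex_cutoff'_def)
qed

lemma DERIV_convex_cutoff': "(convex_cutoff' has_real_derivative convex_cutoff'' y) (at y)"
proof -
  have "((\<lambda>y. (\<lambda>m. m^2 * (m + 3) / (1 + m)^3) (max y 0)) has_real_derivative (\<lambda>m. 6 * m / (1 + m)^4) (max y 0)) (at y)"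
  proof (rule has_real_derivative_max_zero)
    show "((\<lambda>m. m^2 * (m + 3) / (1 + m)^3) has_real_derivative 6 * m / (1 + m)^4) (at m)" if "m > 0" for m :: real
      using that by (auto intro!: derivative_eq_intros simp: divide_simps) algebra
    show "\<bar>m^2 * (m + 3) / (1 + m)^3\<bar> \<le> 3 * m^2" if "m \<ge> 0" for m :: real
    proof -
      have "0 \<le> m^2 * (3 * (1 + m)^3 - (m + 3))"
        using that by (intro mult_nonneg_nonneg) (auto simp: power3_eq_cube algebra_simps)
      then show ?thesis using that by (simp add: divide_le_eq algebra_simps)
    qed
  qed auto
  then show ?thesis by (simp add: convex_cutoff'_def[abs_def] convex_cutoff''_def)
qed

lemma convex_cutoff_eq_0: "y \<le> 0 \<Longrightarrow> convex_cutoff y = 0"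
  by (simp add: convex_cutoff_def)

lemma convex_cutoff_pos: "y > 0 \<Longrightarrow> convex_cutoff y > 0"
  by (simp add: convex_cutoff_def)

lemma convex_cutoff_nonneg: "convex_cutoff y \<ge> 0"
  by (simp add: convex_cutoff_def)

lemma convex_cutoff_le: "convex_cutoff y \<le> max y 0"
proof -
  define m where "m = max y 0"
  have m: "m \<ge> 0" by (simp add: m_def)
  have "m^3 \<le> m * (1 + m)^2" using m by (simp add: power3_eq_cube power2_eq_square algebra_simps)
  then show ?thesis
    unfolding convex_cutoff_def m_def[symmetric] using m by (simp add: divide_le_eq)
qed

lemma convex_cutoff'_bounds: "0 \<le> convex_cutoff' y" "convex_cutoff' y \<le> 1"
proof -
  define m where "m = max y 0"
  have m: "m \<ge> 0" by (simp add: m_def)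
  have "m^2 * (m + 3) \<le> (1 + m)^3" using m by (simp add: power3_eq_cube power2_eq_square algebra_simps)
  then show "convex_cutoff' y \<le> 1"
    unfolding convex_cutoff'_def m_def[symmetric] using m by (simp add: divide_le_eq)
  show "0 \<le> convex_cutoff' y"
    unfolding convex_cutoff'_def m_def[symmetric] using m by simp
qed

lemma convex_cutoff''_nonneg: "0 \<le> convex_cutoff'' y"
  by (simp add: convex_cutoff''_def)

lemma continuous_on_convex_cutoff'':
  assumes "continuous_on S f" shows "continuous_on S (\<lambda>x. convex_cutoff'' (f x))"
proof -
  have "1 + max y 0 \<noteq> 0" for y :: real by (simp add: max_def)
  then show ?thesis unfolding convex_cutoff''_def by (intro continuous_intros assms) auto
qed

lemma convex_cutoff_mono: "y \<le> y' \<Longrightarrow> convex_cutoff y \<le> convex_cutoff y'"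
  by (rule DERIV_nonneg_imp_nondecreasing)
    (use DERIV_convex_cutoff convex_cutoff'_bounds in blast)+

text \<open>The heat kernel, up to the factor \<open>(4\<pi>)\<^sup>-\<^sup>1\<^sup>/\<^sup>2\<close>.\<close>

definition heat_kernel :: "real \<Rightarrow> real \<Rightarrow> real" where
  "heat_kernel s y = exp (- (y^2 / (4 * s))) / sqrt s"

definition heat_kernel_y :: "real \<Rightarrow> real \<Rightarrow> real" where
  "heat_kernel_y s y = - (y / (2 * s)) * heat_kernel s y"

text \<open>One function serves both as time derivative and as second space derivative, which is how
  the heat equation enters.\<close>

definition heat_kernel_s :: "real \<Rightarrow> real \<Rightarrow> real" where
  "heat_kernel_s s y = (y^2 / (4 * s^2) - 1 / (2 * s)) * heat_kernel s y"

lemma DERIV_heat_kernel_s: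
  assumes "s > 0" shows "((\<lambda>s. heat_kernel s y) has_real_derivative heat_kernel_s s y) (at s)"
proof -
  have "sqrt s > 0" "sqrt s * sqrt s = s" using assms by auto
  then show ?thesis
    unfolding heat_kernel_def heat_kernel_s_def using assms
    by (auto intro!: derivative_eq_intros simp: field_simps power2_eq_square)
qed

lemma DERIV_heat_kernel_y:
  assumes "s > 0" shows "(heat_kernel s has_real_derivative heat_kernel_y s y) (at y)"
  unfolding heat_kernel_def[abs_def] heat_kernel_y_def using assms
  by (auto intro!: derivative_eq_intros simp: field_simps power2_eq_square)

lemma DERIV_heat_kernel_yy:
  assumes "s > 0" shows "(heat_kernel_y s has_real_derivative heat_kernel_s s y) (at y)"
proof -
  have "((\<lambda>y. - (y / (2 * s)) * heat_kernel s y) has_real_derivative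
     - (1 / (2 * s)) * heat_kernel s y + heat_kernel_y s y * - (y / (2 * s))) (at y)"
    using assms by (auto intro!: derivative_eq_intros DERIV_heat_kernel_y simp: field_simps)
  also have "- (1 / (2 * s)) * heat_kernel s y + heat_kernel_y s y * - (y / (2 * s)) = heat_kernel_s s y"
    using assms by (simp add: heat_kernel_s_def heat_kernel_y_def field_simps power2_eq_square)
  finally show ?thesis by (simp add: heat_kernel_y_def[abs_def])
qed

lemma heat_kernel_pos: "s > 0 \<Longrightarrow> heat_kernel s y > 0"
  by (simp add: heat_kernel_def)

lemma heat_kernel_minus: "heat_kernel s (- y) = heat_kernel s y"
  by (simp add: heat_kernel_def)

lemma continuous_on_heat_kernel_s:
  "s > 0 \<Longrightarrow> continuous_on A f \<Longrightarrow> continuous_on A (\<lambda>x. heat_kernel_s s (f x))"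
  unfolding heat_kernel_s_def heat_kernel_def by (intro continuous_intros) auto

text \<open>This supplies the Lipschitz constant in time required of a test function. The range |y|
  \<le> 2 covers x - a, x + a and 2 - x - a, and \<delta> keeps away from the singular time
  0.\<close>

lemma heat_kernel_s_bound:
  assumes "\<delta> > 0" "s \<ge> \<delta>" "\<bar>y\<bar> \<le> 2"
  shows "\<bar>heat_kernel_s s y\<bar> \<le> (1 / \<delta>^2 + 1 / (2 * \<delta>)) / sqrt \<delta>"
proof -
  have s: "s > 0" using assms by simp
  have "y^2 \<le> 2^2" using assms(3) by (intro abs_le_square_iff[THEN iffD1]) simp
  then have "y^2 / (4 * s^2) \<le> 4 / (4 * s^2)" using s by (intro divide_right_mono) auto
  also have "\<dots> \<le> 1 / \<delta>^2" using assms by (simp add: frac_le power_mono)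
  finally have 1: "y^2 / (4 * s^2) \<le> 1 / \<delta>^2" .
  have 2: "1 / (2 * s) \<le> 1 / (2 * \<delta>)" using assms by (intro frac_le) auto
  have "y^2 / (4 * s^2) \<ge> 0" "1 / (2 * s) \<ge> 0" using s by auto
  with 1 2 have 3: "\<bar>y^2 / (4 * s^2) - 1 / (2 * s)\<bar> \<le> 1 / \<delta>^2 + 1 / (2 * \<delta>)" by linarith
  have "heat_kernel s y \<le> 1 / sqrt \<delta>"
    unfolding heat_kernel_def using assms s by (intro frac_le) auto
  then have "\<bar>heat_kernel s y\<bar> \<le> 1 / sqrt \<delta>" using heat_kernel_pos[OF s, of y] by simp
  with 3 have "\<bar>heat_kernel_s s y\<bar> \<le> (1 / \<delta>^2 + 1 / (2 * \<delta>)) * (1 / sqrt \<delta>)"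
    unfolding heat_kernel_s_def abs_mult using assms by (intro mult_mono) auto
  then show ?thesis by simp
qed

text \<open>The product depends only on q = |y| / sqrt s, and exp (q^2 / 4) \<ge> 1 + q^2 / 4 \<ge>
  q. It yields a majorant, uniform in s, for a Lipschitz function vanishing at the centre times the
  kernel.\<close>

lemma heat_kernel_mult_abs_le:
  assumes "s > 0" shows "\<bar>y\<bar> * heat_kernel s y \<le> 1"
proof -
  define q where "q = \<bar>y\<bar> / sqrt s"
  have q: "q \<ge> 0" "y^2 / (4 * s) = q^2 / 4" using assms by (auto simp: q_def power_divide)
  have "q \<le> 1 + q^2 / 4" using zero_le_power2[of "q / 2 - 1"] by (simp add: power2_eq_square algebra_simps)
  also have "\<dots> \<le> exp (q^2 / 4)" by (rule exp_ge_add_one_self)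
  finally have "q * exp (- (q^2 / 4)) \<le> 1" by (simp add: exp_minus field_simps)
  moreover have "\<bar>y\<bar> * heat_kernel s y = q * exp (- (q^2 / 4))"
    unfolding heat_kernel_def q(2) by (simp add: q_def)
  ultimately show ?thesis by simp
qed

text \<open>For s = \<sigma> / k the kernel is exp (- c k) sqrt (k / \<sigma>), and exp (- c k)
  \<le> 1 / (c k) beats the square root.\<close>

lemma heat_kernel_tendsto_0:
  assumes "y \<noteq> 0" "\<sigma> > 0"
  shows "(\<lambda>n. heat_kernel (\<sigma> / real (Suc n)) y) \<longlonglongrightarrow> 0"
proof -
  define c where "c = y^2 / (4 * \<sigma>)"
  have c: "c > 0" using assms by (simp add: c_def)
  have "heat_kernel (\<sigma> / real (Suc n)) y = exp (- (c * real (Suc n))) * sqrt (real (Suc n)) / sqrt \<sigma>" for n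
    using assms by (simp add: heat_kernel_def c_def real_sqrt_divide)
  moreover have "(\<lambda>n. exp (- (c * real (Suc n))) * sqrt (real (Suc n)) / sqrt \<sigma>) \<longlonglongrightarrow> 0"
  proof -
    have "((\<lambda>n. 1 / (c * sqrt (real (Suc n))) / sqrt \<sigma>) \<longlonglongrightarrow> 0)"
    proof -
      have "(\<lambda>n. sqrt (1 / real (Suc n)) * (1 / (c * sqrt \<sigma>))) \<longlonglongrightarrow> sqrt 0 * (1 / (c * sqrt \<sigma>))"
        by (intro tendsto_intros LIMSEQ_Suc[OF lim_1_over_n])
      then show ?thesis by (simp add: real_sqrt_divide mult.assoc mult.commute mult.left_commute)
    qed
    then show ?thesis
    proof (rule Lim_null_comparison[rotated], intro always_eventually allI)
      fix n
      define k where "k = real (Suc n)"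
      have k: "k > 0" by (simp add: k_def)
      have "c * k \<le> exp (c * k)" using exp_ge_add_one_self[of "c * k"] by linarith
      then have "exp (- (c * k)) \<le> 1 / (c * k)" using c k by (simp add: exp_minus field_simps)
      then have "exp (- (c * k)) * sqrt k \<le> 1 / (c * k) * sqrt k" using k by (intro mult_right_mono) auto
      also have "\<dots> = 1 / (c * sqrt k)" using c k real_sqrt_mult_self[of k] by (simp add: divide_simps)
      finally have "exp (- (c * k)) * sqrt k / sqrt \<sigma> \<le> 1 / (c * sqrt k) / sqrt \<sigma>"
        using assms(2) by (intro divide_right_mono) auto
      then show "norm (exp (- (c * real (Suc n))) * sqrt (real (Suc n)) / sqrt \<sigma>)
          \<le> 1 / (c * sqrt (real (Suc n))) / sqrt \<sigma>"
        unfolding k_def[symmetric] using k assms(2) by (simp add: abs_mult)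
    qed
  qed
  ultimately show ?thesis by simp
qed

text \<open>Subtracting the reflections of the kernel in the two end points makes it nonpositive there.\<close>

definition reflected_kernel :: "real \<Rightarrow> real \<Rightarrow> real \<Rightarrow> real" where
  "reflected_kernel a s x = heat_kernel s (x - a) - heat_kernel s (x + a) - heat_kernel s (2 - x - a)"

definition reflected_kernel_x :: "real \<Rightarrow> real \<Rightarrow> real \<Rightarrow> real" where
  "reflected_kernel_x a s x = heat_kernel_y s (x - a) - heat_kernel_y s (x + a) + heat_kernel_y s (2 - x - a)"

definition reflected_kernel_s :: "real \<Rightarrow> real \<Rightarrow> real \<Rightarrow> real" where
  "reflected_kernel_s a s x = heat_kernel_s s (x - a) - heat_kernel_s s (x + a) - heat_kernel_s s (2 - x - a)"

lemma DERIV_reflected_kernel_s: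
  "s > 0 \<Longrightarrow> ((\<lambda>s. reflected_kernel a s x) has_real_derivative reflected_kernel_s a s x) (at s)"
  unfolding reflected_kernel_def reflected_kernel_s_def by (intro DERIV_diff DERIV_heat_kernel_s)

lemma DERIV_reflected_kernel_x:
  assumes s: "s > 0"
  shows "(reflected_kernel a s has_real_derivative reflected_kernel_x a s x) (at x)"
proof -
  note D = DERIV_chain2[OF DERIV_heat_kernel_y[OF s]]
  show ?thesis
    unfolding reflected_kernel_def[abs_def] reflected_kernel_x_def
    by (rule derivative_eq_intros D refl | simp)+
qed

lemma DERIV_reflected_kernel_xx:
  assumes s: "s > 0"
  shows "(reflected_kernel_x a s has_real_derivative reflected_kernel_s a s x) (at x)"
proof -
  note D = DERIV_chain2[OF DERIV_heat_kernel_yy[OF s]]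
  show ?thesis
    unfolding reflected_kernel_x_def[abs_def] reflected_kernel_s_def
    by (rule derivative_eq_intros D refl | simp)+
qed

text \<open>At each end point the kernel cancels against its reflection in that point, and the other
  reflection is left with a minus sign.\<close>

lemma reflected_kernel_boundary:
  assumes "s > 0"
  shows "reflected_kernel a s 0 \<le> 0" "reflected_kernel a s 1 \<le> 0"
  using heat_kernel_pos[OF assms, of "2 - a"] heat_kernel_pos[OF assms, of "1 + a"]
    heat_kernel_minus[of s a]
  by (auto simp: reflected_kernel_def)

lemma reflected_kernel_le: "s > 0 \<Longrightarrow> reflected_kernel a s x \<le> heat_kernel s (x - a)"
  using heat_kernel_pos[of s "x + a"] heat_kernel_pos[of s "2 - x - a"]
  by (simp add: reflected_kernel_def)

text \<open>The squares of x + a and of 2 - x - a exceed that of x - a by 4 x a and 4 (1 - x) (1 -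
  a). So each reflected term is the kernel times a factor exp (- c / s) with c \<ge> m; for small s
  each factor is at most 1/4, and half of the kernel survives.\<close>

lemma reflected_kernel_lower:
  assumes s: "0 < s" "\<sigma> \<le> s" "s \<le> 2 * \<sigma>" and x: "x \<in> {p..q}" "0 < p" "q < 1" and a: "0 < a" "a < 1"
    and m: "m \<le> p * a" "m \<le> (1 - q) * (1 - a)" "6 * \<sigma> \<le> m"
  shows "reflected_kernel a s x \<ge> exp (- (1 / (4 * \<sigma>))) / (2 * sqrt (2 * \<sigma>))"
proof -
  have \<sigma>: "\<sigma> > 0" using s by linarith
  \<comment> \<open>From 6 \<sigma> \<le> m \<le> c and s \<le> 2 \<sigma> follows c / s \<ge> 3,
    hence exp (c / s) \<ge> 1 + 3.\<close>
  have small: "exp (- (c / s)) \<le> 1/4" if "c \<ge> m" for c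
  proof -
    have "3 \<le> c / s" using that m(3) s by (simp add: le_divide_eq)
    moreover have "1 + c / s \<le> exp (c / s)" by (rule exp_ge_add_one_self)
    ultimately have "4 \<le> exp (c / s)" by linarith
    then show ?thesis by (simp add: exp_minus field_simps)
  qed
  have refl: "heat_kernel s y' = heat_kernel s (x - a) * exp (- (c / s))" if "y'^2 = (x - a)^2 + 4 * c" for y' c
  proof -
    have "y'^2 / (4 * s) = (x - a)^2 / (4 * s) + c / s" using s that by (simp add: field_simps)
    then show ?thesis by (simp add: heat_kernel_def exp_add[symmetric])
  qed
  have k: "heat_kernel s (x - a) > 0" using s by (intro heat_kernel_pos)
  have "p * a \<le> x * a" using x a by (intro mult_right_mono) auto
  then have "m \<le> x * a" using m(1) by linarith
  then have "exp (- (x * a / s)) \<le> 1/4" by (rule small)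
  then have r0: "heat_kernel s (x - a) * exp (- (x * a / s)) \<le> heat_kernel s (x - a) * (1/4)"
    using k by (intro mult_left_mono) auto
  have "(1 - q) * (1 - a) \<le> (1 - x) * (1 - a)" using x a by (intro mult_right_mono) auto
  then have "m \<le> (1 - x) * (1 - a)" using m(2) by linarith
  then have "exp (- ((1 - x) * (1 - a) / s)) \<le> 1/4" by (rule small)
  then have r1: "heat_kernel s (x - a) * exp (- ((1 - x) * (1 - a) / s)) \<le> heat_kernel s (x - a) * (1/4)"
    using k by (intro mult_left_mono) auto
  have "heat_kernel s (x + a) = heat_kernel s (x - a) * exp (- (x * a / s))"
    by (rule refl) (simp add: power2_eq_square algebra_simps)
  moreover have "heat_kernel s (2 - x - a) = heat_kernel s (x - a) * exp (- ((1 - x) * (1 - a) / s))"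
    by (rule refl) (simp add: power2_eq_square algebra_simps)
  ultimately have "reflected_kernel a s x \<ge> heat_kernel s (x - a) * (1/2)"
    unfolding reflected_kernel_def using r0 r1 by linarith
  moreover have "heat_kernel s (x - a) \<ge> exp (- (1 / (4 * \<sigma>))) / sqrt (2 * \<sigma>)"
    unfolding heat_kernel_def
  proof (rule frac_le)
    have "\<bar>x - a\<bar> \<le> 1" using x a by (auto simp: abs_le_iff)
    then have "(x - a)^2 \<le> 1" by (simp add: abs_square_le_1)
    then have "(x - a)^2 / (4 * s) \<le> 1 / (4 * \<sigma>)" using s \<sigma> by (intro frac_le) auto
    then show "exp (- (1 / (4 * \<sigma>))) \<le> exp (- ((x - a)^2 / (4 * s)))" by simp
  qed (use s in auto)
  ultimately show ?thesis by simp
qed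

section \<open>Positivity\<close>

locale nonneg_trajectory =
  fixes b \<omega> M :: real and \<phi> :: "real \<Rightarrow> real \<Rightarrow> real"
  assumes b_pos: "b > 0" and \<omega>_nonneg: "\<omega> \<ge> 0"
    and traj: "complete_trajectory (F_P b \<omega>) \<phi>"
    and bounded: "\<And>t. Hnorm (\<phi> t) \<le> M"
    and nonneg: "\<And>t. AE x in U01. \<phi> t x \<ge> 0"
begin

lemma inH_phi: "inH (\<phi> t)"
  using traj by (auto simp: complete_trajectory_def is_solution_def)

lemma abs_cont_phi: "T1 < T2 \<Longrightarrow> H_abs_cont \<phi> T1 T2"
  using traj unfolding complete_trajectory_def is_solution_def
  by (meson lt_ex)

lemma continuous_phi: "((\<lambda>s. Hnorm (\<lambda>x. \<phi> s x - \<phi> t x)) \<longlongrightarrow> 0) (at t)"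
proof -
  have "((\<lambda>s. Hnorm (\<lambda>x. \<phi> s x - \<phi> t x)) \<longlongrightarrow> 0) (at t within {t - 1..})"
    using traj unfolding complete_trajectory_def is_solution_def by simp
  moreover have "at t within {t - 1..} = at t"
    by (rule at_within_interior) (simp add: interior_real_atLeast)
  ultimately show ?thesis by simp
qed

lemma regular: "AE t in lborel. regular_at b \<omega> \<phi> t"
  using b_pos traj nonneg by (intro AE_regular_at) auto

lemmas test_mono = integral_test_mono[OF less_imp_le[OF b_pos] \<omega>_nonneg inH_phi bounded abs_cont_phi less_imp_le regular]

text \<open>This z solves the backward heat equation exactly, and it is positive inside the
  interval, so a vanishing integral of \<open>\<phi> T1 * z T1\<close> forces
  \<open>\<phi> T1\<close> to vanish.\<close>

lemma nonzero_forward: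
  assumes "T1 < T2" "Hnorm (\<phi> T1) \<noteq> 0"
  shows "Hnorm (\<phi> T2) \<noteq> 0"
proof
  assume "Hnorm (\<phi> T2) = 0"
  then have 0: "AE x in U01. \<phi> T2 x = 0" using Hnorm_eq_0_iff[OF inH_phi] by blast
  define z where "z t x = exp (pi^2 * t) * sin (pi * x)" for t x
  have zH: "inH (z t)" for t
    unfolding z_def by (intro continuous_on_inH continuous_intros)
  have znn: "z t x \<ge> 0" if "x \<in> {0..1}" for t x
    using that by (auto simp: z_def intro!: sin_ge_zero mult_nonneg_nonneg)
  have "(\<integral>x. \<phi> T1 x * z T1 x \<partial>U01) \<le> (\<integral>x. \<phi> T2 x * z T2 x \<partial>U01)"
  proof (rule test_mono[OF assms(1) assms(1),
        where zt = "\<lambda>t x. pi^2 * z t x" and zx = "\<lambda>t x. exp (pi^2 * t) * (pi * cos (pi * x))"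
          and zxx = "\<lambda>t x. - (pi^2 * z t x)" and L = "pi^2 * exp (pi^2 * T2)"])
    fix t x :: real assume tx: "t \<in> {T1..T2}" "x \<in> {0..1}"
    show "((\<lambda>t. z t x) has_real_derivative pi^2 * z t x) (at t)"
      unfolding z_def by (auto intro!: derivative_eq_intros)
    show "(z t has_real_derivative exp (pi^2 * t) * (pi * cos (pi * x))) (at x within {0..1})"
      unfolding z_def by (auto intro!: derivative_eq_intros)
    show "((\<lambda>x. exp (pi^2 * t) * (pi * cos (pi * x))) has_real_derivative - (pi^2 * z t x)) (at x within {0..1})"
      unfolding z_def by (auto intro!: derivative_eq_intros simp: power2_eq_square)
    have "\<bar>z t x\<bar> \<le> exp (pi^2 * T2) * 1"
      unfolding z_def abs_mult using tx by (intro mult_mono) auto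
    then show "\<bar>pi^2 * z t x\<bar> \<le> pi^2 * exp (pi^2 * T2)" by (simp add: abs_mult)
  qed (use znn in \<open>auto simp: z_def intro!: continuous_intros\<close>)
  moreover have "(\<integral>x. \<phi> T2 x * z T2 x \<partial>U01) = (\<integral>x. 0 \<partial>U01)"
    by (rule integral_cong_AE)
      (use 0 integrable_mult_inH[OF inH_phi zH] in \<open>auto intro: borel_measurable_integrable\<close>)
  moreover have nn: "AE x in U01. 0 \<le> \<phi> T1 x * z T1 x"
    using nonneg[of T1] AE_space by eventually_elim (auto intro!: mult_nonneg_nonneg znn)
  then have "0 \<le> (\<integral>x. \<phi> T1 x * z T1 x \<partial>U01)" by (rule integral_nonneg_AE)
  ultimately have "(\<integral>x. \<phi> T1 x * z T1 x \<partial>U01) = 0" by simp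
  then have "AE x in U01. \<phi> T1 x * z T1 x = 0"
    using integral_nonneg_eq_0_iff_AE[OF integrable_mult_inH[OF inH_phi zH] nn] by blast
  then have "AE x in U01. \<phi> T1 x = 0"
    using AE_space
  proof eventually_elim
    case (elim x)
    then have "sin (pi * x) > 0" by (intro sin_gt_zero) auto
    then show ?case using elim(1) by (auto simp: z_def)
  qed
  then show False using assms(2) Hnorm_eq_0_iff[OF inH_phi] by blast
qed

text \<open>With the kernel running backward in time, the first-order terms of the composition with
  the cut-off cancel and convexity leaves the non-negative term
  \<open>convex_cutoff'' (E t x) * (Ex t x)^2\<close>.\<close>

lemma barrier_mono:
  assumes a: "0 < a" "a < 1" and \<delta>: "\<delta> > 0" and T: "T1 < T2"
  shows "(\<integral>x. \<phi> T1 x * convex_cutoff (reflected_kernel a (T2 - T1 + \<delta>) x) \<partial>U01)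
    \<le> (\<integral>x. \<phi> T2 x * convex_cutoff (reflected_kernel a \<delta> x) \<partial>U01)"
proof -
  \<comment> \<open>The kernel would become singular at time c, which is \<delta> after the end of
    the interval.\<close>
  define c where "c = T2 + \<delta>"
  define E where "E t x = reflected_kernel a (c - t) x" for t x
  define Es where "Es t x = reflected_kernel_s a (c - t) x" for t x
  define Ex where "Ex t x = reflected_kernel_x a (c - t) x" for t x
  have s: "c - t \<ge> \<delta>" "c - t > 0" if "t \<in> {T1..T2}" for t using that \<delta> by (auto simp: c_def)
  have E't: "((\<lambda>t. E t x) has_real_derivative - Es t x) (at t)" if "t \<in> {T1..T2}" for t x
  proof -
    have "((\<lambda>t. c - t) has_real_derivative - 1) (at t)" by (auto intro!: derivative_eq_intros)
    from DERIV_chain2[of "\<lambda>s. reflected_kernel a s x", OF DERIV_reflected_kernel_s[OF s(2)[OF that]] this]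
    show ?thesis unfolding E_def Es_def by simp
  qed
  have E'x: "(E t has_real_derivative Ex t x) (at x within {0..1})" if "t \<in> {T1..T2}" for t x
    unfolding E_def Ex_def
    by (rule has_field_derivative_at_within[OF DERIV_reflected_kernel_x[OF s(2)[OF that]]])
  have E'xx: "(Ex t has_real_derivative Es t x) (at x within {0..1})" if "t \<in> {T1..T2}" for t x
    unfolding Es_def Ex_def
    by (rule has_field_derivative_at_within[OF DERIV_reflected_kernel_xx[OF s(2)[OF that]]])
  have Ec: "continuous_on {0..1} (E t)" and Exc: "continuous_on {0..1} (Ex t)" if "t \<in> {T1..T2}" for t
    using E'x[OF that] E'xx[OF that] has_real_derivative_imp_continuous_on by blast+
  have Esc: "continuous_on {0..1} (Es t)" if "t \<in> {T1..T2}" for t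
    unfolding Es_def reflected_kernel_s_def
    by (intro continuous_on_heat_kernel_s continuous_intros s(2)[OF that])
  have c'c: "continuous_on {0..1} (\<lambda>x. convex_cutoff' (E t x))" if "t \<in> {T1..T2}" for t
    by (rule continuous_on_compose2[of UNIV convex_cutoff', OF _ Ec[OF that]])
      (auto intro!: has_real_derivative_imp_continuous_on DERIV_convex_cutoff')
  \<comment> \<open>Bounds each of the three kernel terms in \<open>Es\<close>; since the cut-off
    has slope at most 1, three times \<open>B\<close> bounds the time derivative of the
    barrier.\<close>
  define B where "B = (1 / \<delta>^2 + 1 / (2 * \<delta>)) / sqrt \<delta>"
  have "(\<integral>x. \<phi> T1 x * convex_cutoff (E T1 x) \<partial>U01) \<le> (\<integral>x. \<phi> T2 x * convex_cutoff (E T2 x) \<partial>U01)"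
  proof (rule test_mono[OF T T,
        where zt = "\<lambda>t x. convex_cutoff' (E t x) * (- Es t x)" and zx = "\<lambda>t x. convex_cutoff' (E t x) * Ex t x"
          and zxx = "\<lambda>t x. convex_cutoff'' (E t x) * (Ex t x)^2 + convex_cutoff' (E t x) * Es t x"
          and L = "3 * B"])
    fix t x :: real assume tx: "t \<in> {T1..T2}" "x \<in> {0..1}"
    show "((\<lambda>t. convex_cutoff (E t x)) has_real_derivative convex_cutoff' (E t x) * (- Es t x)) (at t)"
      by (rule DERIV_chain2[OF DERIV_convex_cutoff E't[OF tx(1)]])
    show "((\<lambda>x. convex_cutoff (E t x)) has_real_derivative convex_cutoff' (E t x) * Ex t x) (at x within {0..1})"
      by (rule DERIV_chain2[OF DERIV_convex_cutoff E'x[OF tx(1)]])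
    have "((\<lambda>x. convex_cutoff' (E t x)) has_real_derivative convex_cutoff'' (E t x) * Ex t x) (at x within {0..1})"
      by (rule DERIV_chain2[OF DERIV_convex_cutoff' E'x[OF tx(1)]])
    then show "((\<lambda>x. convex_cutoff' (E t x) * Ex t x) has_real_derivative
        convex_cutoff'' (E t x) * (Ex t x)^2 + convex_cutoff' (E t x) * Es t x) (at x within {0..1})"
      by (rule DERIV_mult'[OF _ E'xx[OF tx(1)], THEN DERIV_cong]) (simp add: power2_eq_square)
    have "\<bar>heat_kernel_s (c - t) (x - a)\<bar> \<le> B" "\<bar>heat_kernel_s (c - t) (x + a)\<bar> \<le> B"
      "\<bar>heat_kernel_s (c - t) (2 - x - a)\<bar> \<le> B"
      unfolding B_def using tx a by (intro heat_kernel_s_bound \<delta> s(1)[OF tx(1)]; simp add: abs_le_iff)+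
    then have "\<bar>Es t x\<bar> \<le> 3 * B" unfolding Es_def reflected_kernel_s_def by linarith
    then have "\<bar>convex_cutoff' (E t x)\<bar> * \<bar>- Es t x\<bar> \<le> 1 * (3 * B)"
      using convex_cutoff'_bounds by (intro mult_mono) auto
    then show "\<bar>convex_cutoff' (E t x) * (- Es t x)\<bar> \<le> 3 * B" by (simp add: abs_mult)
    show "0 \<le> convex_cutoff' (E t x) * (- Es t x) + (convex_cutoff'' (E t x) * (Ex t x)^2 + convex_cutoff' (E t x) * Es t x)"
      using convex_cutoff''_nonneg by simp
    show "0 \<le> convex_cutoff (E t x)" by (rule convex_cutoff_nonneg)
  next
    fix t assume t: "t \<in> {T1..T2}"
    show "continuous_on {0..1} (\<lambda>x. convex_cutoff' (E t x) * (- Es t x))"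
      by (intro continuous_intros c'c Esc t)
    show "continuous_on {0..1} (\<lambda>x. convex_cutoff'' (E t x) * (Ex t x)^2 + convex_cutoff' (E t x) * Es t x)"
      by (intro continuous_intros continuous_on_convex_cutoff'' c'c Esc Exc Ec t)
    show "convex_cutoff (E t 0) = 0" "convex_cutoff (E t 1) = 0"
      unfolding E_def using reflected_kernel_boundary[OF s(2)[OF t], of a] by (auto intro: convex_cutoff_eq_0)
  qed
  then show ?thesis by (simp add: E_def c_def add.commute add_diff_eq)
qed

text \<open>The barrier transports a fixed amount of mass to every neighbourhood of a given point,
  which excludes a zero there.\<close>

lemma positive:
  assumes ne: "Hnorm (\<phi> t) \<noteq> 0" and ae: "AE x in U01. \<phi> t x = g x" and g: "second_deriv_L2 g h"
    and gnn: "\<And>x. x \<in> {0..1} \<Longrightarrow> g x \<ge> 0" and a: "0 < a" "a < 1"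
  shows "g a > 0"
proof (rule ccontr)
  assume "\<not> g a > 0"
  with gnn[of a] a have ga: "g a = 0" by auto
  obtain g1 where "inH h" and g1: "\<And>x. x \<in> {0..1} \<Longrightarrow> (g has_real_derivative g1 x) (at x within {0..1})"
    and "\<And>x. x \<in> {0..1} \<Longrightarrow> g1 x = g1 0 + (\<integral>y. indicator {..<x} y * h y \<partial>U01)"
    and g1c: "continuous_on {0..1} g1" and gc: "continuous_on {0..1} g"
    using second_deriv_L2_E[OF g] by blast
  obtain C where C: "C > 0" "\<And>x. x \<in> {0..1} \<Longrightarrow> \<bar>g1 x\<bar> \<le> C"
    using continuous_on_bounded_abs[OF g1c] by blast
  \<comment> \<open>The Lipschitz bound starts from the assumed zero at a; it later provides the
    majorant for the concentrating kernels.\<close>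
  have lip: "g x \<le> C * \<bar>x - a\<bar>" if "x \<in> {0..1}" for x
  proof -
    have "norm (g x - g a) \<le> C * norm (x - a)"
      by (rule field_differentiable_bound[of "{0..1}" g g1]) (use that a g1 C(2) in auto)
    then show ?thesis using ga by simp
  qed
  have gH: "inH g" by (rule continuous_on_inH[OF gc])
  obtain y0 where y0: "y0 \<in> {0<..<1}" "g y0 > 0"
  proof -
    have "\<exists>y0\<in>{0<..<1}. g y0 \<noteq> 0"
    proof (rule ccontr)
      assume no: "\<not> (\<exists>y0\<in>{0<..<1}. g y0 \<noteq> 0)"
      have "AE x in U01. \<phi> t x = 0" using ae AE_space by eventually_elim (use no in auto)
      then show False using ne Hnorm_eq_0_iff[OF inH_phi] by blast
    qed
    then obtain y0 where "y0 \<in> {0<..<1}" "g y0 \<noteq> 0" by blast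
    then show ?thesis using gnn[of y0] by (intro that[of y0]) auto
  qed
  have "continuous_on {0<..<1} g" by (rule continuous_on_subset[OF gc]) auto
  then have "open ({0<..<1} \<inter> g -` {0<..})" by (rule continuous_open_preimage) auto
  moreover have "y0 \<in> {0<..<1} \<inter> g -` {0<..}" using y0 by auto
  ultimately obtain d where d: "d > 0" "cball y0 d \<subseteq> {0<..<1} \<inter> g -` {0<..}"
    unfolding open_contains_cball by blast
  define p where "p = y0 - d"
  define q where "q = y0 + d"
  have pq: "p < q" using d by (simp add: p_def q_def)
  have pqg: "0 < x \<and> x < 1 \<and> 0 < g x" if "x \<in> {p..q}" for x
    using that d(2) by (auto simp: p_def q_def dist_real_def subset_iff abs_le_iff)
  have p0: "0 < p" and q1: "q < 1" using pqg[of p] pqg[of q] pq by auto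
  \<comment> \<open>Mass on an interval where g t is bounded away from neither end point but
    positive throughout: this mass feeds the barrier.\<close>
  define J where "J s = (\<integral>x. \<phi> s x * indicator {p..q} x \<partial>U01)" for s
  have indH: "inH (indicator {p..q})"
    using inH_indicator_mult[OF inH_const[of 1], of "{p..q}"] by simp
  have J0: "J t > 0"
  proof -
    have nn: "AE x in U01. 0 \<le> \<phi> t x * indicator {p..q} x" using nonneg[of t] by eventually_elim simp
    have "J t \<noteq> 0"
    proof
      assume "J t = 0"
      then have "AE x in U01. \<phi> t x * indicator {p..q} x = 0"
        unfolding J_def using integral_nonneg_eq_0_iff_AE[OF integrable_mult_inH[OF inH_phi indH] nn] by blast
      then have *: "AE x in U01. g x * indicator {p..q} x = 0" using ae by eventually_elim simp
      obtain x where "p < x" "x < q" "g x * indicator {p..q} x = 0"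
        by (rule AE_U01_dense[OF *, of p q]) (use p0 q1 pq in auto)
      then show False using pqg[of x] by auto
    qed
    moreover have "J t \<ge> 0" unfolding J_def using nn by (rule integral_nonneg_AE)
    ultimately show ?thesis by simp
  qed
  have "\<forall>\<^sub>F s in at t. Hnorm (\<lambda>x. \<phi> s x - \<phi> t x) < J t / 2"
    by (rule order_tendstoD(2)[OF continuous_phi]) (use J0 in simp)
  then obtain \<rho> where \<rho>: "\<rho> > 0" "\<And>s. s \<noteq> t \<Longrightarrow> dist s t < \<rho> \<Longrightarrow> Hnorm (\<lambda>x. \<phi> s x - \<phi> t x) < J t / 2"
    unfolding eventually_at by auto
  define m where "m = min (p * a) ((1 - q) * (1 - a))"
  have m0: "m > 0" using p0 q1 a by (simp add: m_def)
  \<comment> \<open>The bound \<open>m / 6\<close> is the smallness asked for in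
    \<open>reflected_kernel_lower\<close>; \<open>\<rho> / 2\<close> keeps t - \<sigma> in the time
    span on which at least half of the mass \<open>J t\<close> is present.\<close>
  define \<sigma> where "\<sigma> = min (m / 6) (\<rho> / 2)"
  have \<sigma>: "\<sigma> > 0" "6 * \<sigma> \<le> m" "\<sigma> < \<rho>" using m0 \<rho>(1) by (auto simp: \<sigma>_def min_def)
  define t0 where "t0 = t - \<sigma>"
  have J2: "J t0 \<ge> J t / 2"
  proof -
    have "J t0 - J t = (\<integral>x. (\<phi> t0 x - \<phi> t x) * indicator {p..q} x \<partial>U01)"
      unfolding J_def using integrable_mult_inH[OF inH_phi indH]
      by (simp add: left_diff_distrib)
    also have "\<bar>\<dots>\<bar> \<le> 1 * Hnorm (\<lambda>x. \<phi> t0 x - \<phi> t x)"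
      using inH_measurable[OF indH]
      by (intro integral_bounded_mult_le inH_diff inH_phi) (auto split: split_indicator)
    also have "\<dots> < J t / 2" using \<rho>(2)[of t0] \<sigma> by (simp add: t0_def dist_real_def)
    finally show ?thesis by linarith
  qed
  \<comment> \<open>The least height of the barrier over the interval from p to q, taken from
    \<open>reflected_kernel_lower\<close>.\<close>
  define k where "k = convex_cutoff (exp (- (1 / (4 * \<sigma>))) / (2 * sqrt (2 * \<sigma>)))"
  have k0: "k > 0" unfolding k_def using \<sigma> by (intro convex_cutoff_pos) simp
  have cutH: "inH (\<lambda>x. convex_cutoff (reflected_kernel a s x))" if "s > 0" for s
  proof (intro continuous_on_inH has_real_derivative_imp_continuous_on)
    show "((\<lambda>x. convex_cutoff (reflected_kernel a s x)) has_real_derivative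
      convex_cutoff' (reflected_kernel a s x) * reflected_kernel_x a s x) (at x within {0..1})" for x
      by (rule DERIV_chain2[OF DERIV_convex_cutoff has_field_derivative_at_within[OF DERIV_reflected_kernel_x[OF that]]])
  qed
  \<comment> \<open>As \<delta> n \<le> \<sigma>, the kernel time t - t0 + \<delta> n stays between
    \<sigma> and 2 \<sigma>, so the bound k does not depend on n.\<close>
  define \<delta> where "\<delta> n = \<sigma> / real (Suc n)" for n
  have \<delta>: "\<delta> n > 0" "\<delta> n \<le> \<sigma>" for n using \<sigma> by (auto simp: \<delta>_def divide_le_eq mult_le_cancel_left1)
  have kerH: "inH (\<lambda>x. heat_kernel s (x - a))" if "s > 0" for s
    unfolding heat_kernel_def using that by (intro continuous_on_inH continuous_intros) auto
  have lower: "k * (J t / 2) \<le> (\<integral>x. g x * heat_kernel (\<delta> n) (x - a) \<partial>U01)" for n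
  \<comment> \<open>The mass at time t0, weighted by the barrier, is carried to time t, where the
    barrier lies below the heat kernel centred at a.\<close>
  proof -
    have "k * (J t / 2) \<le> k * J t0" using J2 k0 by simp
    also have "\<dots> = (\<integral>x. k * (\<phi> t0 x * indicator {p..q} x) \<partial>U01)" by (simp add: J_def)
    also have "\<dots> \<le> (\<integral>x. \<phi> t0 x * convex_cutoff (reflected_kernel a (t - t0 + \<delta> n) x) \<partial>U01)"
    proof (rule integral_mono_AE)
      show "integrable U01 (\<lambda>x. k * (\<phi> t0 x * indicator {p..q} x))"
        using integrable_mult_inH[OF inH_phi indH] by simp
      show "integrable U01 (\<lambda>x. \<phi> t0 x * convex_cutoff (reflected_kernel a (t - t0 + \<delta> n) x))"
        using \<sigma> \<delta>[of n] by (intro integrable_mult_inH inH_phi cutH) (simp add: t0_def)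
      show "AE x in U01. k * (\<phi> t0 x * indicator {p..q} x) \<le> \<phi> t0 x * convex_cutoff (reflected_kernel a (t - t0 + \<delta> n) x)"
        using nonneg[of t0]
      proof eventually_elim
        case (elim x)
        show ?case
        proof (cases "x \<in> {p..q}")
          case True
          have "k \<le> convex_cutoff (reflected_kernel a (t - t0 + \<delta> n) x)"
            unfolding k_def
          proof (intro convex_cutoff_mono reflected_kernel_lower)
            show "x \<in> {p..q}" by (rule True)
            show "m \<le> p * a" "m \<le> (1 - q) * (1 - a)" by (auto simp: m_def)
          qed (use \<sigma> \<delta>[of n] p0 q1 a in \<open>auto simp: t0_def\<close>)
          then have "\<phi> t0 x * k \<le> \<phi> t0 x * convex_cutoff (reflected_kernel a (t - t0 + \<delta> n) x)"
            using elim by (rule mult_left_mono)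
          then show ?thesis using True by (simp add: mult.commute)
        next
          case False
          then show ?thesis using elim convex_cutoff_nonneg by simp
        qed
      qed
    qed
    also have "\<dots> \<le> (\<integral>x. \<phi> t x * convex_cutoff (reflected_kernel a (\<delta> n) x) \<partial>U01)"
      using \<sigma> by (intro barrier_mono a \<delta>) (simp add: t0_def)
    also have "\<dots> \<le> (\<integral>x. g x * heat_kernel (\<delta> n) (x - a) \<partial>U01)"
    proof (rule integral_mono_AE)
      show "integrable U01 (\<lambda>x. \<phi> t x * convex_cutoff (reflected_kernel a (\<delta> n) x))"
        by (intro integrable_mult_inH inH_phi cutH \<delta>)
      show "integrable U01 (\<lambda>x. g x * heat_kernel (\<delta> n) (x - a))"
        by (intro integrable_mult_inH gH kerH \<delta>)
      show "AE x in U01. \<phi> t x * convex_cutoff (reflected_kernel a (\<delta> n) x) \<le> g x * heat_kernel (\<delta> n) (x - a)"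
        using ae AE_space
      proof eventually_elim
        case (elim x)
        have "max (reflected_kernel a (\<delta> n) x) 0 \<le> heat_kernel (\<delta> n) (x - a)"
          using reflected_kernel_le[OF \<delta>(1), of a n x] heat_kernel_pos[OF \<delta>(1), of n "x - a"] by simp
        then have "convex_cutoff (reflected_kernel a (\<delta> n) x) \<le> heat_kernel (\<delta> n) (x - a)"
          using convex_cutoff_le order_trans by blast
        then show ?case using elim gnn[of x] by (auto intro: mult_left_mono)
      qed
    qed
    finally show ?thesis .
  qed
  \<comment> \<open>Off a the kernel tends to 0, and \<open>lip\<close> with
    \<open>heat_kernel_mult_abs_le\<close> gives the majorant C; the limit 0 contradicts the
    positive lower bound.\<close>
  have "(\<lambda>n. \<integral>x. g x * heat_kernel (\<delta> n) (x - a) \<partial>U01) \<longlonglongrightarrow> (\<integral>x. 0 \<partial>U01)"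
  proof (rule integral_dominated_convergence)
    show "integrable U01 (\<lambda>x. C)" by (intro inH_integrable inH_const)
    show "(\<lambda>x. g x * heat_kernel (\<delta> n) (x - a)) \<in> borel_measurable U01" for n
      using integrable_mult_inH[OF gH kerH[OF \<delta>(1)]] by (rule borel_measurable_integrable)
    show "AE x in U01. (\<lambda>n. g x * heat_kernel (\<delta> n) (x - a)) \<longlonglongrightarrow> 0"
      using AE_U01_neq[of a]
    proof eventually_elim
      case (elim x)
      then have "(\<lambda>n. heat_kernel (\<delta> n) (x - a)) \<longlonglongrightarrow> 0"
        unfolding \<delta>_def using \<sigma>(1) by (intro heat_kernel_tendsto_0) auto
      then show ?case by (rule tendsto_mult_right_zero)
    qed
    show "AE x in U01. norm (g x * heat_kernel (\<delta> n) (x - a)) \<le> C" for n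
    proof (rule AE_I2)
      fix x assume "x \<in> space U01"
      then have x: "x \<in> {0..1}" by simp
      have "g x * heat_kernel (\<delta> n) (x - a) \<le> (C * \<bar>x - a\<bar>) * heat_kernel (\<delta> n) (x - a)"
        using lip[OF x] heat_kernel_pos[OF \<delta>(1), of n "x - a"] by (intro mult_right_mono) auto
      also have "\<dots> \<le> C"
        using mult_left_mono[OF heat_kernel_mult_abs_le[OF \<delta>(1), of "x - a" n], of C] C(1)
        by (simp add: mult.assoc)
      finally show "norm (g x * heat_kernel (\<delta> n) (x - a)) \<le> C"
        using gnn[OF x] heat_kernel_pos[OF \<delta>(1), of n "x - a"] by (simp add: abs_mult)
    qed
  qed simp
  then have "(\<lambda>n. \<integral>x. g x * heat_kernel (\<delta> n) (x - a) \<partial>U01) \<longlonglongrightarrow> 0" by simp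
  then have "k * (J t / 2) \<le> 0" by (rule LIMSEQ_le_const) (use lower in blast)
  then show False using k0 J0 by (simp add: mult_le_0_iff)
qed

end

section \<open>Energy decay for the linear problem\<close>

text \<open>Testing the equation with d itself, the Poincare inequality bounds the derivative of the
  squared norm by -2 c times the squared norm; the exponential weight absorbs this rate.\<close>

lemma energy_decay:
  assumes T: "T1 \<le> T2" and H: "\<And>t. t \<in> {T1..T2} \<Longrightarrow> inH (d t)"
    and cont: "\<And>t. t \<in> {T1..T2} \<Longrightarrow> ((\<lambda>s. Hnorm (\<lambda>x. d s x - d t x)) \<longlongrightarrow> 0) (at t within {T1..T2})"
    and ac: "H_abs_cont d T1 T2"
    and eq: "AE t in lborel. T1 < t \<and> t < T2 \<longrightarrow>
      (\<exists>v w. H_deriv d t v \<and> opA (d t) w \<and> (AE x in U01. v x + w x = \<omega> * d t x))"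
    and \<mu>: "0 \<le> \<mu>" "\<mu> < pi" and c: "c = \<mu>^2 - \<omega>" "c \<ge> 0"
  shows "exp (2 * c * T2) * (Hnorm (d T2))^2 \<le> exp (2 * c * T1) * (Hnorm (d T1))^2"
proof -
  have "continuous_on {T1..T2} (\<lambda>t. Hnorm (d t))"
    unfolding continuous_on_def
  proof
    fix t assume t: "t \<in> {T1..T2}"
    have "((\<lambda>s. Hnorm (d s) - Hnorm (d t)) \<longlongrightarrow> 0) (at t within {T1..T2})"
      by (rule Lim_null_comparison[OF _ cont[OF t]])
        (use Hnorm_diff_le[OF H H[OF t]] in \<open>auto simp: eventually_at_filter\<close>)
    then show "((\<lambda>t. Hnorm (d t)) \<longlongrightarrow> Hnorm (d t)) (at t within {T1..T2})" by (rule LIM_zero_cancel)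
  qed
  then have "bounded ((\<lambda>t. Hnorm (d t)) ` {T1..T2})"
    by (intro compact_imp_bounded compact_continuous_image) auto
  then obtain M where M: "M > 0" "\<And>t. t \<in> {T1..T2} \<Longrightarrow> Hnorm (d t) \<le> M"
    unfolding bounded_pos by force
  define e where "e = exp (2 * c * T2)"
  have ele: "exp (2 * c * t) \<le> e" if "t \<in> {T1..T2}" for t
    using that c(2) by (auto simp: e_def intro!: mult_left_mono)
  \<comment> \<open>The sign turns decay into the growth that
    \<open>nonneg_AE_deriv_imp_mono\<close> delivers.\<close>
  define F where "F t = - (exp (2 * c * t) * (Hnorm (d t))^2)" for t
  have "F T1 \<le> F T2"
  proof (rule nonneg_AE_deriv_imp_mono[OF T ac])
    show "0 \<le> e * (2 * M)" "0 \<le> (2 * c * e) * M^2" using M c(2) by (auto simp: e_def)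
    fix s t assume st: "s \<in> {T1..T2}" "t \<in> {T1..T2}"
    have "\<bar>(Hnorm (d s))^2 - (Hnorm (d t))^2\<bar> = \<bar>Hnorm (d s) - Hnorm (d t)\<bar> * (Hnorm (d s) + Hnorm (d t))"
      using Hnorm_nonneg[of "d s"] Hnorm_nonneg[of "d t"]
      by (simp add: power2_eq_square square_diff_square_factored abs_mult)
    also have "\<dots> \<le> Hnorm (\<lambda>x. d s x - d t x) * (2 * M)"
      using Hnorm_diff_le[OF H[OF st(1)] H[OF st(2)]] M(2)[OF st(1)] M(2)[OF st(2)]
        Hnorm_nonneg[of "d s"] Hnorm_nonneg[of "d t"]
      by (intro mult_mono) (auto simp: Hnorm_nonneg)
    finally have 1: "\<bar>(Hnorm (d s))^2 - (Hnorm (d t))^2\<bar> \<le> Hnorm (\<lambda>x. d s x - d t x) * (2 * M)" .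
    have "norm (exp (2 * c * s) - exp (2 * c * t)) \<le> (2 * c * e) * norm (s - t)"
    proof (rule field_differentiable_bound[of "{T1..T2}" "\<lambda>t. exp (2 * c * t)" "\<lambda>t. 2 * c * exp (2 * c * t)"])
      fix t assume t: "t \<in> {T1..T2}"
      show "((\<lambda>t. exp (2 * c * t)) has_field_derivative 2 * c * exp (2 * c * t)) (at t within {T1..T2})"
        by (auto intro!: derivative_eq_intros)
      show "norm (2 * c * exp (2 * c * t)) \<le> 2 * c * e"
        using ele[OF t] c(2) by (simp add: abs_mult mult_left_mono)
    qed (use st in auto)
    then have 2: "\<bar>exp (2 * c * s) - exp (2 * c * t)\<bar> \<le> (2 * c * e) * \<bar>s - t\<bar>" by simp
    have "F t - F s = exp (2 * c * s) * ((Hnorm (d s))^2 - (Hnorm (d t))^2)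
        + (exp (2 * c * s) - exp (2 * c * t)) * (Hnorm (d t))^2"
      by (simp add: F_def algebra_simps)
    then have "\<bar>F s - F t\<bar> \<le> \<bar>exp (2 * c * s) * ((Hnorm (d s))^2 - (Hnorm (d t))^2)\<bar>
        + \<bar>(exp (2 * c * s) - exp (2 * c * t)) * (Hnorm (d t))^2\<bar>" by linarith
    also have "\<dots> \<le> e * (Hnorm (\<lambda>x. d s x - d t x) * (2 * M)) + (2 * c * e) * \<bar>s - t\<bar> * M^2"
      unfolding abs_mult
    proof (intro add_mono mult_mono)
      show "\<bar>exp (2 * c * s)\<bar> \<le> e" using ele[OF st(1)] by simp
      show "\<bar>(Hnorm (d t))^2\<bar> \<le> M^2"
        using M(2)[OF st(2)] Hnorm_nonneg[of "d t"] by (simp add: power_mono)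
    qed (use 1 2 c(2) in \<open>auto simp: e_def\<close>)
    finally show "\<bar>F s - F t\<bar> \<le> e * (2 * M) * Hnorm (\<lambda>x. d s x - d t x) + (2 * c * e) * M^2 * \<bar>s - t\<bar>"
      by (simp add: mult.assoc mult.commute mult.left_commute)
  next
    show "AE t in lborel. T1 < t \<and> t < T2 \<longrightarrow> (\<exists>D\<ge>0. (F has_real_derivative D) (at t))"
      using eq
    proof eventually_elim
      case (elim t)
      show ?case
      proof
        assume t: "T1 < t \<and> t < T2"
        then have tI: "t \<in> {T1..T2}" by auto
        note dH = H[OF tI]
        obtain v w where vw: "H_deriv d t v" "opA (d t) w" "AE x in U01. v x + w x = \<omega> * d t x"
          using elim t by blast
        have vH: "inH v" using vw(1) by (simp add: H_deriv_def)
        obtain g where g: "inH w" "AE x in U01. d t x = g x" "g 0 = 0" "g 1 = 0" "second_deriv_L2 g (\<lambda>x. - w x)"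
          using opA_E[OF vw(2)] by metis
        have "continuous_on {0..1} g" using second_deriv_L2_E[OF g(5)] by blast
        then have gH: "inH g" by (rule continuous_on_inH)
        define N where "N = (Hnorm (d t))^2"
        define I where "I = (\<integral>x. v x * d t x \<partial>U01)"
        have "I \<le> - c * N"
        proof -
          have "I = (\<integral>x. \<omega> * (g x)^2 + - w x * g x \<partial>U01)"
            unfolding I_def
          proof (rule integral_cong_AE)
            show "AE x in U01. v x * d t x = \<omega> * (g x)^2 + - w x * g x"
              using vw(3) g(2)
            proof eventually_elim
              case (elim x)
              then have "v x = \<omega> * g x - w x" by simp
              then have "v x * d t x = (\<omega> * g x - w x) * g x" using elim(2) by simp
              then show ?case by (simp add: power2_eq_square algebra_simps)
            qed
          qed (use vH dH gH g(1) in measurable)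
          also have "\<dots> = \<omega> * (\<integral>x. (g x)^2 \<partial>U01) + (\<integral>x. - w x * g x \<partial>U01)"
            using gH integrable_mult_inH[OF inH_minus[OF g(1)] gH] by (simp add: inH_iff)
          also have "\<dots> \<le> \<omega> * (\<integral>x. (g x)^2 \<partial>U01) + - (\<mu>^2) * (\<integral>x. (g x)^2 \<partial>U01)"
            using Poincare_U01[OF g(5,3,4) \<mu>] by simp
          also have "(\<integral>x. (g x)^2 \<partial>U01) = N"
            using Hnorm_cong_AE[OF inH_measurable[OF dH] inH_measurable[OF gH] g(2)]
            by (simp add: N_def Hnorm_power2)
          finally show ?thesis by (simp add: c(1) algebra_simps)
        qed
        have N': "((\<lambda>s. (Hnorm (d s))^2) has_real_derivative 2 * I) (at t within {T1..T2})"
        proof -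
          define q where "q s x = (d s x - d t x) / (s - t)" for s x
          have qH: "inH (q s)" if "s \<in> {T1..T2}" for s
            unfolding q_def by (intro inH_diff inH_divide H that dH)
          have lim: "((\<lambda>s. Hnorm (\<lambda>x. q s x - v x)) \<longlongrightarrow> 0) (at t within {T1..T2})"
            using vw(1) unfolding H_deriv_def q_def by (auto intro: tendsto_within_subset)
          \<comment> \<open>Expansion of the square of \<open>d s = d t + (s - t) * q s\<close>. The
            remainder (s - t) |q s|^2 vanishes in the limit because the quotients converge in norm
            and so stay bounded.\<close>
          have quot: "((Hnorm (d s))^2 - (Hnorm (d t))^2) / (s - t)
              = 2 * (\<integral>x. (q s x - v x) * d t x \<partial>U01) + 2 * I + (s - t) * (Hnorm (q s))^2"
            if s: "s \<in> {T1..T2}" "s \<noteq> t" for s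
          proof -
            have i: "integrable U01 (\<lambda>x. (q s x - v x) * d t x)" "integrable U01 (\<lambda>x. v x * d t x)"
              "integrable U01 (\<lambda>x. (q s x)^2)"
              using qH[OF s(1)] vH dH by (auto intro!: integrable_mult_inH inH_diff simp: inH_iff)
            have "2 * (\<integral>x. (q s x - v x) * d t x \<partial>U01) + 2 * I + (s - t) * (Hnorm (q s))^2
              = (\<integral>x. 2 * ((q s x - v x) * d t x) + 2 * (v x * d t x) + (s - t) * (q s x)^2 \<partial>U01)"
              using i by (simp add: I_def Hnorm_power2)
            also have "\<dots> = (\<integral>x. ((d s x)^2 - (d t x)^2) / (s - t) \<partial>U01)"
            proof (rule Bochner_Integration.integral_cong[OF refl])
              fix x
              have ds: "d s x = d t x + (s - t) * q s x" using s(2) by (simp add: q_def)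
              have "(d s x)^2 - (d t x)^2 = (s - t) * (2 * (q s x * d t x) + (s - t) * (q s x)^2)"
                unfolding ds by (simp add: power2_eq_square algebra_simps)
              then have "((d s x)^2 - (d t x)^2) / (s - t) = 2 * (q s x * d t x) + (s - t) * (q s x)^2"
                using s(2) by simp
              then show "2 * ((q s x - v x) * d t x) + 2 * (v x * d t x) + (s - t) * (q s x)^2
                = ((d s x)^2 - (d t x)^2) / (s - t)" by (simp add: algebra_simps)
            qed
            also have "\<dots> = ((Hnorm (d s))^2 - (Hnorm (d t))^2) / (s - t)"
              using H[OF s(1)] dH by (simp add: inH_iff Hnorm_power2)
            finally show ?thesis ..
          qed
          have "((\<lambda>s. 2 * (\<integral>x. (q s x - v x) * d t x \<partial>U01) + 2 * I + (s - t) * (Hnorm (q s))^2) \<longlongrightarrow>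
              2 * 0 + 2 * I + 0) (at t within {T1..T2})"
          proof (intro tendsto_add tendsto_const tendsto_mult)
            have "((\<lambda>s. Hnorm (\<lambda>x. q s x - v x) * Hnorm (d t)) \<longlongrightarrow> 0) (at t within {T1..T2})"
              using lim by (rule tendsto_mult_left_zero)
            then show "((\<lambda>s. \<integral>x. (q s x - v x) * d t x \<partial>U01) \<longlongrightarrow> 0) (at t within {T1..T2})"
            proof (rule Lim_null_comparison[rotated])
              show "\<forall>\<^sub>F s in at t within {T1..T2}. norm (\<integral>x. (q s x - v x) * d t x \<partial>U01) \<le> Hnorm (\<lambda>x. q s x - v x) * Hnorm (d t)"
                unfolding eventually_at_filter real_norm_def
                by (intro always_eventually allI impI Cauchy_Schwarz_U01 inH_diff qH vH dH)
            qed
            have "((\<lambda>s. \<bar>s - t\<bar> * (Hnorm v + Hnorm (\<lambda>x. q s x - v x))^2) \<longlongrightarrow> \<bar>t - t\<bar> * (Hnorm v + 0)^2) (at t within {T1..T2})"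
              by (intro tendsto_intros lim)
            then have "((\<lambda>s. \<bar>s - t\<bar> * (Hnorm v + Hnorm (\<lambda>x. q s x - v x))^2) \<longlongrightarrow> 0) (at t within {T1..T2})" by simp
            then show "((\<lambda>s. (s - t) * (Hnorm (q s))^2) \<longlongrightarrow> 0) (at t within {T1..T2})"
            proof (rule Lim_null_comparison[rotated])
              have "norm ((s - t) * (Hnorm (q s))^2) \<le> \<bar>s - t\<bar> * (Hnorm v + Hnorm (\<lambda>x. q s x - v x))^2"
                if "s \<in> {T1..T2}" for s
              proof -
                have "Hnorm (q s) \<le> Hnorm v + Hnorm (\<lambda>x. q s x - v x)"
                  using Hnorm_triangle[OF vH inH_diff[OF qH[OF that] vH]] by simp
                then have "(Hnorm (q s))^2 \<le> (Hnorm v + Hnorm (\<lambda>x. q s x - v x))^2"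
                  using Hnorm_nonneg by (intro power_mono) auto
                then show ?thesis by (simp add: abs_mult mult_left_mono)
              qed
              then show "\<forall>\<^sub>F s in at t within {T1..T2}. norm ((s - t) * (Hnorm (q s))^2)
                  \<le> \<bar>s - t\<bar> * (Hnorm v + Hnorm (\<lambda>x. q s x - v x))^2"
                by (simp add: eventually_at_filter)
            qed
          qed
          then have "((\<lambda>s. 2 * (\<integral>x. (q s x - v x) * d t x \<partial>U01) + 2 * I + (s - t) * (Hnorm (q s))^2) \<longlongrightarrow> 2 * I) (at t within {T1..T2})"
            by simp
          then have "((\<lambda>s. ((Hnorm (d s))^2 - (Hnorm (d t))^2) / (s - t)) \<longlongrightarrow> 2 * I) (at t within {T1..T2})"
            using quot[symmetric] by (auto elim!: Lim_transform_within[where d = 1])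
          then show ?thesis by (simp add: has_field_derivative_iff)
        qed
        have "((\<lambda>s. exp (2 * c * s)) has_real_derivative 2 * c * exp (2 * c * t)) (at t within {T1..T2})"
          by (auto intro!: derivative_eq_intros)
        from DERIV_minus[OF DERIV_mult'[OF this N']]
        have "(F has_real_derivative - (exp (2 * c * t) * (2 * I) + 2 * c * exp (2 * c * t) * N)) (at t within {T1..T2})"
          by (simp add: F_def[abs_def] N_def)
        then have "(F has_real_derivative - (exp (2 * c * t) * (2 * I) + 2 * c * exp (2 * c * t) * N)) (at t)"
          unfolding at_within_Icc_at[OF conjunct1[OF t] conjunct2[OF t]] .
        moreover have "0 \<le> - (exp (2 * c * t) * (2 * I) + 2 * c * exp (2 * c * t) * N)"
        proof -
          have "c * N \<le> - I" using \<open>I \<le> - c * N\<close> by simp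
          then have "0 \<le> - (2 * I + 2 * (c * N))" by linarith
          then have "0 \<le> exp (2 * c * t) * (- (2 * I + 2 * (c * N)))"
            by (rule mult_nonneg_nonneg[OF exp_ge_zero])
          also have "\<dots> = - (exp (2 * c * t) * (2 * I) + 2 * c * exp (2 * c * t) * N)" by algebra
          finally show ?thesis .
        qed
        ultimately show "\<exists>D\<ge>0. (F has_real_derivative D) (at t)" by blast
      qed
    qed
  qed
  then show ?thesis by (simp add: F_def)
qed

section \<open>Differences of solutions of the linear problem\<close>

lemma H_abs_cont_diff:
  assumes "H_abs_cont u T1 T2" "H_abs_cont u' T1 T2"
    and H: "\<And>t. t \<in> {T1..T2} \<Longrightarrow> inH (u t)" "\<And>t. t \<in> {T1..T2} \<Longrightarrow> inH (u' t)"
  shows "H_abs_cont (\<lambda>t x. u t x - u' t x) T1 T2"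
  unfolding H_abs_cont_def
proof (intro allI impI)
  fix \<epsilon> :: real assume "\<epsilon> > 0"
  then have e: "\<epsilon> / 2 > 0" by simp
  from assms(1) e obtain \<delta>1 where d1: "\<delta>1 > 0" "\<forall>n (a :: nat \<Rightarrow> real) c.
        (\<forall>i<n. T1 \<le> a i \<and> a i \<le> c i \<and> c i \<le> T2) \<and> disjoint_family_on (\<lambda>i. {a i<..<c i}) {..<n} \<and>
        (\<Sum>i<n. c i - a i) < \<delta>1 \<longrightarrow> (\<Sum>i<n. Hnorm (\<lambda>x. u (c i) x - u (a i) x)) < \<epsilon> / 2"
    unfolding H_abs_cont_def by blast
  from assms(2) e obtain \<delta>2 where d2: "\<delta>2 > 0" "\<forall>n (a :: nat \<Rightarrow> real) c.
        (\<forall>i<n. T1 \<le> a i \<and> a i \<le> c i \<and> c i \<le> T2) \<and> disjoint_family_on (\<lambda>i. {a i<..<c i}) {..<n} \<and>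
        (\<Sum>i<n. c i - a i) < \<delta>2 \<longrightarrow> (\<Sum>i<n. Hnorm (\<lambda>x. u' (c i) x - u' (a i) x)) < \<epsilon> / 2"
    unfolding H_abs_cont_def by blast
  show "\<exists>\<delta>>0. \<forall>n (a :: nat \<Rightarrow> real) c.
        (\<forall>i<n. T1 \<le> a i \<and> a i \<le> c i \<and> c i \<le> T2) \<and> disjoint_family_on (\<lambda>i. {a i<..<c i}) {..<n} \<and>
        (\<Sum>i<n. c i - a i) < \<delta> \<longrightarrow> (\<Sum>i<n. Hnorm (\<lambda>x. (u (c i) x - u' (c i) x) - (u (a i) x - u' (a i) x))) < \<epsilon>"
  proof (intro exI[of _ "min \<delta>1 \<delta>2"] conjI allI impI)
    fix n and a c :: "nat \<Rightarrow> real"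
    assume *: "(\<forall>i<n. T1 \<le> a i \<and> a i \<le> c i \<and> c i \<le> T2) \<and> disjoint_family_on (\<lambda>i. {a i<..<c i}) {..<n} \<and>
        (\<Sum>i<n. c i - a i) < min \<delta>1 \<delta>2"
    have "(\<Sum>i<n. Hnorm (\<lambda>x. (u (c i) x - u' (c i) x) - (u (a i) x - u' (a i) x)))
      \<le> (\<Sum>i<n. Hnorm (\<lambda>x. u (c i) x - u (a i) x) + Hnorm (\<lambda>x. u' (c i) x - u' (a i) x))"
    proof (rule sum_mono)
      fix i assume "i \<in> {..<n}"
      then have i: "a i \<in> {T1..T2}" "c i \<in> {T1..T2}" using * by force+
      have "(\<lambda>x. (u (c i) x - u' (c i) x) - (u (a i) x - u' (a i) x))
          = (\<lambda>x. (u (c i) x - u (a i) x) - (u' (c i) x - u' (a i) x))" by auto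
      then show "Hnorm (\<lambda>x. (u (c i) x - u' (c i) x) - (u (a i) x - u' (a i) x))
         \<le> Hnorm (\<lambda>x. u (c i) x - u (a i) x) + Hnorm (\<lambda>x. u' (c i) x - u' (a i) x)"
        using Hnorm_triangle_diff[OF inH_diff inH_diff, OF H(1)[OF i(2)] H(1)[OF i(1)] H(2)[OF i(2)] H(2)[OF i(1)]]
        by simp
    qed
    also have "\<dots> < \<epsilon> / 2 + \<epsilon> / 2"
      unfolding sum.distrib using * by (intro add_strict_mono d1(2)[rule_format] d2(2)[rule_format]) auto
    finally show "(\<Sum>i<n. Hnorm (\<lambda>x. (u (c i) x - u' (c i) x) - (u (a i) x - u' (a i) x))) < \<epsilon>" by simp
  qed (use d1 d2 in auto)
qed

lemma second_deriv_L2_diff: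
  assumes "second_deriv_L2 g h" "second_deriv_L2 g' h'"
  shows "second_deriv_L2 (\<lambda>x. g x - g' x) (\<lambda>x. h x - h' x)"
proof -
  obtain g1 where g1: "inH h"
    "\<And>x. x \<in> {0..1} \<Longrightarrow> (g has_real_derivative g1 x) (at x within {0..1})"
    "\<And>x. x \<in> {0..1} \<Longrightarrow> g1 x = g1 0 + (\<integral>y. indicator {..<x} y * h y \<partial>U01)"
    using assms(1) unfolding second_deriv_L2_iff by blast
  obtain g1' where g1': "inH h'"
    "\<And>x. x \<in> {0..1} \<Longrightarrow> (g' has_real_derivative g1' x) (at x within {0..1})"
    "\<And>x. x \<in> {0..1} \<Longrightarrow> g1' x = g1' 0 + (\<integral>y. indicator {..<x} y * h' y \<partial>U01)"
    using assms(2) unfolding second_deriv_L2_iff by blast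
  show ?thesis
    unfolding second_deriv_L2_iff
  proof (intro conjI exI[of _ "\<lambda>x. g1 x - g1' x"] ballI)
    show "inH (\<lambda>x. h x - h' x)" by (intro inH_diff g1(1) g1'(1))
    fix x :: real assume x: "x \<in> {0..1}"
    show "((\<lambda>x. g x - g' x) has_real_derivative g1 x - g1' x) (at x within {0..1})"
      by (intro DERIV_diff g1(2) g1'(2) x)
    have "(\<integral>y. indicator {..<x} y * (h y - h' y) \<partial>U01) = (\<integral>y. indicator {..<x} y * h y \<partial>U01) - (\<integral>y. indicator {..<x} y * h' y \<partial>U01)"
      using g1(1) g1'(1) by (simp add: right_diff_distrib inH_integrable inH_indicator_mult)
    then show "g1 x - g1' x = g1 0 - g1' 0 + (\<integral>y. indicator {..<x} y * (h y - h' y) \<partial>U01)"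
      using g1(3)[OF x] g1'(3)[OF x] by linarith
  qed
qed

lemma opA_diff:
  assumes "opA u w" "opA u' w'"
  shows "opA (\<lambda>x. u x - u' x) (\<lambda>x. w x - w' x)"
proof -
  obtain g where g: "inH u" "inH w" "AE x in U01. u x = g x" "g 0 = 0" "g 1 = 0" "second_deriv_L2 g (\<lambda>x. - w x)"
    using opA_E[OF assms(1)] by metis
  obtain g' where g': "inH u'" "inH w'" "AE x in U01. u' x = g' x" "g' 0 = 0" "g' 1 = 0" "second_deriv_L2 g' (\<lambda>x. - w' x)"
    using opA_E[OF assms(2)] by metis
  have "second_deriv_L2 (\<lambda>x. g x - g' x) (\<lambda>x. - (w x - w' x))"
    using second_deriv_L2_diff[OF g(6) g'(6)] by (simp add: algebra_simps)
  moreover have "AE x in U01. u x - u' x = g x - g' x"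
    using g(3) g'(3) by eventually_elim simp
  ultimately show ?thesis
    unfolding opA_def AE_U01[symmetric] using g g'
    by (intro conjI inH_diff exI[of _ "\<lambda>x. g x - g' x"]) auto
qed

lemma H_deriv_diff:
  assumes "H_deriv u t v" "H_deriv u' t v'"
    and H: "\<forall>\<^sub>F s in at t. inH (u s) \<and> inH (u' s)" "inH (u t)" "inH (u' t)"
  shows "H_deriv (\<lambda>t x. u t x - u' t x) t (\<lambda>x. v x - v' x)"
proof -
  have v: "inH v" "inH v'" using assms(1,2) by (auto simp: H_deriv_def)
  have "((\<lambda>s. Hnorm (\<lambda>x. (u s x - u t x) / (s - t) - v x) + Hnorm (\<lambda>x. (u' s x - u' t x) / (s - t) - v' x)) \<longlongrightarrow> 0 + 0) (at t)"
    using assms(1,2) unfolding H_deriv_def by (intro tendsto_add) auto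
  then have lim: "((\<lambda>s. Hnorm (\<lambda>x. (u s x - u t x) / (s - t) - v x) + Hnorm (\<lambda>x. (u' s x - u' t x) / (s - t) - v' x)) \<longlongrightarrow> 0) (at t)"
    by simp
  have "((\<lambda>s. Hnorm (\<lambda>x. ((u s x - u' s x) - (u t x - u' t x)) / (s - t) - (v x - v' x))) \<longlongrightarrow> 0) (at t)"
  proof (rule Lim_null_comparison[OF _ lim])
    show "\<forall>\<^sub>F s in at t. norm (Hnorm (\<lambda>x. ((u s x - u' s x) - (u t x - u' t x)) / (s - t) - (v x - v' x)))
       \<le> Hnorm (\<lambda>x. (u s x - u t x) / (s - t) - v x) + Hnorm (\<lambda>x. (u' s x - u' t x) / (s - t) - v' x)"
      using H(1)
    proof eventually_elim
      case (elim s)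
      have "(\<lambda>x. ((u s x - u' s x) - (u t x - u' t x)) / (s - t) - (v x - v' x))
        = (\<lambda>x. ((u s x - u t x) / (s - t) - v x) - ((u' s x - u' t x) / (s - t) - v' x))"
        by (auto simp: diff_divide_distrib)
      moreover have "inH (\<lambda>x. (u s x - u t x) / (s - t) - v x)" "inH (\<lambda>x. (u' s x - u' t x) / (s - t) - v' x)"
        using elim H v by (intro inH_diff inH_divide; simp)+
      ultimately show ?case using Hnorm_triangle_diff Hnorm_nonneg by simp
    qed
  qed
  then show ?thesis using v by (auto simp: H_deriv_def)
qed

definition linear_at :: "real \<Rightarrow> real \<Rightarrow> (real \<Rightarrow> real \<Rightarrow> real) \<Rightarrow> real \<Rightarrow> bool" where
  "linear_at b \<omega> u t \<longleftrightarrow> (\<exists>v w. H_deriv u t v \<and> opA (u t) w \<and> (AE x in U01. v x + w x = b + \<omega> * u t x))"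

text \<open>A solution of the linear problem with the source eliminated and the initial value left
  open, so that a time shift does not involve a jointly measurable r.\<close>

definition linear_evolution :: "real \<Rightarrow> real \<Rightarrow> real \<Rightarrow> (real \<Rightarrow> real \<Rightarrow> real) \<Rightarrow> bool" where
  "linear_evolution b \<omega> \<tau> u \<longleftrightarrow> (\<forall>t\<ge>\<tau>. inH (u t)) \<and>
     (\<forall>t\<ge>\<tau>. ((\<lambda>s. Hnorm (\<lambda>x. u s x - u t x)) \<longlongrightarrow> 0) (at t within {\<tau>..})) \<and>
     (\<forall>T1 T2. \<tau> < T1 \<and> T1 < T2 \<longrightarrow> H_abs_cont u T1 T2) \<and>
     (AE t in lborel. \<tau> < t \<longrightarrow> linear_at b \<omega> u t)"

lemma is_solution_imp_linear_evolution:
  assumes "is_solution (F_lin b \<omega>) \<tau> u0 u"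
  shows "linear_evolution b \<omega> \<tau> u"
proof -
  obtain r where r: "(\<lambda>(t, x). r t x) \<in> borel_measurable (lborel \<Otimes>\<^sub>M lborel)"
    "AE t in lborel. \<tau> < t \<longrightarrow> (AE x in U01. F_lin b \<omega> (u t x) (r t x))"
    "AE t in lborel. \<tau> < t \<longrightarrow>
       (\<exists>v w. H_deriv u t v \<and> opA (u t) w \<and> Hnorm (\<lambda>x. v x + w x - r t x) = 0)"
    using assms unfolding is_solution_def AE_U01 by blast
  have "AE t in lborel. \<tau> < t \<longrightarrow> linear_at b \<omega> u t"
    using r(2,3)
  proof eventually_elim
    case (elim t)
    show ?case
    proof
      assume t: "\<tau> < t"
      obtain v w where vw: "H_deriv u t v" "opA (u t) w" "Hnorm (\<lambda>x. v x + w x - r t x) = 0"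
        using elim t by blast
      have F: "AE x in U01. b + \<omega> * u t x = r t x" using elim t by (auto simp: F_lin_def elim: eventually_mono)
      have "inH (\<lambda>x. b + \<omega> * u t x)" using vw(2) by (auto simp: opA_def)
      then have "inH (r t)" by (rule inH_cong_AE[OF _ source_slice_measurable[OF r(1)] F])
      then have "AE x in U01. v x + w x = r t x"
        using vw by (intro AE_eq_source) (auto simp: H_deriv_def opA_def)
      then have "AE x in U01. v x + w x = b + \<omega> * u t x" using F by eventually_elim simp
      then show "linear_at b \<omega> u t" unfolding linear_at_def using vw by blast
    qed
  qed
  then show ?thesis using assms unfolding is_solution_def linear_evolution_def by blast
qed

text \<open>The constant b cancels in the difference, which solves the homogeneous equation of
  \<open>energy_decay\<close>. The start T1 lies strictly after \<tau>, where absolute continuity is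
  available.\<close>

lemma linear_evolution_difference_decay:
  assumes u: "linear_evolution b \<omega> \<tau> u" and u': "linear_evolution b \<omega> \<tau> u'" and T: "\<tau> < T1" "T1 < T2"
    and \<mu>: "0 \<le> \<mu>" "\<mu> < pi" and c: "c = \<mu>^2 - \<omega>" "c \<ge> 0"
  shows "exp (2 * c * T2) * (Hnorm (\<lambda>x. u T2 x - u' T2 x))^2 \<le> exp (2 * c * T1) * (Hnorm (\<lambda>x. u T1 x - u' T1 x))^2"
proof -
  have H: "inH (u t)" "inH (u' t)" if "t \<ge> \<tau>" for t
    using u u' that by (auto simp: linear_evolution_def)
  have "exp (2 * c * T2) * (Hnorm ((\<lambda>t x. u t x - u' t x) T2))^2 \<le> exp (2 * c * T1) * (Hnorm ((\<lambda>t x. u t x - u' t x) T1))^2"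
  proof (rule energy_decay[OF _ _ _ _ _ \<mu> c])
    show "T1 \<le> T2" using T by simp
    show "inH (\<lambda>x. u t x - u' t x)" if "t \<in> {T1..T2}" for t
      using that T by (intro inH_diff H) auto
    show "H_abs_cont (\<lambda>t x. u t x - u' t x) T1 T2"
      using u u' T by (intro H_abs_cont_diff H) (auto simp: linear_evolution_def)
    show "((\<lambda>s. Hnorm (\<lambda>x. (u s x - u' s x) - (u t x - u' t x))) \<longlongrightarrow> 0) (at t within {T1..T2})"
      if t: "t \<in> {T1..T2}" for t
    proof -
      have "((\<lambda>s. Hnorm (\<lambda>x. u s x - u t x) + Hnorm (\<lambda>x. u' s x - u' t x)) \<longlongrightarrow> 0 + 0) (at t within {\<tau>..})"
        using u u' t T unfolding linear_evolution_def by (intro tendsto_add) auto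
      then have "((\<lambda>s. Hnorm (\<lambda>x. u s x - u t x) + Hnorm (\<lambda>x. u' s x - u' t x)) \<longlongrightarrow> 0) (at t within {T1..T2})"
        using T by (auto intro: tendsto_within_subset)
      then show ?thesis
      proof (rule Lim_null_comparison[rotated])
        have "norm (Hnorm (\<lambda>x. (u s x - u' s x) - (u t x - u' t x))) \<le> Hnorm (\<lambda>x. u s x - u t x) + Hnorm (\<lambda>x. u' s x - u' t x)"
          if s: "s \<in> {T1..T2}" for s
        proof -
          have "(\<lambda>x. (u s x - u' s x) - (u t x - u' t x)) = (\<lambda>x. (u s x - u t x) - (u' s x - u' t x))" by auto
          moreover have "inH (\<lambda>x. u s x - u t x)" "inH (\<lambda>x. u' s x - u' t x)"
            using s t T by (intro inH_diff H; simp)+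
          ultimately show ?thesis using Hnorm_triangle_diff Hnorm_nonneg by simp
        qed
        then show "\<forall>\<^sub>F s in at t within {T1..T2}. norm (Hnorm (\<lambda>x. (u s x - u' s x) - (u t x - u' t x)))
            \<le> Hnorm (\<lambda>x. u s x - u t x) + Hnorm (\<lambda>x. u' s x - u' t x)"
          by (simp add: eventually_at_filter)
      qed
    qed
    have "AE t in lborel. \<tau> < t \<longrightarrow> linear_at b \<omega> u t" "AE t in lborel. \<tau> < t \<longrightarrow> linear_at b \<omega> u' t"
      using u u' by (auto simp: linear_evolution_def)
    then show "AE t in lborel. T1 < t \<and> t < T2 \<longrightarrow> (\<exists>v w. H_deriv (\<lambda>t x. u t x - u' t x) t v \<and>
      opA (\<lambda>x. u t x - u' t x) w \<and> (AE x in U01. v x + w x = \<omega> * (u t x - u' t x)))"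
    proof eventually_elim
      case (elim t)
      show ?case
      proof
        assume t: "T1 < t \<and> t < T2"
        obtain v w where vw: "H_deriv u t v" "opA (u t) w" "AE x in U01. v x + w x = b + \<omega> * u t x"
          using elim(1) t T unfolding linear_at_def by auto
        obtain v' w' where vw': "H_deriv u' t v'" "opA (u' t) w'" "AE x in U01. v' x + w' x = b + \<omega> * u' t x"
          using elim(2) t T unfolding linear_at_def by auto
        have "\<forall>\<^sub>F s in at t. s > \<tau>"
          using t T by (intro eventually_at_in_open'[of "{\<tau><..}", simplified]) auto
        then have "\<forall>\<^sub>F s in at t. inH (u s) \<and> inH (u' s)" by eventually_elim (simp add: H)
        then have "H_deriv (\<lambda>t x. u t x - u' t x) t (\<lambda>x. v x - v' x)"
          using t T by (intro H_deriv_diff vw vw' H) auto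
        moreover have "AE x in U01. (v x - v' x) + (w x - w' x) = \<omega> * (u t x - u' t x)"
          using vw(3) vw'(3) by eventually_elim (simp add: algebra_simps)
        ultimately show "\<exists>v w. H_deriv (\<lambda>t x. u t x - u' t x) t v \<and>
          opA (\<lambda>x. u t x - u' t x) w \<and> (AE x in U01. v x + w x = \<omega> * (u t x - u' t x))"
          using opA_diff[OF vw(2) vw'(2)] by blast
      qed
    qed
  qed
  then show ?thesis by simp
qed

section \<open>Classification of the trajectories\<close>

text \<open>\<open>Poincare_U01\<close> is stated for \<mu> < pi; taking \<mu>^2 midway between
  \<omega> and pi^2 leaves a positive decay rate.\<close>

lemma subcritical_sqrt:
  assumes "0 \<le> \<omega>" "\<omega> < pi^2"
  obtains \<mu> where "0 \<le> \<mu>" "\<mu> < pi" "\<mu>^2 - \<omega> > 0"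
proof (rule that)
  let ?\<mu> = "sqrt ((\<omega> + pi^2) / 2)"
  have "?\<mu> < sqrt (pi^2)" using assms by (intro real_sqrt_less_mono) simp
  then show "?\<mu> < pi" by simp
  show "0 \<le> ?\<mu>" using assms by simp
  show "?\<mu>^2 - \<omega> > 0" using assms by simp
qed

text \<open>The decay estimate only starts at times s > \<tau>; letting s decrease to \<tau>,
  continuity in H brings in the common initial value.\<close>

lemma linear_evolution_unique:
  assumes u: "linear_evolution b \<omega> \<tau> u" and u': "linear_evolution b \<omega> \<tau> u'"
    and \<omega>: "0 \<le> \<omega>" "\<omega> < pi^2" and 0: "Hnorm (\<lambda>x. u \<tau> x - u' \<tau> x) = 0" and t: "t \<ge> \<tau>"
  shows "Hnorm (\<lambda>x. u t x - u' t x) = 0"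
proof (cases "t = \<tau>")
  case False
  with t have t: "\<tau> < t" by simp
  obtain \<mu> where \<mu>: "0 \<le> \<mu>" "\<mu> < pi" "\<mu>^2 - \<omega> > 0" using subcritical_sqrt[OF \<omega>] .
  define c where "c = \<mu>^2 - \<omega>"
  have c: "c > 0" using \<mu> by (simp add: c_def)
  have H: "inH (u t)" "inH (u' t)" if "t \<ge> \<tau>" for t
    using u u' that by (auto simp: linear_evolution_def)
  define d where "d s = Hnorm (\<lambda>x. u s x - u' s x)" for s
  have dec: "d t \<le> d s" if s: "\<tau> < s" "s < t" for s
  proof -
    have "exp (2 * c * t) * (d t)^2 \<le> exp (2 * c * s) * (d s)^2"
      unfolding d_def using c by (intro linear_evolution_difference_decay[OF u u' s \<mu>(1,2)]) (auto simp: c_def)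
    also have "\<dots> \<le> exp (2 * c * t) * (d s)^2" using s c by (intro mult_right_mono) auto
    finally have "(d t)^2 \<le> (d s)^2" by simp
    then show ?thesis by (rule power2_le_imp_le) (simp add: d_def Hnorm_nonneg)
  qed
  have le: "d s \<le> Hnorm (\<lambda>x. u s x - u \<tau> x) + Hnorm (\<lambda>x. u' s x - u' \<tau> x)" if s: "s \<ge> \<tau>" for s
  proof -
    have h: "inH (\<lambda>x. u s x - u \<tau> x)" "inH (\<lambda>x. u' s x - u' \<tau> x)" "inH (\<lambda>x. u \<tau> x - u' \<tau> x)"
      using s by (intro inH_diff H; simp)+
    have "(\<lambda>x. u s x - u' s x) = (\<lambda>x. ((u s x - u \<tau> x) - (u' s x - u' \<tau> x)) + (u \<tau> x - u' \<tau> x))" by auto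
    then have "d s \<le> Hnorm (\<lambda>x. (u s x - u \<tau> x) - (u' s x - u' \<tau> x)) + Hnorm (\<lambda>x. u \<tau> x - u' \<tau> x)"
      unfolding d_def using Hnorm_triangle[OF inH_diff[OF h(1,2)] h(3)] by simp
    then show ?thesis using 0 Hnorm_triangle_diff[OF h(1,2)] by simp
  qed
  have "((\<lambda>s. Hnorm (\<lambda>x. u s x - u \<tau> x) + Hnorm (\<lambda>x. u' s x - u' \<tau> x)) \<longlongrightarrow> 0 + 0) (at \<tau> within {\<tau>..})"
    using u u' unfolding linear_evolution_def by (intro tendsto_add) auto
  then have lim: "((\<lambda>s. Hnorm (\<lambda>x. u s x - u \<tau> x) + Hnorm (\<lambda>x. u' s x - u' \<tau> x)) \<longlongrightarrow> 0) (at_right \<tau>)"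
    by (auto intro: tendsto_within_subset)
  have "\<forall>\<^sub>F s in at_right \<tau>. d t \<le> Hnorm (\<lambda>x. u s x - u \<tau> x) + Hnorm (\<lambda>x. u' s x - u' \<tau> x)"
    using eventually_at_right_real[OF t]
  proof eventually_elim
    case (elim s)
    then show ?case using dec[of s] le[of s] by auto
  qed
  from tendsto_lowerbound[OF lim this] have "d t \<le> 0" by simp
  then show ?thesis using Hnorm_nonneg[of "\<lambda>x. u t x - u' t x"] by (simp add: d_def)
qed (use 0 in simp)

section \<open>Invariance under time shifts\<close>

lemma H_abs_cont_shift:
  assumes "H_abs_cont u (T1 + h) (T2 + h)"
  shows "H_abs_cont (\<lambda>t. u (t + h)) T1 T2"
  unfolding H_abs_cont_def
proof (intro allI impI)
  fix \<epsilon> :: real assume "\<epsilon> > 0"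
  with assms obtain \<delta> where d: "\<delta> > 0" "\<forall>n (a :: nat \<Rightarrow> real) c.
        (\<forall>i<n. T1 + h \<le> a i \<and> a i \<le> c i \<and> c i \<le> T2 + h) \<and> disjoint_family_on (\<lambda>i. {a i<..<c i}) {..<n} \<and>
        (\<Sum>i<n. c i - a i) < \<delta> \<longrightarrow> (\<Sum>i<n. Hnorm (\<lambda>x. u (c i) x - u (a i) x)) < \<epsilon>"
    unfolding H_abs_cont_def by blast
  show "\<exists>\<delta>>0. \<forall>n (a :: nat \<Rightarrow> real) c.
        (\<forall>i<n. T1 \<le> a i \<and> a i \<le> c i \<and> c i \<le> T2) \<and> disjoint_family_on (\<lambda>i. {a i<..<c i}) {..<n} \<and>
        (\<Sum>i<n. c i - a i) < \<delta> \<longrightarrow> (\<Sum>i<n. Hnorm (\<lambda>x. u (c i + h) x - u (a i + h) x)) < \<epsilon>"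
  proof (intro exI[of _ \<delta>] conjI allI impI d(1))
    fix n and a c :: "nat \<Rightarrow> real"
    assume *: "(\<forall>i<n. T1 \<le> a i \<and> a i \<le> c i \<and> c i \<le> T2) \<and> disjoint_family_on (\<lambda>i. {a i<..<c i}) {..<n} \<and>
        (\<Sum>i<n. c i - a i) < \<delta>"
    have "disjoint_family_on (\<lambda>i. {a i + h<..<c i + h}) {..<n}"
      unfolding disjoint_family_on_def
    proof (intro ballI impI)
      fix m k assume mk: "m \<in> {..<n}" "k \<in> {..<n}" "m \<noteq> k"
      then have e: "{a m<..<c m} \<inter> {a k<..<c k} = {}" using * unfolding disjoint_family_on_def by blast
      show "{a m + h<..<c m + h} \<inter> {a k + h<..<c k + h} = {}"
      proof (rule equals0I)
        fix y assume "y \<in> {a m + h<..<c m + h} \<inter> {a k + h<..<c k + h}"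
        then have "y - h \<in> {a m<..<c m} \<inter> {a k<..<c k}" by auto
        then show False using e by blast
      qed
    qed
    then show "(\<Sum>i<n. Hnorm (\<lambda>x. u (c i + h) x - u (a i + h) x)) < \<epsilon>"
      using * by (intro d(2)[rule_format, of n "\<lambda>i. a i + h" "\<lambda>i. c i + h"]) auto
  qed
qed

lemma linear_at_shift:
  assumes "linear_at b \<omega> u (t + h)"
  shows "linear_at b \<omega> (\<lambda>t. u (t + h)) t"
proof -
  obtain v w where vw: "H_deriv u (t + h) v" "opA (u (t + h)) w" "AE x in U01. v x + w x = b + \<omega> * u (t + h) x"
    using assms unfolding linear_at_def by blast
  have "((\<lambda>s. Hnorm (\<lambda>x. (u (s + h) x - u (t + h) x) / (s + h - (t + h)) - v x)) \<longlongrightarrow> 0) (at (t + h - h))"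
    by (rule LIM_offset) (use vw(1) in \<open>simp add: H_deriv_def\<close>)
  then have "H_deriv (\<lambda>t. u (t + h)) t v" using vw(1) by (simp add: H_deriv_def)
  then show ?thesis unfolding linear_at_def using vw by blast
qed

lemma AE_lborel_shift:
  fixes h :: real
  assumes "AE t in lborel. P t" shows "AE t in lborel. P (t + h)"
proof -
  have "AE t in distr lborel borel ((+) h). P t" using assms unfolding lborel_distr_plus .
  then have "AE t in lborel. P (h + t)" by (rule AE_distrD[rotated]) simp
  then show ?thesis by (simp add: add.commute)
qed

section \<open>Uniqueness of the positive stationary solution\<close>

lemma pos_stationary_unique:
  assumes v: "pos_stationary b \<omega> v" "pos_stationary b \<omega> v'" and \<omega>: "0 \<le> \<omega>" "\<omega> < pi^2"
    and x: "x \<in> {0..1}"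
  shows "v x = v' x"
proof -
  obtain \<mu> where \<mu>: "0 \<le> \<mu>" "\<mu> < pi" "\<mu>^2 - \<omega> > 0" using subcritical_sqrt[OF \<omega>] .
  define d where "d x = v x - v' x" for x
  have "second_deriv_L2 (\<lambda>x. v x - v' x) (\<lambda>x. - (b + \<omega> * v x) - - (b + \<omega> * v' x))"
    using v by (intro second_deriv_L2_diff) (auto simp: pos_stationary_def)
  moreover have "(\<lambda>x. - (b + \<omega> * v x) - - (b + \<omega> * v' x)) = (\<lambda>x. - \<omega> * d x)"
    by (auto simp: d_def algebra_simps)
  \<comment> \<open>The difference solves -d'' = \<omega> d with zero boundary values, and the
    Poincare inequality with \<mu>^2 > \<omega> leaves only d = 0.\<close>
  ultimately have d: "second_deriv_L2 d (\<lambda>x. - \<omega> * d x)" by (simp add: d_def[abs_def])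
  have dc: "continuous_on {0..1} d" using second_deriv_L2_E[OF d] by blast
  have dH: "inH d" by (rule continuous_on_inH[OF dc])
  have "(\<integral>x. - \<omega> * d x * d x \<partial>U01) \<le> - (\<mu>^2) * (\<integral>x. (d x)^2 \<partial>U01)"
    using v by (intro Poincare_U01[OF d _ _ \<mu>(1,2)]) (auto simp: d_def pos_stationary_def)
  moreover have "(\<integral>x. - \<omega> * d x * d x \<partial>U01) = - \<omega> * (\<integral>x. (d x)^2 \<partial>U01)"
    by (simp add: power2_eq_square mult.assoc)
  ultimately have "(\<mu>^2 - \<omega>) * (Hnorm d)^2 \<le> 0" by (simp add: Hnorm_power2 left_diff_distrib)
  then have "(Hnorm d)^2 \<le> 0" using \<mu>(3) by (simp add: mult_le_0_iff)
  then have "AE x in U01. d x = 0" using Hnorm_eq_0_iff[OF dH] by simp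
  then have "AE x in U01. d x \<ge> 0" "AE x in U01. - d x \<ge> 0" by (auto elim: eventually_mono)
  moreover have "continuous_on {0..1} (\<lambda>x. - d x)" using dc by (intro continuous_intros)
  ultimately have "d x \<ge> 0" "- d x \<ge> 0"
    using dc x by (auto intro: AE_U01_nonneg_continuous simp del: neg_0_le_iff_le)
  then show ?thesis by (simp add: d_def)
qed

text \<open>The description in \<open>v1plus\<close> fixes the value 0 outside [0,1], so g is
  truncated before uniqueness identifies the two. Existence enters through g, which a nowhere
  vanishing trajectory will provide.\<close>

lemma v1plus_eqI:
  assumes g: "pos_stationary b \<omega> g" and \<omega>: "0 \<le> \<omega>" "\<omega> < pi^2" and x: "x \<in> {0..1}"
  shows "v1plus b \<omega> x = g x"
proof -
  define g0 where "g0 x = (if x \<in> {0..1} then g x else 0)" for x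
  have "second_deriv_L2 g0 (\<lambda>x. - (b + \<omega> * g0 x))"
  proof -
    obtain g1 where "inH (\<lambda>x. - (b + \<omega> * g x))" and g1: "\<And>x. x \<in> {0..1} \<Longrightarrow> (g has_real_derivative g1 x) (at x within {0..1})"
      "\<And>x. x \<in> {0..1} \<Longrightarrow> g1 x = g1 0 + (\<integral>y. indicator {..<x} y * - (b + \<omega> * g y) \<partial>U01)"
      and "continuous_on {0..1} g1" and gc: "continuous_on {0..1} g"
      using second_deriv_L2_E[of g "\<lambda>x. - (b + \<omega> * g x)"] g unfolding pos_stationary_def by blast
    show ?thesis
      unfolding second_deriv_L2_iff
    proof (intro conjI exI[of _ g1] ballI)
      have "continuous_on {0..1} g0"
        using gc by (rule continuous_on_cong[THEN iffD1, rotated 2]) (auto simp: g0_def)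
      then show "inH (\<lambda>x. - (b + \<omega> * g0 x))" by (intro continuous_on_inH continuous_intros)
      fix x :: real assume x: "x \<in> {0..1}"
      show "(g0 has_real_derivative g1 x) (at x within {0..1})"
        by (rule has_field_derivative_transform_within[OF g1(1)[OF x], of 1]) (use x in \<open>auto simp: g0_def\<close>)
      have "(\<integral>y. indicator {..<x} y * - (b + \<omega> * g y) \<partial>U01) = (\<integral>y. indicator {..<x} y * - (b + \<omega> * g0 y) \<partial>U01)"
        by (intro Bochner_Integration.integral_cong refl) (simp add: g0_def)
      then show "g1 x = g1 0 + (\<integral>y. indicator {..<x} y * - (b + \<omega> * g0 y) \<partial>U01)"
        using g1(2)[OF x] by simp
    qed
  qed
  then have "pos_stationary b \<omega> g0" using g by (auto simp: pos_stationary_def g0_def)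
  then have "v1plus b \<omega> = g0"
    unfolding v1plus_def
  proof (intro the_equality conjI)
    fix v assume v: "pos_stationary b \<omega> v \<and> (\<forall>x. x \<notin> {0..1} \<longrightarrow> v x = 0)"
    show "v = g0"
    proof
      fix x show "v x = g0 x"
        using v pos_stationary_unique[of b \<omega> v g0 x] \<open>pos_stationary b \<omega> g0\<close> \<omega>
        by (cases "x \<in> {0..1}") (auto simp: g0_def)
    qed
  qed (auto simp: g0_def)
  then show ?thesis using x by (simp add: g0_def)
qed

context nonneg_trajectory
begin

text \<open>Positivity in the interior removes the branch of the source on the zero set.\<close>

lemma regular_nonzeroE:
  assumes "regular_at b \<omega> \<phi> t" "Hnorm (\<phi> t) \<noteq> 0"
  obtains v g h where "H_deriv \<phi> t v" "AE x in U01. \<phi> t x = g x" "g 0 = 0" "g 1 = 0"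
    "second_deriv_L2 g h" "\<forall>x\<in>{0<..<1}. g x > 0" "AE x in U01. v x = h x + (b + \<omega> * g x)"
proof -
  obtain v g h where vgh: "H_deriv \<phi> t v" "AE x in U01. \<phi> t x = g x" "g 0 = 0" "g 1 = 0"
    "second_deriv_L2 g h" "\<forall>x\<in>{0..1}. 0 \<le> g x"
    "AE x in U01. v x = h x + (if g x = 0 then 0 else b + \<omega> * g x)"
    using assms(1) unfolding regular_at_def by blast
  have pos: "g x > 0" if "x \<in> {0<..<1}" for x
    using that vgh(6) by (intro positive[OF assms(2) vgh(2,5)]) auto
  have "AE x in U01. v x = h x + (b + \<omega> * g x)"
    using vgh(7) AE_space
  proof eventually_elim
    case (elim x)
    then show ?case using pos[of x] by simp
  qed
  then show ?thesis using that vgh pos by blast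
qed

lemma linear_at_if_nonzero:
  assumes "regular_at b \<omega> \<phi> t" "Hnorm (\<phi> t) \<noteq> 0"
  shows "linear_at b \<omega> \<phi> t"
proof -
  obtain v g h where vgh: "H_deriv \<phi> t v" "AE x in U01. \<phi> t x = g x" "g 0 = 0" "g 1 = 0"
    "second_deriv_L2 g h" "AE x in U01. v x = h x + (b + \<omega> * g x)"
    using regular_nonzeroE[OF assms] by metis
  have "inH h" using vgh(5) by (simp add: second_deriv_L2_iff)
  then have "opA (\<phi> t) (\<lambda>x. - h x)"
    unfolding opA_def AE_U01[symmetric] using vgh inH_phi by (auto intro!: exI[of _ g])
  moreover have "AE x in U01. v x + - h x = b + \<omega> * \<phi> t x"
    using vgh(2,6) by eventually_elim simp
  ultimately show ?thesis unfolding linear_at_def using vgh(1) by blast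
qed

text \<open>The trajectory and its given source r serve unchanged: where the trajectory is positive,
  \<open>H0\<close> leaves b as the only choice. This also settles existence for the linear problem
  with zero data.\<close>

lemma is_solution_linear:
  assumes ne: "\<And>t. t > \<tau> \<Longrightarrow> Hnorm (\<phi> t) \<noteq> 0" and 0: "Hnorm (\<phi> \<tau>) = 0"
  shows "is_solution (F_lin b \<omega>) \<tau> (\<lambda>x. 0) \<phi>"
proof -
  have sol: "is_solution (F_P b \<omega>) \<tau> (\<phi> \<tau>) \<phi>" using traj by (simp add: complete_trajectory_def)
  then obtain r where r: "(\<lambda>(t, x). r t x) \<in> borel_measurable (lborel \<Otimes>\<^sub>M lborel)"
    "\<forall>T>\<tau>. set_integrable (lborel \<Otimes>\<^sub>M lborel) ({\<tau><..<T} \<times> {0<..<1}) (\<lambda>(t, x). (r t x)^2)"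
    "AE t in lborel. \<tau> < t \<longrightarrow> (AE x in U01. F_P b \<omega> (\<phi> t x) (r t x))"
    "AE t in lborel. \<tau> < t \<longrightarrow> (\<exists>v w. H_deriv \<phi> t v \<and> opA (\<phi> t) w \<and> Hnorm (\<lambda>x. v x + w x - r t x) = 0)"
    unfolding is_solution_def AE_U01 by blast
  have "AE t in lborel. \<tau> < t \<longrightarrow> (AE x in U01. F_lin b \<omega> (\<phi> t x) (r t x))"
    using r(3) regular
  proof eventually_elim
    case (elim t)
    show ?case
    proof
      assume t: "\<tau> < t"
      obtain g where g: "AE x in U01. \<phi> t x = g x" "\<forall>x\<in>{0<..<1}. g x > 0"
        using regular_nonzeroE[OF elim(2) ne[OF t]] by metis
      have "AE x in U01. F_P b \<omega> (\<phi> t x) (r t x)" using elim t by blast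
      then show "AE x in U01. F_lin b \<omega> (\<phi> t x) (r t x)"
        using g(1) AE_space
      proof eventually_elim
        case (elim x)
        then have "\<phi> t x > 0" using g(2) by simp
        then show ?case using elim(1) by (auto simp: F_P_def F_lin_def H0_def)
      qed
    qed
  qed
  then have "\<exists>r. (\<lambda>(t, x). r t x) \<in> borel_measurable (lborel \<Otimes>\<^sub>M lborel) \<and>
    (\<forall>T>\<tau>. set_integrable (lborel \<Otimes>\<^sub>M lborel) ({\<tau><..<T} \<times> {0<..<1}) (\<lambda>(t, x). (r t x)^2)) \<and>
    (AE t in lborel. \<tau> < t \<longrightarrow> (AE x in U01. F_lin b \<omega> (\<phi> t x) (r t x))) \<and>
    (AE t in lborel. \<tau> < t \<longrightarrow> (\<exists>v w. H_deriv \<phi> t v \<and> opA (\<phi> t) w \<and> Hnorm (\<lambda>x. v x + w x - r t x) = 0))"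
    using r by blast
  then show ?thesis
    using sol 0 unfolding is_solution_def AE_U01 by simp
qed

lemma linear_evolution_if_nonzero:
  assumes "\<And>t. Hnorm (\<phi> t) \<noteq> 0"
  shows "linear_evolution b \<omega> \<tau> (\<lambda>t. \<phi> (t + h))"
proof -
  have "AE t in lborel. linear_at b \<omega> \<phi> t"
    using regular by eventually_elim (rule linear_at_if_nonzero[OF _ assms])
  then have "AE t in lborel. linear_at b \<omega> \<phi> (t + h)" by (rule AE_lborel_shift)
  then have "AE t in lborel. \<tau> < t \<longrightarrow> linear_at b \<omega> (\<lambda>t. \<phi> (t + h)) t"
    by eventually_elim (simp add: linear_at_shift)
  moreover have "H_abs_cont (\<lambda>t. \<phi> (t + h)) T1 T2" if "T1 < T2" for T1 T2
    using that by (intro H_abs_cont_shift abs_cont_phi) simp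
  moreover have "((\<lambda>s. Hnorm (\<lambda>x. \<phi> (s + h) x - \<phi> (t + h) x)) \<longlongrightarrow> 0) (at t within {\<tau>..})" for t
  proof -
    have "((\<lambda>s. Hnorm (\<lambda>x. \<phi> (s + h) x - \<phi> (t + h) x)) \<longlongrightarrow> 0) (at (t + h - h))"
      by (rule LIM_offset[OF continuous_phi])
    then have "((\<lambda>s. Hnorm (\<lambda>x. \<phi> (s + h) x - \<phi> (t + h) x)) \<longlongrightarrow> 0) (at t)" by simp
    then show ?thesis by (rule tendsto_within_subset) simp
  qed
  ultimately show ?thesis unfolding linear_evolution_def using inH_phi by blast
qed

text \<open>The trajectory and its translate by s - t both solve the linear problem on the whole
  line. Started n time units back, their difference is at most 2 M and has decayed by exp (- c n) at
  time t; n is arbitrary.\<close>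

lemma constant_if_nonzero:
  assumes ne: "\<And>t. Hnorm (\<phi> t) \<noteq> 0" and \<omega>: "\<omega> < pi^2"
  shows "Hnorm (\<lambda>x. \<phi> s x - \<phi> t x) = 0"
proof -
  obtain \<mu> where \<mu>: "0 \<le> \<mu>" "\<mu> < pi" "\<mu>^2 - \<omega> > 0" using subcritical_sqrt[OF \<omega>_nonneg \<omega>] .
  define c where "c = \<mu>^2 - \<omega>"
  have c: "c > 0" using \<mu> by (simp add: c_def)
  define h where "h = s - t"
  define d where "d t = Hnorm (\<lambda>x. \<phi> (t + h) x - \<phi> t x)" for t
  have dM: "d r \<le> 2 * M" for r
    using Hnorm_triangle_diff[OF inH_phi inH_phi, of "r + h" r] bounded[of r] bounded[of "r + h"] by (simp add: d_def)
  have dnn: "d r \<ge> 0" for r by (simp add: d_def Hnorm_nonneg)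
  have "(d t)^2 \<le> exp (- (2 * c) * real n) * (2 * M)^2" if n: "n > 0" for n
  proof -
    \<comment> \<open>The extra unit puts the starting time of the decay estimate, t - n, strictly
      after the initial time.\<close>
    have "linear_evolution b \<omega> (t - real n - 1) (\<lambda>t. \<phi> (t + h))" "linear_evolution b \<omega> (t - real n - 1) \<phi>"
      using linear_evolution_if_nonzero[OF ne] linear_evolution_if_nonzero[OF ne, where h = 0] by auto
    from linear_evolution_difference_decay[OF this, of "t - real n" t \<mu> c]
    have "exp (2 * c * t) * (d t)^2 \<le> exp (2 * c * (t - real n)) * (d (t - real n))^2"
      using n \<mu> c by (simp add: d_def c_def)
    also have "\<dots> \<le> exp (2 * c * (t - real n)) * (2 * M)^2"
      using dM dnn by (intro mult_left_mono power_mono) auto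
    also have "\<dots> = exp (2 * c * t) * (exp (- (2 * c) * real n) * (2 * M)^2)"
      by (simp add: exp_add[symmetric] algebra_simps mult_exp_exp)
    finally show ?thesis by simp
  qed
  moreover have "(\<lambda>n. exp (- (2 * c) * real n) * (2 * M)^2) \<longlonglongrightarrow> 0"
  proof -
    have "filterlim (\<lambda>n. (2 * c) * real n) at_top sequentially"
      using c by (intro filterlim_tendsto_pos_mult_at_top[OF tendsto_const] filterlim_real_sequentially) auto
    then have "filterlim (\<lambda>n. - (2 * c) * real n) at_bot sequentially"
      by (simp add: filterlim_uminus_at_top)
    then have "(\<lambda>n. exp (- (2 * c) * real n)) \<longlonglongrightarrow> 0" by (rule filterlim_compose[OF exp_at_bot])
    then show ?thesis by (rule tendsto_mult_left_zero)
  qed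
  ultimately have "(d t)^2 \<le> 0" by (intro LIMSEQ_le_const) (auto intro!: exI[of _ 1])
  then show ?thesis by (simp add: d_def h_def)
qed

text \<open>A single regular time suffices: the trajectory is constant in H, so its time derivative
  there is 0 and the equation becomes the stationary one for the representative g.\<close>

lemma stationary_if_nonzero:
  assumes ne: "\<And>t. Hnorm (\<phi> t) \<noteq> 0" and \<omega>: "\<omega> < pi^2"
  shows "Hnorm (\<lambda>x. \<phi> s x - v1plus b \<omega> x) = 0"
proof -
  obtain t where t: "regular_at b \<omega> \<phi> t"
    using eventually_happens'[OF _ regular] by (auto simp: ae_filter_eq_bot_iff)
  obtain v g h where vgh: "H_deriv \<phi> t v" "AE x in U01. \<phi> t x = g x" "g 0 = 0" "g 1 = 0"
    "second_deriv_L2 g h" "\<forall>x\<in>{0<..<1}. g x > 0" "AE x in U01. v x = h x + (b + \<omega> * g x)"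
    by (rule regular_nonzeroE[OF t ne]) (rule that)
  have vH: "inH v" using vgh(1) by (simp add: H_deriv_def)
  have const: "AE x in U01. \<phi> s x = \<phi> t x" for s
    using constant_if_nonzero[OF ne \<omega>, of s t] Hnorm_eq_0_iff[OF inH_diff[OF inH_phi inH_phi], of s t] by simp
  have "Hnorm (\<lambda>x. (\<phi> s x - \<phi> t x) / (s - t) - v x) = Hnorm (\<lambda>x. - v x)" for s
  proof (rule Hnorm_cong_AE)
    show "(\<lambda>x. (\<phi> s x - \<phi> t x) / (s - t) - v x) \<in> borel_measurable U01"
      by (intro inH_measurable inH_diff inH_divide inH_phi vH)
    show "(\<lambda>x. - v x) \<in> borel_measurable U01" by (intro inH_measurable inH_minus vH)
    show "AE x in U01. (\<phi> s x - \<phi> t x) / (s - t) - v x = - v x" using const[of s] by eventually_elim simp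
  qed
  \<comment> \<open>The quotients vanish in H, so the norm that tends to 0 in \<open>H_deriv\<close>
    is independent of s.\<close>
  then have "((\<lambda>s::real. Hnorm v) \<longlongrightarrow> 0) (at t)" using vgh(1) by (simp add: H_deriv_def Hnorm_uminus)
  then have "Hnorm v = 0" by (simp add: tendsto_const_iff)
  then have "AE x in U01. v x = 0" using Hnorm_eq_0_iff[OF vH] by simp
  then have hg: "AE x in U01. h x = - (b + \<omega> * g x)" using vgh(7) by eventually_elim simp
  obtain g1 where "inH h" and g1: "\<And>x. x \<in> {0..1} \<Longrightarrow> (g has_real_derivative g1 x) (at x within {0..1})"
    "\<And>x. x \<in> {0..1} \<Longrightarrow> g1 x = g1 0 + (\<integral>y. indicator {..<x} y * h y \<partial>U01)"
    and "continuous_on {0..1} g1" and gc: "continuous_on {0..1} g"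
    using second_deriv_L2_E[OF vgh(5)] by blast
  have gH: "inH (\<lambda>x. - (b + \<omega> * g x))" using gc by (intro continuous_on_inH continuous_intros)
  have "second_deriv_L2 g (\<lambda>x. - (b + \<omega> * g x))"
    unfolding second_deriv_L2_iff
  proof (intro conjI exI[of _ g1] ballI gH g1(1))
    fix x :: real assume x: "x \<in> {0..1}"
    have "(\<integral>y. indicator {..<x} y * h y \<partial>U01) = (\<integral>y. indicator {..<x} y * - (b + \<omega> * g y) \<partial>U01)"
    proof (rule integral_cong_AE)
      show "(\<lambda>y. indicator {..<x} y * h y) \<in> borel_measurable U01"
        "(\<lambda>y. indicator {..<x} y * - (b + \<omega> * g y)) \<in> borel_measurable U01"
        using \<open>inH h\<close> gH by (auto intro!: inH_measurable inH_indicator_mult simp del: mult_minus_right)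
      show "AE y in U01. indicator {..<x} y * h y = indicator {..<x} y * - (b + \<omega> * g y)"
        using hg by eventually_elim simp
    qed
    then show "g1 x = g1 0 + (\<integral>y. indicator {..<x} y * - (b + \<omega> * g y) \<partial>U01)" using g1(2)[OF x] by simp
  qed
  then have "pos_stationary b \<omega> g" using vgh(3,4,6) by (auto simp: pos_stationary_def)
  then have v1: "v1plus b \<omega> x = g x" if "x \<in> {0..1}" for x
    using \<omega>_nonneg \<omega> that by (intro v1plus_eqI)
  have "AE x in U01. \<phi> s x - v1plus b \<omega> x = 0"
    using const[of s] vgh(2) AE_space by eventually_elim (simp add: v1)
  moreover have "continuous_on {0..1} (v1plus b \<omega>)"
    using gc by (rule continuous_on_cong[THEN iffD1, rotated 2]) (auto simp: v1)
  then have "inH (\<lambda>x. \<phi> s x - v1plus b \<omega> x)" by (intro inH_diff inH_phi continuous_on_inH)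
  ultimately show ?thesis using Hnorm_eq_0_iff by blast
qed

end

theorem theorem1:
  fixes b \<omega> :: real and \<phi> :: "real \<Rightarrow> real \<Rightarrow> real"
  assumes "b > 0" and "0 \<le> \<omega>" and "\<omega> < pi^2"
    and "complete_trajectory (F_P b \<omega>) \<phi>"
    and "\<exists>M. \<forall>t. Hnorm (\<phi> t) \<le> M"
    and "\<forall>t. AE x in lborel. 0 < x \<and> x < 1 \<longrightarrow> \<phi> t x \<ge> 0"
    and "\<not> (\<forall>t. Hnorm (\<phi> t) = 0)"
    and "\<not> (\<forall>t. Hnorm (\<lambda>x. \<phi> t x - v1plus b \<omega> x) = 0)"
  shows "\<exists>\<tau>. (\<forall>t\<le>\<tau>. Hnorm (\<phi> t) = 0) \<and>
             (\<exists>u. is_solution (F_lin b \<omega>) \<tau> (\<lambda>x. 0) u) \<and>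
             (\<forall>u. is_solution (F_lin b \<omega>) \<tau> (\<lambda>x. 0) u \<longrightarrow>
                  (\<forall>t\<ge>\<tau>. Hnorm (\<lambda>x. \<phi> t x - u t x) = 0))"
proof -
  obtain M where M: "\<And>t. Hnorm (\<phi> t) \<le> M" using assms(5) by blast
  interpret nonneg_trajectory b \<omega> M \<phi>
  proof
    show "AE x in U01. \<phi> t x \<ge> 0" for t using assms(6) unfolding AE_U01 by blast
  qed (fact assms(1,2,4) M)+
  \<comment> \<open>By \<open>nonzero_forward\<close> this set of times is upward closed, so its
    infimum is the switching time \<tau>.\<close>
  define S where "S = {t. Hnorm (\<phi> t) \<noteq> 0}"
  have up: "t \<in> S" if "s \<in> S" "s < t" for s t
    using nonzero_forward[of s t] that by (simp add: S_def)
  obtain t1 where t1: "t1 \<in> S" using assms(7) by (auto simp: S_def)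
  \<comment> \<open>Without a zero time the trajectory would be the stationary solution; any zero
    time bounds \<open>S\<close> from below.\<close>
  obtain t2 where t2: "t2 \<notin> S"
    using stationary_if_nonzero[OF _ assms(3)] assms(8) by (auto simp: S_def)
  have bdd: "bdd_below S"
  proof (rule bdd_belowI[of _ t2])
    fix s assume "s \<in> S"
    then show "t2 \<le> s" using up[of s t2] t2 by force
  qed
  define \<tau> where "\<tau> = Inf S"
  have after: "Hnorm (\<phi> t) \<noteq> 0" if "t > \<tau>" for t
  proof -
    have "S \<noteq> {}" using t1 by auto
    then have "\<exists>s\<in>S. s < t" using that unfolding \<tau>_def by (intro cInf_lessD)
    then obtain s where "s \<in> S" "s < t" by auto
    then show ?thesis using up by (auto simp: S_def)
  qed
  have before: "Hnorm (\<phi> t) = 0" if "t < \<tau>" for t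
    using that cInf_lower[OF _ bdd, of t] by (force simp: \<tau>_def S_def)
  \<comment> \<open>All earlier times are zero times, so continuity from the left decides the value
    at \<tau> itself.\<close>
  have at: "Hnorm (\<phi> \<tau>) = 0"
  proof -
    have "\<forall>\<^sub>F s in at_left \<tau>. Hnorm (\<phi> \<tau>) \<le> Hnorm (\<lambda>x. \<phi> s x - \<phi> \<tau> x)"
      unfolding eventually_at_filter
    proof (intro always_eventually allI impI)
      fix s assume "s \<in> {..<\<tau>}"
      then show "Hnorm (\<phi> \<tau>) \<le> Hnorm (\<lambda>x. \<phi> s x - \<phi> \<tau> x)"
        using before[of s] Hnorm_diff_le[OF inH_phi inH_phi, of s \<tau>] by simp
    qed
    moreover have "((\<lambda>s. Hnorm (\<lambda>x. \<phi> s x - \<phi> \<tau> x)) \<longlongrightarrow> 0) (at_left \<tau>)"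
      using continuous_phi by (rule tendsto_within_subset) simp
    ultimately have "Hnorm (\<phi> \<tau>) \<le> 0" by (intro tendsto_lowerbound) auto
    then show ?thesis using Hnorm_nonneg[of "\<phi> \<tau>"] by simp
  qed
  have sol: "is_solution (F_lin b \<omega>) \<tau> (\<lambda>x. 0) \<phi>" by (rule is_solution_linear[OF after at])
  have "Hnorm (\<lambda>x. \<phi> t x - u t x) = 0" if u: "is_solution (F_lin b \<omega>) \<tau> (\<lambda>x. 0) u" and t: "t \<ge> \<tau>" for u t
  proof (rule linear_evolution_unique[OF is_solution_imp_linear_evolution[OF sol] is_solution_imp_linear_evolution[OF u] assms(2,3) _ t])
    have "inH (u \<tau>)" "Hnorm (u \<tau>) = 0" using u by (auto simp: is_solution_def)
    then show "Hnorm (\<lambda>x. \<phi> \<tau> x - u \<tau> x) = 0"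
      using Hnorm_triangle_diff[OF inH_phi, of "u \<tau>" \<tau>] at Hnorm_nonneg[of "\<lambda>x. \<phi> \<tau> x - u \<tau> x"] by simp
  qed
  then show ?thesis using sol at before by (intro exI[of _ \<tau>]) (auto simp: le_less)
qed

end
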